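(* Let $d\ge 1$, $s\in(0,1]$ and $T>0$. Let $\Psi:\mathbb{R}^d\to\mathbb{R}$ be non-negative with $\Psi\in C^{1,1}(\mathbb{R}^d)\cap C^{2,1}(\mathbb{R}^d)$. Let $f_0\ge 0$ satisfy $f_0\in \mathcal{P}^2_a(\mathbb{R}^{2d})\cap L^p(\mathbb{R}^{2d})$ for some $1<p\le\infty$ and $\int_{\mathbb{R}^{2d}} f_0(x,v)\Psi(v)\,dx\,dv<\infty$. Then there exists a weak solution $f(x,v,t)$ on $\mathbb{R}^{2d}\times(0,T)$ of the fractional kinetic Fokker–Planck equation $$\partial_t f+v\cdot\nabla_x f=\mathrm{div}_v(\nabla\Psi(v) f)-(-\Delta_v)^s f,\qquad f(x,v,0)=f_0(x,v),$$ i.e. a measurable function $f$ on $\mathbb{R}^{2d}\times(0,T)$ such that: (1) $\int_{\mathbb{R}^{2d}} f(x,v,t)\,dx\,dv=\int_{\mathbb{R}^{2d}} f_0(x,v)\,dx\,dv=1$ for any $t\in(0,T)$; (2) $f(x,v,t)\ge 0$ for a.e. $(x,v,t)\in\mathbb{R}^{2d}\times(0,T)$; (3) for every $\varphi\in C_c^\infty(\mathbb{R}^{2d}\times(-T,T))$, $$\int_0^T\!\!\int_{\mathbb{R}^{2d}} f(x,v,t)\big(\partial_t\varphi+v\cdot\nabla_x\varphi-\nabla_v\Psi(v)\cdot\nabla_v\varphi-(-\Delta_v)^s\varphi\big)\,dx\,dv\,dt+\int_{\mathbb{R}^{2d}} f_0(x,v)\varphi(0,x,v)\,dx\,dv=0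.$$
   Context: $\mathcal{P}^2_a(\mathbb{R}^{2d})$ denotes the set of probability measures on $\mathbb{R}^{2d}$ with finite second moment that are absolutely continuous with respect to Lebesgue measure (identified with their densities). Points of $\mathbb{R}^{2d}$ are written $(x,v)$ with $x,v\in\mathbb{R}^d$; subscripts $x$, $v$ on differential operators indicate the variable they act on. The fractional Laplacian in $v$ is $-(-\Delta_v)^s g:=-\mathcal{F}^{-1}(|\xi|^{2s}\mathcal{F}[g](\xi))$, where $\mathcal F$ is the Fourier transform in $v$; for $0<s<1$ equivalently $-(-\Delta)^s g(v)=-C_{d,s}\int_{\mathbb{R}^d}\frac{g(v)-g(w)}{|v-w|^{d+2s}}\,dw$ with $C_{d,s}=s2^{2s}\Gamma(\frac{d+2s}{2})/(\pi^{d/2}\Gamma(1-s))$. $C^{k,1}$ denotes $C^k$ functions whose $k$-th derivatives are Lipschitz. *)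

theory Defs
  imports "HOL-Analysis.Analysis"
begin

definition partial :: "'b::euclidean_space \<Rightarrow> ('b \<Rightarrow> real) \<Rightarrow> 'b \<Rightarrow> real" where
  "partial b g x = deriv (\<lambda>h. g (x + h *\<^sub>R b)) 0"

definition iter_partial :: "'b::euclidean_space list \<Rightarrow> ('b \<Rightarrow> real) \<Rightarrow> 'b \<Rightarrow> real" where
  "iter_partial bs g = foldr partial bs g"

(* C^\<infinity>: every iterated partial derivative exists and is (Frechet) differentiable everywhere
   (hence all partial derivatives of all orders exist and are continuous). *)
definition smooth_fun :: "('b::euclidean_space \<Rightarrow> real) \<Rightarrow> bool" where
  "smooth_fun g \<longleftrightarrow> (\<forall>bs. set bs \<subseteq> Basis \<longrightarrow> (\<forall>x. iter_partial bs g differentiable (at x)))"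

definition test_fun :: "real \<Rightarrow> ('a::euclidean_space \<times> 'a \<times> real \<Rightarrow> real) \<Rightarrow> bool" where
  "test_fun T \<phi> \<longleftrightarrow> smooth_fun \<phi> \<and> compact (closure {p. \<phi> p \<noteq> 0})
      \<and> closure {p. \<phi> p \<noteq> 0} \<subseteq> UNIV \<times> UNIV \<times> {-T<..<T}"

definition laplacian :: "('a::euclidean_space \<Rightarrow> real) \<Rightarrow> 'a \<Rightarrow> real" where
  "laplacian g v = (\<Sum>b\<in>Basis. deriv (\<lambda>h. deriv (\<lambda>k. g (v + k *\<^sub>R b)) h) 0)"

definition frac_const :: "nat \<Rightarrow> real \<Rightarrow> real" where
  "frac_const d s = s * 2 powr (2 * s) * Gamma ((real d + 2 * s) / 2)
                     / (pi powr (real d / 2) * Gamma (1 - s))"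

(* (-\<Delta>)^s g (v).  For 0<s<1 via the (symmetrised) singular integral
     (-\<Delta>)^s g(v) = -(C_{d,s}/2) \<integral> (g(v+z)+g(v-z)-2g(v)) / |z|^{d+2s} dz,
   which equals C_{d,s} p.v.\<integral> (g(v)-g(w))/|v-w|^{d+2s} dw;  for s = 1 it is -\<Delta> g. *)
definition frac_lap :: "real \<Rightarrow> ('a::euclidean_space \<Rightarrow> real) \<Rightarrow> 'a \<Rightarrow> real" where
  "frac_lap s g v =
     (if s = 1 then - laplacian g v
      else - (frac_const DIM('a) s / 2) *
        (\<integral>z. (g (v + z) + g (v - z) - 2 * g v) / norm z powr (real DIM('a) + 2 * s) \<partial>lborel))"

definition weak_op :: "real \<Rightarrow> ('a::euclidean_space \<Rightarrow> 'a) \<Rightarrow> ('a \<times> 'a \<times> real \<Rightarrow> real)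
                        \<Rightarrow> 'a \<times> 'a \<times> real \<Rightarrow> real" where
  "weak_op s gradPsi \<phi> p = (case p of (x, v, t) \<Rightarrow>
       deriv (\<lambda>\<tau>. \<phi> (x, v, \<tau>)) t
     + deriv (\<lambda>h. \<phi> (x + h *\<^sub>R v, v, t)) 0
     - deriv (\<lambda>h. \<phi> (x, v + h *\<^sub>R gradPsi v, t)) 0
     - frac_lap s (\<lambda>w. \<phi> (x, w, t)) v)"

definition P2a_density :: "('a::euclidean_space \<times> 'a \<Rightarrow> real) \<Rightarrow> bool" where
  "P2a_density f0 \<longleftrightarrow> f0 \<in> borel_measurable lebesgue \<and> (AE z in lebesgue. f0 z \<ge> 0)
      \<and> integrable lebesgue f0 \<and> (\<integral>z. f0 z \<partial>lebesgue) = 1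
      \<and> integrable lebesgue (\<lambda>z. (norm z)\<^sup>2 * f0 z)"

definition Lp_some :: "('a::euclidean_space \<Rightarrow> real) \<Rightarrow> bool" where
  "Lp_some g \<longleftrightarrow> g \<in> borel_measurable lebesgue \<and>
     ((\<exists>p::real. p > 1 \<and> integrable lebesgue (\<lambda>z. \<bar>g z\<bar> powr p))
      \<or> (\<exists>C. AE z in lebesgue. \<bar>g z\<bar> \<le> C))"

definition C11_C21 :: "('a::euclidean_space \<Rightarrow> real) \<Rightarrow> ('a \<Rightarrow> 'a) \<Rightarrow> bool" where
  "C11_C21 Psi gradPsi \<longleftrightarrow>
     (\<forall>v. (Psi has_derivative (\<lambda>h. gradPsi v \<bullet> h)) (at v))
     \<and> (\<exists>L. L-lipschitz_on UNIV gradPsi)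
     \<and> (\<exists>H :: 'a \<Rightarrow> ('a \<Rightarrow>\<^sub>L 'a). (\<forall>v. (gradPsi has_derivative blinfun_apply (H v)) (at v))
                                 \<and> (\<exists>L. L-lipschitz_on UNIV H))"

end

theory Submission
  imports Defs "HOL-Probability.Probability"
begin

text \<open>
The solution is a limit of laws of a discrete-time Markov chain. In a step of length $h$ the chain
moves, each with a prescribed probability, along the drift $b(x,v) = (v, -\nabla\Psi(v))$, jumps in
the variable $v$ by a symmetric law $\kappa_n$, or stays put; the jump laws, used at rate $r_n$,
approximate $-(-\Delta_v)^s$ uniformly on test functions (truncated and normalised L\'evy densities
for $s < 1$, coordinate jumps for $s = 1$). The drift map expands distances by at least $1 - 2hL$, so
the volume of the preimage of a set is controlled, and a bound $\mu(A) \le c + K|A|$ propagates along the chain with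
only $K$ growing, by a factor that stays bounded as $h \to 0$. Since the parallelogram identity gives
$\ln(1+|z+q|^2) + \ln(1+|z-q|^2) \le 2\ln(1+|z|^2) + 2\ln(1+|q|^2)$, logarithmic moments also stay
bounded. Hence the space-time laws are uniformly integrable and tight. Compactness in a product of
intervals indexed by sets yields a filter along which the laws of all sets converge; uniform
integrability makes the limit countably additive and absolutely continuous, and its density is the
solution. Telescoping the expectations of a test function along the chain gives the weak equation,
and the time marginal gives mass one for almost every time; the remaining times form a null set, on
which the solution may be redefined.
\<close>

section \<open>Volume of preimages under expanding maps\<close>

text \<open>The weak equation is linear in \<open>f\<close> and integrates over time, so convergence
  of the space-time laws against bounded functions suffices; neither compactness at a fixed time nor
  regularity of the solution is sought. Two obstacles fix the estimates. For s < 1 the jumps have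
  infinite variance, so tightness is measured by ln(1+|z|^2), whose moment under the tails of the
  Levy density is finite for every s > 0. And concentration has to be excluded using only what a
  step preserves: translations keep volume, the drift distorts it by 1 + O(h), and both respect
  bounds of the form mu(A) <= c + K|A|. Cutting the initial density at height K makes c as small as
  desired, and a bound with arbitrarily small c is uniform integrability once mass far away has been
  controlled. The rates r_n may diverge: only r_n times the logarithmic moment of one jump has to
  stay bounded, and h is chosen after r_n.\<close>

lemma emeasure_lborel_ball_scale:
  fixes x y :: "'b::euclidean_space"
  assumes "0 < B"
  shows "emeasure lborel (ball x (B * r)) = ennreal (B ^ DIM('b)) * emeasure lborel (ball y r)"
proof (cases "r \<le> 0")
  case True
  then have "B * r \<le> 0"
    using assms by (simp add: mult_nonneg_nonpos)
  then show ?thesis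
    using True by (simp add: ball_empty)
next
  case False
  then show ?thesis
    using assms by (simp add: emeasure_ball ennreal_mult' power_mult_distrib unit_ball_vol_nonneg ac_simps)
qed

text \<open>Countable subadditivity for an arbitrary countable index set; the Vitali balls below are
  indexed by pairs, not by natural numbers.\<close>

lemma emeasure_UN_countable_le:
  assumes X: "\<And>i. i \<in> I \<Longrightarrow> X i \<in> sets M" and I: "countable I"
  shows "emeasure M (\<Union>i\<in>I. X i) \<le> (\<integral>\<^sup>+i. emeasure M (X i) \<partial>count_space I)"
proof -
  have "emeasure M (\<Union>i\<in>I. X i) = (\<integral>\<^sup>+x. indicator (\<Union>i\<in>I. X i) x \<partial>M)"
    using X I by (subst nn_integral_indicator) (auto intro!: sets.countable_UN')
  also have "\<dots> \<le> (\<integral>\<^sup>+x. (\<integral>\<^sup>+i. indicator (X i) x \<partial>count_space I) \<partial>M)"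
  proof (rule nn_integral_mono)
    fix x
    show "indicator (\<Union>i\<in>I. X i) x \<le> (\<integral>\<^sup>+i. indicator (X i) x \<partial>count_space I)"
    proof (cases "x \<in> (\<Union>i\<in>I. X i)")
      case True
      then obtain i where i: "i \<in> I" "x \<in> X i" by auto
      then show ?thesis
        using nn_integral_ge_point[of i I "\<lambda>i. indicator (X i) x"] by (simp add: indicator_def)
    qed simp
  qed
  also have "\<dots> = (\<integral>\<^sup>+i. (\<integral>\<^sup>+x. indicator (X i) x \<partial>M) \<partial>count_space I)"
    using X I by (subst nn_integral_count_space_nn_integral) auto
  also have "\<dots> = (\<integral>\<^sup>+i. emeasure M (X i) \<partial>count_space I)"
    using X by (intro nn_integral_cong) simp
  finally show ?thesis .
qed

text \<open>The map need not be onto: a Vitali cover of the part of the range inside $U$ by disjoint balls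
pulls back to balls whose radii grow by the factor $B$, and the uncovered null set has a null
preimage because the inverse is Lipschitz.\<close>

lemma emeasure_vimage_open_expanding:
  fixes T :: "'b::euclidean_space \<Rightarrow> 'b"
  assumes B: "0 < B"
    and expand: "\<And>x y. norm (x - y) \<le> B * norm (T x - T y)"
    and cont: "continuous_on UNIV T"
    and U: "open U"
  shows "emeasure lborel (T -` U) \<le> ennreal (B ^ DIM('b)) * emeasure lborel U"
proof -
  \<comment> \<open>Balls are indexed by a point of the domain and a radius in the range, so every
    Vitali ball comes with a known preimage of its centre.\<close>
  define K where "K = {(x, r). 0 < r \<and> ball (T x) r \<subseteq> U}"
  have cover: "\<exists>i. i \<in> K \<and> z \<in> ball (T (fst i)) (snd i) \<and> snd i < d"
    if "z \<in> U \<inter> range T" "0 < d" for z d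
  proof -
    from that obtain x where x: "z = T x" by auto
    have "z \<in> U" using that by simp
    then obtain e where e: "e > 0" "ball z e \<subseteq> U"
      using openE[OF U] by metis
    have "ball z (min e (d/2)) \<subseteq> U" using e by (auto simp: ball_def)
    with e that x show ?thesis
      by (intro exI[of _ "(x, min e (d/2))"]) (auto simp: K_def)
  qed
  obtain C where C: "countable C" "C \<subseteq> K"
     "pairwise (\<lambda>i j. disjnt (ball (T (fst i)) (snd i)) (ball (T (fst j)) (snd j))) C"
     "negligible (U \<inter> range T - (\<Union>i \<in> C. ball (T (fst i)) (snd i)))" (is "negligible ?N")
    using Vitali_covering_theorem_balls[of "U \<inter> range T" K "\<lambda>i. T (fst i)" snd] cover by blast
  have injT: "inj T"
  proof (rule injI)
    fix x y assume "T x = T y"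
    with expand[of x y] show "x = y" by simp
  qed
  have "negligible (inv T ` ?N)"
  proof (rule negligible_locally_Lipschitz_image)
    show "negligible ?N" by (rule C(4))
    fix z assume z: "z \<in> ?N"
    have "norm (inv T y - inv T z) \<le> B * norm (y - z)" if "y \<in> ?N" for y
      using expand[of "inv T y" "inv T z"] that z by (auto simp: inv_f_f[OF injT])
    then show "\<exists>V B. open V \<and> z \<in> V \<and> (\<forall>y\<in>?N \<inter> V. norm (inv T y - inv T z) \<le> B * norm (y - z))"
      by (intro exI[of _ UNIV] exI[of _ B]) auto
  qed simp
  moreover have "T -` ?N \<subseteq> inv T ` ?N"
    by (metis (no_types, lifting) image_eqI injT inv_f_f subsetI vimageD)
  ultimately have neg: "negligible (T -` ?N)"
    by (rule negligible_subset)
  have "T -` U \<subseteq> T -` ?N \<union> (\<Union>i\<in>C. ball (fst i) (B * snd i))"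
  proof
    fix x assume x: "x \<in> T -` U"
    show "x \<in> T -` ?N \<union> (\<Union>i\<in>C. ball (fst i) (B * snd i))"
    proof (cases "x \<in> T -` ?N")
      case False
      with x obtain i where i: "i \<in> C" "T x \<in> ball (T (fst i)) (snd i)" by auto
      have "dist (fst i) x \<le> B * dist (T (fst i)) (T x)"
        using expand[of "fst i" x] by (simp add: dist_norm)
      also have "\<dots> < B * snd i" using i B by simp
      finally show ?thesis using i by auto
    qed simp
  qed
  \<comment> \<open>The estimate passes through \<open>lebesgue\<close> because a negligible set
    need not be Borel; it returns to \<open>lborel\<close> once the null part is gone.\<close>
  then have "emeasure lebesgue (T -` U) \<le> emeasure lebesgue (T -` ?N \<union> (\<Union>i\<in>C. ball (fst i) (B * snd i)))"
    using neg C(1)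
    by (intro emeasure_mono sets.Un sets.countable_UN') (auto intro: negligible_imp_sets)
  also have "\<dots> \<le> emeasure lebesgue (T -` ?N) + emeasure lebesgue (\<Union>i\<in>C. ball (fst i) (B * snd i))"
    using neg C(1)
    by (intro emeasure_subadditive sets.countable_UN') (auto intro: negligible_imp_sets)
  also have "\<dots> = emeasure lebesgue (\<Union>i\<in>C. ball (fst i) (B * snd i))"
    using null_setsD1[OF neg[unfolded negligible_iff_null_sets]] by (simp only: add_0_left)
  also have "\<dots> = emeasure lborel (\<Union>i\<in>C. ball (fst i) (B * snd i))"
  proof -
    have "(\<Union>i\<in>C. ball (fst i) (B * snd i)) \<in> sets lborel"
      by (simp add: borel_open open_UN)
    then show ?thesis by simp
  qed
  also have "\<dots> \<le> (\<integral>\<^sup>+i. emeasure lborel (ball (fst i) (B * snd i)) \<partial>count_space C)"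
    by (rule emeasure_UN_countable_le) (use C in auto)
  also have "\<dots> = (\<integral>\<^sup>+i. ennreal (B ^ DIM('b)) * emeasure lborel (ball (T (fst i)) (snd i)) \<partial>count_space C)"
    by (intro nn_integral_cong emeasure_lborel_ball_scale B)
  also have "\<dots> = ennreal (B ^ DIM('b)) * (\<integral>\<^sup>+i. emeasure lborel (ball (T (fst i)) (snd i)) \<partial>count_space C)"
    by (rule nn_integral_cmult) simp
  also have "(\<integral>\<^sup>+i. emeasure lborel (ball (T (fst i)) (snd i)) \<partial>count_space C)
      = emeasure lborel (\<Union>i\<in>C. ball (T (fst i)) (snd i))"
    by (rule emeasure_UN_countable[symmetric])
      (use C in \<open>auto simp: disjoint_family_on_def pairwise_def disjnt_def\<close>)
  also have "\<dots> \<le> emeasure lborel U"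
    using C(2) U by (intro emeasure_mono UN_least) (auto simp: K_def subset_iff)
  finally have "emeasure lebesgue (T -` U) \<le> ennreal (B ^ DIM('b)) * emeasure lborel U"
    by (simp add: mult_left_mono)
  moreover have "T -` U \<in> sets lborel"
    using U cont by (simp add: borel_open open_vimage)
  ultimately show ?thesis by simp
qed

text \<open>Outer regularity reduces Borel sets to the open case. The excess \<open>U - A\<close> is
  taken below \<open>e / c\<close> so that multiplication by \<open>c\<close>, the power of
  \<open>B\<close>, leaves at most \<open>e\<close>.\<close>

lemma emeasure_vimage_expanding:
  fixes T :: "'b::euclidean_space \<Rightarrow> 'b"
  assumes B: "0 < B"
    and expand: "\<And>x y. norm (x - y) \<le> B * norm (T x - T y)"
    and cont: "continuous_on UNIV T"
    and A: "A \<in> sets borel"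
  shows "emeasure lborel (T -` A) \<le> ennreal (B ^ DIM('b)) * emeasure lborel A"
proof (rule ennreal_le_epsilon)
  fix e :: real assume e: "0 < e"
  define c where "c = B ^ DIM('b)"
  have c: "c > 0" using B by (simp add: c_def)
  obtain U where U: "open U" "A \<subseteq> U" "emeasure lborel (U - A) < e / c"
    using outer_regular_lborel[OF A, of "e / c"] e c by auto
  have "emeasure lborel (T -` A) \<le> emeasure lborel (T -` U)"
    using U cont by (intro emeasure_mono) (auto simp: borel_open open_vimage)
  also have "\<dots> \<le> ennreal c * emeasure lborel U"
    unfolding c_def by (rule emeasure_vimage_open_expanding[OF B expand cont U(1)])
  also have "emeasure lborel U \<le> emeasure lborel A + emeasure lborel (U - A)"
  proof -
    have "emeasure lborel U = emeasure lborel (A \<union> (U - A))"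
      using U by (intro arg_cong[where f = "emeasure lborel"]) auto
    also have "\<dots> \<le> emeasure lborel A + emeasure lborel (U - A)"
      using U A by (intro emeasure_subadditive) auto
    finally show ?thesis .
  qed
  also have "emeasure lborel (U - A) \<le> ennreal (e / c)" using U by simp
  finally have "emeasure lborel (T -` A) \<le> ennreal c * (emeasure lborel A + ennreal (e / c))"
    by (simp add: mult_left_mono add_left_mono)
  also have "\<dots> = ennreal c * emeasure lborel A + ennreal e"
    using c e by (simp add: distrib_left ennreal_mult'[symmetric])
  finally show "emeasure lborel (T -` A) \<le> ennreal (B ^ DIM('b)) * emeasure lborel A + ennreal e"
    by (simp add: c_def)
qed

section \<open>Weak limits of uniformly integrable laws\<close>

text \<open>Tychonoff: the sequence, viewed as points of a product of compact intervals, has a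
  cluster point \<open>L\<close>. For an uncountable index type a convergent subsequence need not
  exist, so the neighbourhoods of \<open>L\<close> are pulled back to the indices instead.\<close>

lemma subfilter_all_convergent:
  fixes X :: "'i \<Rightarrow> nat \<Rightarrow> real"
  assumes bdd: "\<And>i. bounded (range (X i))"
  obtains H L where "H \<noteq> bot" "H \<le> sequentially" "\<And>i. (X i \<longlongrightarrow> L i) H"
proof -
  have "\<exists>B. \<forall>n. \<bar>X i n\<bar> \<le> B" for i
    using bdd[of i] by (auto simp: bounded_iff)
  then obtain B where B: "\<And>i n. \<bar>X i n\<bar> \<le> B i"
    by metis
  define S where "S = PiE UNIV (\<lambda>i. {- B i..B i})"
  have "compactin (product_topology (\<lambda>i. euclideanreal) UNIV) S"
    unfolding S_def compactin_PiE by auto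
  then have "compact S"
    by (simp add: euclidean_product_topology)
  define F where "F = filtermap (\<lambda>n i. X i n) sequentially"
  have "F \<noteq> bot"
    by (simp add: F_def filtermap_bot_iff)
  moreover have "eventually (\<lambda>x. x \<in> S) F"
    unfolding F_def S_def eventually_filtermap
    using B by (intro always_eventually allI PiE_I) (auto simp: abs_le_iff minus_le_iff)
  ultimately obtain L where L: "inf (nhds L) F \<noteq> bot"
    using \<open>compact S\<close> unfolding compact_filter by blast
  \<comment> \<open>Indices whose point is close to \<open>L\<close>, met with
    \<open>sequentially\<close> so that ordinary limits persist along \<open>H\<close>.\<close>
  define H where "H = inf (filtercomap (\<lambda>n i. X i n) (nhds L)) sequentially"
  have "H \<noteq> bot"
  proof
    assume "H = bot"
    then have "eventually (\<lambda>_. False) H" by simp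
    then obtain P Q where "eventually P (filtercomap (\<lambda>n i. X i n) (nhds L))"
      "eventually Q sequentially" and PQ: "\<And>n. P n \<Longrightarrow> Q n \<Longrightarrow> False"
      unfolding H_def eventually_inf by auto
    then obtain P' where P': "eventually P' (nhds L)" "\<And>n. P' (\<lambda>i. X i n) \<Longrightarrow> P n"
      unfolding eventually_filtercomap by auto
    \<comment> \<open>If a tail of the indices avoided the pulled back neighbourhood,
      \<open>F\<close> would eventually lie outside a neighbourhood of \<open>L\<close>, against the
      choice of \<open>L\<close>.\<close>
    have "eventually (\<lambda>x. \<not> P' x) F"
      unfolding F_def eventually_filtermap
      using \<open>eventually Q sequentially\<close> by eventually_elim (use P' PQ in blast)
    with P' have "eventually (\<lambda>_. False) (inf (nhds L) F)"
      unfolding eventually_inf by blast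
    with L show False by (simp add: eventually_False)
  qed
  moreover have "H \<le> sequentially" by (simp add: H_def)
  moreover have "(X i \<longlongrightarrow> L i) H" for i
  proof -
    have "filterlim (\<lambda>n i. X i n) (nhds L) H"
      unfolding H_def by (intro filterlim_inf[THEN iffD2] filterlim_mono[OF filterlim_filtercomap order.refl inf_le1])
    moreover have "\<forall>\<^sub>F x in nhds L. x i \<in> S" if "open S" "L i \<in> S" for S
      unfolding eventually_nhds
      using that open_vimage[OF \<open>open S\<close> continuous_on_product_coordinates[of i]]
      by (intro exI[of _ "(\<lambda>x. x i) -` S"]) auto
    ultimately show ?thesis
      by (intro topological_tendstoI) (auto simp: filterlim_iff[of "\<lambda>n i. X i n"])
  qed
  ultimately show thesis using that by blast
qed

text \<open>Rounding \<open>g\<close> down to multiples of \<open>d\<close> is a uniform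
  approximation with finitely many levels, and its integral is a finite combination of measures of
  sets. Boundedness of \<open>g\<close> makes the number of levels finite; no topology on the space
  enters.\<close>

lemma integral_tendsto_of_measure_tendsto:
  fixes M :: "'n \<Rightarrow> 'b measure" and g :: "'b \<Rightarrow> real"
  assumes M: "\<And>n. prob_space (M n)" "\<And>n. sets (M n) = sets S"
    and N: "prob_space N" "sets N = sets S"
    and lim: "\<And>A. A \<in> sets S \<Longrightarrow> ((\<lambda>n. measure (M n) A) \<longlongrightarrow> measure N A) H"
    and g: "g \<in> borel_measurable S" "\<And>x. \<bar>g x\<bar> \<le> C"
  shows "((\<lambda>n. integral\<^sup>L (M n) g) \<longlongrightarrow> integral\<^sup>L N g) H"
proof (rule tendstoI)
  fix e :: real assume e: "0 < e"
  define d where "d = e / 3"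
  have d: "d > 0" using e by (simp add: d_def)
  \<comment> \<open>Since \<open>\<bar>g x / d\<bar>\<close> is at most \<open>C / d\<close>, every
    rounded value lies between \<open>-k\<close> and \<open>k\<close>.\<close>
  define k :: int where "k = \<lceil>C / d\<rceil> + 1"
  define G where "G x = (\<Sum>j\<in>{-k..k}. d * real_of_int j * indicator {x \<in> space S. \<lfloor>g x / d\<rfloor> = j} x)" for x
  have sets: "{x \<in> space S. \<lfloor>g x / d\<rfloor> = j} \<in> sets S" for j
    using g(1) by measurable
  have G: "G x = d * real_of_int \<lfloor>g x / d\<rfloor>" if "x \<in> space S" for x
  proof -
    have "\<bar>g x / d\<bar> \<le> C / d" using g(2)[of x] d by (simp add: divide_right_mono)
    then have "\<lfloor>g x / d\<rfloor> \<in> {-k..k}" unfolding k_def by (auto; linarith)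
    then have "(\<Sum>j\<in>{-k..k}. d * real_of_int j * indicator {x \<in> space S. \<lfloor>g x / d\<rfloor> = j} x)
       = (\<Sum>j\<in>{\<lfloor>g x / d\<rfloor>}. d * real_of_int j * indicator {x \<in> space S. \<lfloor>g x / d\<rfloor> = j} x)"
      by (intro sum.mono_neutral_right) (auto simp: indicator_def)
    with that show ?thesis by (simp add: G_def)
  qed
  have Gg: "\<bar>g x - G x\<bar> \<le> d" if "x \<in> space S" for x
  proof -
    have "\<bar>g x / d - real_of_int \<lfloor>g x / d\<rfloor>\<bar> \<le> 1" by linarith
    then have "d * \<bar>g x / d - real_of_int \<lfloor>g x / d\<rfloor>\<bar> \<le> d * 1" 
      using d by (intro mult_left_mono) auto
    also have "d * \<bar>g x / d - real_of_int \<lfloor>g x / d\<rfloor>\<bar> = \<bar>d * (g x / d - real_of_int \<lfloor>g x / d\<rfloor>)\<bar>"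
      using d by (simp add: abs_mult)
    also have "d * (g x / d - real_of_int \<lfloor>g x / d\<rfloor>) = g x - G x"
      using d that by (simp add: G algebra_simps)
    finally show ?thesis by simp
  qed
  have *: "integral\<^sup>L Q G = (\<Sum>j\<in>{-k..k}. d * real_of_int j * measure Q {x \<in> space S. \<lfloor>g x / d\<rfloor> = j})"
     "\<bar>integral\<^sup>L Q g - integral\<^sup>L Q G\<bar> \<le> d"
    if Q: "prob_space Q" "sets Q = sets S" for Q
  proof -
    interpret Q: prob_space Q by fact
    have [simp]: "space Q = space S" using Q(2) by (rule sets_eq_imp_space_eq)
    have meas: "{x \<in> space S. \<lfloor>g x / d\<rfloor> = j} \<in> sets Q" for j using sets Q(2) by simp
    have [simp]: "{x \<in> space S. \<lfloor>g x / d\<rfloor> = j} \<inter> space S = {x \<in> space S. \<lfloor>g x / d\<rfloor> = j}" for j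
      by auto
    have "integrable Q (\<lambda>x. d * real_of_int j * indicator {x \<in> space S. \<lfloor>g x / d\<rfloor> = j} x)" for j
      using meas by (intro integrable_mult_right) (simp add: integrable_indicator_iff Q.emeasure_finite less_top[symmetric])
    moreover have "integral\<^sup>L Q (\<lambda>x. d * real_of_int j * indicator {x \<in> space S. \<lfloor>g x / d\<rfloor> = j} x)
       = d * real_of_int j * measure Q {x \<in> space S. \<lfloor>g x / d\<rfloor> = j}" for j
      using meas by (subst integral_mult_right_zero) (auto intro!: arg_cong[where f="measure Q"])
    ultimately show 1: "integral\<^sup>L Q G = (\<Sum>j\<in>{-k..k}. d * real_of_int j * measure Q {x \<in> space S. \<lfloor>g x / d\<rfloor> = j})"
      unfolding G_def[abs_def] by (subst Bochner_Integration.integral_sum) auto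
    have iG: "integrable Q G"
      unfolding G_def[abs_def]
      using \<open>\<And>j. integrable Q (\<lambda>x. d * real_of_int j * indicator {x \<in> space S. \<lfloor>g x / d\<rfloor> = j} x)\<close>
      by (intro Bochner_Integration.integrable_sum) auto
    have gQ: "g \<in> borel_measurable Q" using g(1) Q(2) measurable_cong_sets by blast
    have ig: "integrable Q g"
      by (rule Q.integrable_const_bound[of _ C]) (use g gQ in auto)
    have "\<bar>integral\<^sup>L Q g - integral\<^sup>L Q G\<bar> = \<bar>integral\<^sup>L Q (\<lambda>x. g x - G x)\<bar>"
      using ig iG by simp
    also have "\<dots> \<le> integral\<^sup>L Q (\<lambda>x. \<bar>g x - G x\<bar>)"
      by (rule integral_abs_bound)
    also have "\<dots> \<le> integral\<^sup>L Q (\<lambda>x. d)"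
      using Gg ig iG by (intro integral_mono) auto
    also have "\<dots> = d" using Q.prob_space by simp
    finally show "\<bar>integral\<^sup>L Q g - integral\<^sup>L Q G\<bar> \<le> d" .
  qed
  have "((\<lambda>n. integral\<^sup>L (M n) G) \<longlongrightarrow> integral\<^sup>L N G) H"
    unfolding *(1)[OF M] *(1)[OF N] by (intro tendsto_intros lim sets)
  then have "\<forall>\<^sub>F n in H. dist (integral\<^sup>L (M n) G) (integral\<^sup>L N G) < d"
    using d by (rule tendstoD)
  then show "\<forall>\<^sub>F n in H. dist (integral\<^sup>L (M n) g) (integral\<^sup>L N g) < e"
  proof eventually_elim
    case (elim n)
    with *(2)[OF M, of n] *(2)[OF N] show ?case unfolding dist_real_def d_def by linarith
  qed
qed

text \<open>A filter finer than \<open>sequentially\<close> replaces a subsequence: no countable family of sets has to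
be singled out.\<close>

theorem weak_L1_limit:
  fixes M :: "nat \<Rightarrow> 'b::euclidean_space measure"
  assumes M: "\<And>n. prob_space (M n)" "\<And>n. sets (M n) = sets borel"
    and UI: "\<And>e. 0 < e \<Longrightarrow> \<exists>K R. \<forall>n. \<forall>A\<in>sets borel. measure (M n) A \<le> e + K * measure lborel (A \<inter> cball 0 R)"
  obtains H and D :: "'b \<Rightarrow> real" where "H \<noteq> bot" "H \<le> sequentially" "D \<in> borel_measurable borel" "\<And>x. 0 \<le> D x"
    "integrable lborel D" "integral\<^sup>L lborel D = 1"
    "\<And>(g :: 'b \<Rightarrow> real) C. g \<in> borel_measurable borel \<Longrightarrow> (\<And>x. \<bar>g x\<bar> \<le> C) \<Longrightarrow>
       ((\<lambda>n. integral\<^sup>L (M n) g) \<longlongrightarrow> (\<integral>x. D x * g x \<partial>lborel)) H"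
proof -
  have "bounded (range (\<lambda>n. measure (M n) A))" for A
    using prob_space.prob_le_1[OF M(1)] by (intro boundedI[where B=1]) auto
  then obtain H m where H: "H \<noteq> bot" "H \<le> sequentially"
    and m: "\<And>A. ((\<lambda>n. measure (M n) A) \<longlongrightarrow> m A) H"
    using subfilter_all_convergent[of "\<lambda>A n. measure (M n) A"] by metis
  have m_nonneg: "0 \<le> m A" for A
    using H(1) by (intro tendsto_lowerbound[OF m]) auto
  \<comment> \<open>The bound passes to the limit because its constants do not depend on
    \<open>n\<close>.\<close>
  have m_UI: "\<exists>K\<ge>0. \<exists>R. \<forall>A\<in>sets borel. m A \<le> e + K * measure lborel (A \<inter> cball 0 R)" if e: "0 < e" for e
  proof -
    obtain K R where KR: "\<And>n A. A \<in> sets borel \<Longrightarrow> measure (M n) A \<le> e + K * measure lborel (A \<inter> cball 0 R)"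
      using UI[OF e] by blast
    have "m A \<le> e + max K 0 * measure lborel (A \<inter> cball 0 R)" if "A \<in> sets borel" for A
    proof (rule tendsto_upperbound[OF m _ H(1)], rule always_eventually, rule allI)
      fix n
      have "K * measure lborel (A \<inter> cball 0 R) \<le> max K 0 * measure lborel (A \<inter> cball 0 R)"
        by (intro mult_right_mono) auto
      with KR[OF that, of n] show "measure (M n) A \<le> e + max K 0 * measure lborel (A \<inter> cball 0 R)"
        by linarith
    qed
    then show ?thesis by (intro exI[of _ "max K 0"]) auto
  qed
  have m_add: "m (A \<union> B) = m A + m B" if "A \<in> sets borel" "B \<in> sets borel" "A \<inter> B = {}" for A B
  proof (rule tendsto_unique[OF H(1) m])
    have "measure (M n) (A \<union> B) = measure (M n) A + measure (M n) B" for n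
    proof -
      interpret prob_space "M n" by (rule M)
      show ?thesis using that M(2) by (intro finite_measure_Union) auto
    qed
    then show "((\<lambda>n. measure (M n) (A \<union> B)) \<longlongrightarrow> m A + m B) H"
      by (auto intro!: tendsto_intros m)
  qed
  have m_empty: "m {} = 0"
    using tendsto_unique[OF H(1) m[of "{}"], of 0] by simp
  have m_UNIV: "m UNIV = 1"
  proof (rule tendsto_unique[OF H(1) m])
    have "measure (M n) UNIV = 1" for n
      using prob_space.prob_space[OF M(1)[of n]] sets_eq_imp_space_eq[OF M(2)[of n]] by simp
    then show "((\<lambda>n. measure (M n) UNIV) \<longlongrightarrow> 1) H" by simp
  qed
  \<comment> \<open>With finite additivity at hand, continuity at the empty set is enough. For a
    decreasing sequence with empty intersection the volume inside the ball tends to 0, the ball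
    having finite volume, and \<open>m_UI\<close> turns this into smallness of
    \<open>m\<close>.\<close>
  have "countably_additive (sets borel) (\<lambda>A. ennreal (m A))"
  proof (rule sets.empty_continuous_imp_countably_additive)
    show "positive (sets borel) (\<lambda>A. ennreal (m A))" by (simp add: positive_def m_empty)
    show "additive (sets borel) (\<lambda>A. ennreal (m A))"
      by (auto simp: additive_def m_add m_nonneg)
    fix A :: "nat \<Rightarrow> 'b set"
    assume A: "range A \<subseteq> sets borel" "decseq A" "(\<Inter>i. A i) = {}"
    have "(\<lambda>i. m (A i)) \<longlonglongrightarrow> 0"
    proof (rule tendstoI)
      fix e :: real assume e: "0 < e"
      obtain K R where K: "K \<ge> 0" and KR: "\<And>A. A \<in> sets borel \<Longrightarrow> m A \<le> e/2 + K * measure lborel (A \<inter> cball 0 R)"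
        using m_UI[of "e/2"] e by (metis half_gt_zero)
      have "(\<lambda>i. measure lborel (A i \<inter> cball 0 R)) \<longlonglongrightarrow> measure lborel (\<Inter>i. A i \<inter> cball 0 R)"
      proof (rule Lim_measure_decseq)
        show "range (\<lambda>i. A i \<inter> cball 0 R) \<subseteq> sets lborel" using A by auto
        show "decseq (\<lambda>i. A i \<inter> cball 0 R)" using A by (auto simp: decseq_def)
        show "emeasure lborel (A i \<inter> cball 0 R) \<noteq> \<infinity>" for i
          using emeasure_lborel_cball_finite[of "0::'b" R] emeasure_mono[of "A i \<inter> cball 0 R" "cball 0 R" lborel]
          by (auto simp: top_unique less_top)
      qed
      also have "(\<Inter>i. A i \<inter> cball 0 R) = {}" using A by auto
      finally have "(\<lambda>i. e/2 + K * measure lborel (A i \<inter> cball 0 R)) \<longlonglongrightarrow> e/2 + K * 0"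
        by (intro tendsto_intros) simp
      then have "\<forall>\<^sub>F i in sequentially. e/2 + K * measure lborel (A i \<inter> cball 0 R) < e"
        using e by (intro order_tendstoD(2)[of _ "e/2"]) auto
      then show "\<forall>\<^sub>F i in sequentially. dist (m (A i)) 0 < e"
      proof eventually_elim
        case (elim i)
        have "A i \<in> sets borel" using A by auto
        from KR[OF this] elim m_nonneg[of "A i"] show ?case by simp
      qed
    qed
    then show "(\<lambda>i. ennreal (m (A i))) \<longlonglongrightarrow> 0"
      using tendsto_ennrealI[of "\<lambda>i. m (A i)" 0] by simp
  qed simp
  moreover define N where "N = measure_of UNIV (sets (borel :: 'b measure)) (\<lambda>A. ennreal (m A))"
  ultimately have emN: "emeasure N A = ennreal (m A)" if "A \<in> sets borel" for A
    unfolding N_def using that sets.sigma_algebra_axioms[of "borel :: 'b measure"]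
    by (intro emeasure_measure_of_sigma) (auto simp: positive_def m_empty)
  have setsN: "sets N = sets borel"
    unfolding N_def using sets.sets_measure_of_eq[of "borel :: 'b measure"] by simp
  have spaceN: "space N = UNIV" using sets_eq_imp_space_eq[OF setsN] by simp
  have N: "prob_space N"
    by (rule prob_spaceI) (simp add: spaceN emN m_UNIV)
  interpret N: prob_space N by fact
  have measN: "measure N A = m A" if "A \<in> sets borel" for A
    using emN[OF that] m_nonneg by (simp add: measure_def)
  \<comment> \<open>On a null set the volume term of \<open>m_UI\<close> disappears, so
    \<open>m A\<close> is at most every positive \<open>e\<close>.\<close>
  have ac: "absolutely_continuous lborel N"
    unfolding absolutely_continuous_def
  proof
    fix A :: "'b set" assume A: "A \<in> null_sets lborel"
    then have A': "A \<in> sets borel" by auto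
    have "m A \<le> 0"
    proof (rule field_le_epsilon)
      fix e :: real assume "0 < e"
      then obtain K R where KR: "m A \<le> e + K * measure lborel (A \<inter> cball 0 R)"
        using m_UI[of e] A' by blast
      have "emeasure lborel (A \<inter> cball 0 R) \<le> emeasure lborel A"
        using A' by (intro emeasure_mono) auto
      then have "measure lborel (A \<inter> cball 0 R) = 0"
        using A by (auto simp: measure_def null_sets_def)
      with KR show "m A \<le> 0 + e" by simp
    qed
    then show "A \<in> null_sets N"
      using A' setsN emN[OF A'] by (auto simp: null_sets_def ennreal_neg)
  qed
  obtain D where D: "D \<in> borel_measurable lborel" "AE x in lborel. RN_deriv lborel N x = ennreal (D x)"
    "\<And>x. 0 \<le> D x"
    using sigma_finite_measure.real_RN_deriv[OF sigma_finite_lborel N.finite_measure_axioms ac] setsN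
    by (metis sets_lborel)
  have "N = density lborel (RN_deriv lborel N)"
    using sigma_finite_measure.density_RN_deriv[OF sigma_finite_lborel ac] setsN by simp
  also have "\<dots> = density lborel (\<lambda>x. ennreal (D x))"
    using D by (intro density_cong) auto
  finally have ND: "N = density lborel (\<lambda>x. ennreal (D x))" .
  have "(\<integral>\<^sup>+x. ennreal (D x) \<partial>lborel) = 1"
    using N.emeasure_space_1 D(1) unfolding spaceN by (subst (asm) ND) (simp add: emeasure_density)
  then have D1: "integrable lborel D" "integral\<^sup>L lborel D = 1"
    using D by (auto simp: integrable_iff_bounded integral_eq_nn_integral)
  show thesis
  proof
    show "H \<noteq> bot" "H \<le> sequentially" "D \<in> borel_measurable borel" "\<And>x. 0 \<le> D x"
      "integrable lborel D" "integral\<^sup>L lborel D = 1" 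
      using H D D1 by auto
    fix g :: "'b \<Rightarrow> real" and C assume g: "g \<in> borel_measurable borel" "\<And>x. \<bar>g x\<bar> \<le> (C::real)"
    have "((\<lambda>n. integral\<^sup>L (M n) g) \<longlongrightarrow> integral\<^sup>L N g) H"
      by (rule integral_tendsto_of_measure_tendsto[OF M N setsN _ g]) (auto simp: measN m)
    also have "integral\<^sup>L N g = (\<integral>x. D x * g x \<partial>lborel)"
      using g D by (subst ND, subst integral_density) auto
    finally show "((\<lambda>n. integral\<^sup>L (M n) g) \<longlongrightarrow> (\<integral>x. D x * g x \<partial>lborel)) H" .
  qed
qed

section \<open>The drift-jump chain\<close>

text \<open>The mixture is realised by drawing the index first, i.e. by the bind of a point measure.\<close>

lemma finite_mixture:
  fixes w :: "'i \<Rightarrow> real" and N :: "'i \<Rightarrow> 'b measure"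
  assumes I: "finite I" "\<And>i. i \<in> I \<Longrightarrow> 0 \<le> w i" "(\<Sum>i\<in>I. w i) = 1"
    and N: "\<And>i. i \<in> I \<Longrightarrow> prob_space (N i)" "\<And>i. i \<in> I \<Longrightarrow> sets (N i) = sets S"
  obtains M where "prob_space M" "sets M = sets S"
    "\<And>f. f \<in> borel_measurable S \<Longrightarrow> (\<integral>\<^sup>+x. f x \<partial>M) = (\<Sum>i\<in>I. ennreal (w i) * (\<integral>\<^sup>+x. f x \<partial>N i))"
    "\<And>f C. f \<in> borel_measurable S \<Longrightarrow> (\<And>x. x \<in> space S \<Longrightarrow> \<bar>f x\<bar> \<le> (C::real)) \<Longrightarrow>
        (\<integral>x. f x \<partial>M) = (\<Sum>i\<in>I. w i * (\<integral>x. f x \<partial>N i))"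
proof -
  define P where "P = point_measure I (\<lambda>i. ennreal (w i))"
  interpret P: prob_space P
    using I by (intro prob_spaceI)
      (simp add: P_def space_point_measure emeasure_point_measure_finite sum_ennreal[of I w])
  have spaceP: "space P = I" by (simp add: P_def space_point_measure)
  have "I \<noteq> {}" using I(3) by auto
  have meas: "N \<in> measurable P (subprob_algebra S)"
    using N by (auto simp: P_def space_subprob_algebra prob_space_imp_subprob_space)
  define M where "M = P \<bind> N"
  show thesis
  proof
    show "prob_space M"
      unfolding M_def by (rule P.prob_space_bind[OF _ meas]) (use N spaceP in auto)
    show setsM: "sets M = sets S"
      unfolding M_def by (rule sets_bind) (use N spaceP \<open>I \<noteq> {}\<close> in auto)
    show nn: "(\<integral>\<^sup>+x. f x \<partial>M) = (\<Sum>i\<in>I. ennreal (w i) * (\<integral>\<^sup>+x. f x \<partial>N i))"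
      if "f \<in> borel_measurable S" for f
      unfolding M_def nn_integral_bind[OF that meas] unfolding P_def
      using I by (subst nn_integral_point_measure_finite) (auto simp: mult.commute)
    fix f C assume f: "f \<in> borel_measurable S" "\<And>x. x \<in> space S \<Longrightarrow> \<bar>f x\<bar> \<le> (C::real)"
    have "(\<integral>x. f x \<partial>M) = (\<integral>i. (\<integral>x. f x \<partial>N i) \<partial>P)"
      unfolding M_def
    proof (rule integral_bind[OF f meas P.finite_measure_axioms, where B' = 1])
      show "AE x in P. emeasure (N x) (space (N x)) \<le> ennreal 1"
        using N(1) spaceP by (intro AE_I2) (auto simp: prob_space.emeasure_space_1)
    qed
    also have "\<dots> = (\<Sum>i\<in>I. w i * (\<integral>x. f x \<partial>N i))"
      unfolding P_def using I by (subst lebesgue_integral_point_measure_finite) auto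
    finally show "(\<integral>x. f x \<partial>M) = (\<Sum>i\<in>I. w i * (\<integral>x. f x \<partial>N i))" .
  qed
qed

section \<open>A single Markov step with drift, jump and rest\<close>

lemma borel_measurable_shift [measurable]:
  "(\<lambda>(z, y). z + (0, y)) \<in> borel_measurable (borel \<Otimes>\<^sub>M borel :: (('a::euclidean_space \<times> 'a) \<times> 'a) measure)"
proof -
  have "(\<lambda>(z, y). z + (0, y)) \<in> borel_measurable (borel :: (('a \<times> 'a) \<times> 'a) measure)"
    by (intro borel_measurable_continuous_onI) (auto simp: case_prod_beta' intro!: continuous_intros)
  then show ?thesis by (simp add: borel_prod)
qed

text \<open>The bound on \<open>h * r\<close> makes the weight of resting non-negative. Both kinds
  of integral are recorded because volume and moment bounds use non-negative functions, and the weak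
  equation uses signed bounded ones.\<close>

lemma markov_step:
  fixes b :: "'a::euclidean_space \<times> 'a \<Rightarrow> 'a \<times> 'a"
  assumes \<mu>: "prob_space \<mu>" "sets \<mu> = sets borel"
    and \<kappa>: "prob_space \<kappa>" "sets \<kappa> = sets borel"
    and b: "b \<in> borel_measurable borel"
    and h: "0 \<le> h" "0 \<le> r" "h * r \<le> 1 / 2"
  obtains \<nu> where "prob_space \<nu>" "sets \<nu> = sets borel"
    "\<And>f. f \<in> borel_measurable borel \<Longrightarrow> (\<integral>\<^sup>+z. f z \<partial>\<nu>) =
       ennreal (1/2) * (\<integral>\<^sup>+z. f (z + (2 * h) *\<^sub>R b z) \<partial>\<mu>)
       + (ennreal (h * r) * (\<integral>\<^sup>+z. (\<integral>\<^sup>+y. f (z + (0, y)) \<partial>\<kappa>) \<partial>\<mu>)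
       + ennreal (1/2 - h * r) * (\<integral>\<^sup>+z. f z \<partial>\<mu>))"
    "\<And>(f :: _ \<Rightarrow> real) C. f \<in> borel_measurable borel \<Longrightarrow> (\<And>z. \<bar>f z\<bar> \<le> C) \<Longrightarrow> (\<integral>z. f z \<partial>\<nu>) =
       1/2 * (\<integral>z. f (z + (2 * h) *\<^sub>R b z) \<partial>\<mu>)
       + (h * r * (\<integral>z. (\<integral>y. f (z + (0, y)) \<partial>\<kappa>) \<partial>\<mu>)
       + (1/2 - h * r) * (\<integral>z. f z \<partial>\<mu>))"
proof -
  note [measurable_cong] = \<mu>(2) \<kappa>(2)
  note [measurable] = b
  interpret \<mu>: prob_space \<mu> by fact
  interpret \<kappa>: prob_space \<kappa> by fact
  interpret pair_prob_space \<mu> \<kappa> by standard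
  \<comment> \<open>The jump is independent of the current state: branch 1 is the image of a product
    measure under addition.\<close>
  define N where "N i = (if i = (0::nat) then distr \<mu> borel (\<lambda>z. z + (2 * h) *\<^sub>R b z)
     else if i = 1 then distr (\<mu> \<Otimes>\<^sub>M \<kappa>) borel (\<lambda>(z, y). z + (0, y)) else \<mu>)" for i
  define w where "w i = (if i = (0::nat) then 1/2 else if i = 1 then h * r else 1/2 - h * r)" for i
  have N: "prob_space (N i)" "sets (N i) = sets borel" for i
    by (auto simp: N_def \<mu> intro!: \<mu>.prob_space_distr prob_space_distr)
  have *: "{..<3::nat} = {0, 1, 2}" by auto
  obtain \<nu> where \<nu>: "prob_space \<nu>" "sets \<nu> = sets borel"
    "\<And>f. f \<in> borel_measurable borel \<Longrightarrow> (\<integral>\<^sup>+x. f x \<partial>\<nu>) = (\<Sum>i\<in>{..<3}. ennreal (w i) * (\<integral>\<^sup>+x. f x \<partial>N i))"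
    "\<And>f C. f \<in> borel_measurable borel \<Longrightarrow> (\<And>x. x \<in> space borel \<Longrightarrow> \<bar>f x\<bar> \<le> (C::real)) \<Longrightarrow>
        (\<integral>x. f x \<partial>\<nu>) = (\<Sum>i\<in>{..<3}. w i * (\<integral>x. f x \<partial>N i))"
    by (rule finite_mixture[of "{..<3}" w N borel]) (use h N in \<open>auto simp: w_def *\<close>)
  show thesis
  proof (rule that[OF \<nu>(1,2)])
    fix f :: "'a \<times> 'a \<Rightarrow> ennreal" assume [measurable]: "f \<in> borel_measurable borel"
    have "(\<integral>\<^sup>+x. f x \<partial>N 1) = (\<integral>\<^sup>+z. (\<integral>\<^sup>+y. f (z + (0, y)) \<partial>\<kappa>) \<partial>\<mu>)"
      unfolding N_def by (simp add: nn_integral_distr \<kappa>.nn_integral_fst[symmetric])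
    then show "(\<integral>\<^sup>+z. f z \<partial>\<nu>) = ennreal (1/2) * (\<integral>\<^sup>+z. f (z + (2 * h) *\<^sub>R b z) \<partial>\<mu>)
       + (ennreal (h * r) * (\<integral>\<^sup>+z. (\<integral>\<^sup>+y. f (z + (0, y)) \<partial>\<kappa>) \<partial>\<mu>)
       + ennreal (1/2 - h * r) * (\<integral>\<^sup>+z. f z \<partial>\<mu>))"
      by (simp add: \<nu>(3) * w_def) (simp add: N_def nn_integral_distr)
  next
    fix f :: "'a \<times> 'a \<Rightarrow> real" and C assume [measurable]: "f \<in> borel_measurable borel" and f: "\<And>z. \<bar>f z\<bar> \<le> C"
    have "integrable (\<mu> \<Otimes>\<^sub>M \<kappa>) (\<lambda>(z, y). f (z + (0, y)))"
      by (rule P.integrable_const_bound[of _ C]) (auto simp: f)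
    then have "(\<integral>x. f x \<partial>N 1) = (\<integral>z. (\<integral>y. f (z + (0, y)) \<partial>\<kappa>) \<partial>\<mu>)"
      unfolding N_def by (simp add: integral_distr integral_fst'[symmetric] case_prod_beta')
    then show "(\<integral>z. f z \<partial>\<nu>) = 1/2 * (\<integral>z. f (z + (2 * h) *\<^sub>R b z) \<partial>\<mu>)
       + (h * r * (\<integral>z. (\<integral>y. f (z + (0, y)) \<partial>\<kappa>) \<partial>\<mu>)
       + (1/2 - h * r) * (\<integral>z. f z \<partial>\<mu>))"
      by (subst \<nu>(4)[of f C]) (auto simp: f * w_def, simp add: N_def integral_distr)
  qed
qed

text \<open>The identity gives \<open>a + c\<close>, which is at most \<open>2 * (u * v)\<close>
  since \<open>u * v\<close> only adds the product of the squared norms; the arithmetic-geometric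
  inequality then bounds \<open>a * c\<close> by the square of \<open>u * v\<close>.\<close>

lemma ln_parallelogram:
  fixes z q :: "'b::real_inner"
  shows "ln (1 + (norm (z + q))\<^sup>2) + ln (1 + (norm (z - q))\<^sup>2) \<le> 2 * ln (1 + (norm z)\<^sup>2) + 2 * ln (1 + (norm q)\<^sup>2)"
proof -
  define a c where "a = 1 + (norm (z + q))\<^sup>2" and "c = 1 + (norm (z - q))\<^sup>2"
  define u v where "u = 1 + (norm z)\<^sup>2" and "v = 1 + (norm q)\<^sup>2"
  have pos: "a > 0" "c > 0" "u > 0" "v > 0"
    by (auto simp: a_def c_def u_def v_def intro: add_pos_nonneg)
  have "a + c = 2 + 2 * (norm z)\<^sup>2 + 2 * (norm q)\<^sup>2"
    by (simp add: a_def c_def power2_norm_eq_inner inner_add_left inner_add_right inner_diff_left inner_diff_right inner_commute)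
  also have "\<dots> \<le> 2 * (u * v)"
    by (simp add: u_def v_def algebra_simps)
  finally have "(a + c)\<^sup>2 \<le> (2 * (u * v))\<^sup>2"
    using pos by (intro power_mono) auto
  moreover have "4 * (a * c) \<le> (a + c)\<^sup>2"
    using sum_squares_bound[of a c] by (simp add: power2_sum)
  ultimately have "a * c \<le> (u * v)\<^sup>2" by (simp add: power_mult_distrib)
  then have "ln (a * c) \<le> ln ((u * v)\<^sup>2)"
    using pos by (subst ln_le_cancel_iff) auto
  then show ?thesis
    using pos unfolding a_def[symmetric] c_def[symmetric] u_def[symmetric] v_def[symmetric]
    by (simp add: ln_mult ln_realpow)
qed

text \<open>Lyapunov function for tightness. Under a drift of linear growth it increases at a
  bounded rate, it is integrable against the tails of the Levy density for every positive
  \<open>s\<close>, and it is at most the squared norm, so the second moment of the initial density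
  controls it.\<close>

definition logw :: "'b::real_normed_vector \<Rightarrow> real" where
  "logw z = ln (1 + (norm z)\<^sup>2)"

lemma logw_nonneg: "0 \<le> logw z"
  by (simp add: logw_def)

lemma borel_measurable_logw [measurable]: "logw \<in> borel_measurable borel"
  unfolding logw_def[abs_def] by measurable

text \<open>Linear growth of \<open>q\<close> multiplies \<open>1 + (norm z)\<^sup>2\<close> by at
  most 1 + O(h), which the logarithm turns into an additive O(h). The two terms of the constant come
  from the cross term and from the squared displacement; the latter also uses
  \<open>h\<^sup>2 \<le> h\<close>.\<close>

lemma logw_drift:
  assumes B: "0 \<le> B" "norm q \<le> B * (1 + norm z)" and h: "0 \<le> h" "h \<le> 1"
  shows "logw (z + (2 * h) *\<^sub>R q) \<le> logw z + h * (8 * B + 8 * B\<^sup>2)"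
proof -
  define n where "n = norm z"
  have n: "0 \<le> n" by (simp add: n_def)
  have "norm (z + (2 * h) *\<^sub>R q) \<le> n + 2 * h * (B * (1 + n))"
    using norm_triangle_ineq[of z "(2 * h) *\<^sub>R q"] B h mult_left_mono[OF B(2), of "2 * h"] by (simp add: n_def)
  then have "(norm (z + (2 * h) *\<^sub>R q))\<^sup>2 \<le> (n + 2 * h * (B * (1 + n)))\<^sup>2"
    by (intro power_mono) auto
  also have "\<dots> = n\<^sup>2 + 4 * (h * B) * (n * (1 + n)) + 4 * (h\<^sup>2 * B\<^sup>2) * (1 + n)\<^sup>2"
    by (simp add: power2_eq_square algebra_simps)
  also have "\<dots> \<le> n\<^sup>2 + 4 * (h * B) * (2 * (1 + n\<^sup>2)) + 4 * (h * B\<^sup>2) * (2 * (1 + n\<^sup>2))"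
  proof -
    have "0 \<le> (n - 1)\<^sup>2" by simp
    then have n1: "n * (1 + n) \<le> 2 * (1 + n\<^sup>2)" and n2: "(1 + n)\<^sup>2 \<le> 2 * (1 + n\<^sup>2)"
      using n by (simp_all add: power2_eq_square algebra_simps)
    have "4 * (h * B) * (n * (1 + n)) \<le> 4 * (h * B) * (2 * (1 + n\<^sup>2))"
      using n1 B h by (intro mult_left_mono) auto
    moreover have "4 * (h\<^sup>2 * B\<^sup>2) * (1 + n)\<^sup>2 \<le> 4 * (h * B\<^sup>2) * (2 * (1 + n\<^sup>2))"
    proof (rule mult_mono)
      have "h\<^sup>2 \<le> h" using h by (simp add: power2_eq_square mult_left_le_one_le)
      then show "4 * (h\<^sup>2 * B\<^sup>2) \<le> 4 * (h * B\<^sup>2)" by (simp add: mult_right_mono)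
    qed (use n2 h in auto)
    ultimately show ?thesis by simp
  qed
  finally have "1 + (norm (z + (2 * h) *\<^sub>R q))\<^sup>2 \<le> (1 + n\<^sup>2) * (1 + h * (8 * B + 8 * B\<^sup>2))"
    by (simp add: algebra_simps)
  then have "ln (1 + (norm (z + (2 * h) *\<^sub>R q))\<^sup>2) \<le> ln ((1 + n\<^sup>2) * (1 + h * (8 * B + 8 * B\<^sup>2)))"
    using B h by (subst ln_le_cancel_iff) (auto intro!: add_pos_nonneg mult_pos_pos mult_nonneg_nonneg)
  also have "\<dots> = ln (1 + n\<^sup>2) + ln (1 + h * (8 * B + 8 * B\<^sup>2))"
    using B h by (intro ln_mult_pos) (auto intro!: add_pos_nonneg mult_nonneg_nonneg)
  also have "ln (1 + h * (8 * B + 8 * B\<^sup>2)) \<le> h * (8 * B + 8 * B\<^sup>2)"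
    using B h by (intro ln_add_one_self_le_self) (auto intro!: mult_nonneg_nonneg add_nonneg_nonneg)
  finally show ?thesis by (simp add: logw_def n_def)
qed

text \<open>Adding the integral to its reflected copy pairs the jumps \<open>J y\<close> and
  \<open>- J y\<close>, and \<open>ln_parallelogram\<close> applies pointwise. \<open>J\<close> is
  odd and norm preserving so as to cover the embedding of a velocity jump as
  \<open>(0, y)\<close>.\<close>

lemma nn_integral_logw_jump:
  fixes z :: "'b::{real_inner, second_countable_topology}"
  assumes \<kappa>: "prob_space \<kappa>" "sets \<kappa> = sets borel" "distr \<kappa> borel uminus = \<kappa>"
    and J: "J \<in> borel_measurable borel" "\<And>y. J (- y) = - J y" "\<And>y. norm (J y) = norm y"
  shows "(\<integral>\<^sup>+y. ennreal (logw (z + J y)) \<partial>\<kappa>) \<le> ennreal (logw z) + (\<integral>\<^sup>+y. ennreal (logw y) \<partial>\<kappa>)"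
proof -
  note [measurable_cong] = \<kappa>(2)
  note [measurable] = J(1)
  have um: "uminus \<in> borel_measurable \<kappa>"
    unfolding measurable_cong_sets[OF \<kappa>(2) refl]
    by (intro borel_measurable_continuous_onI continuous_on_minus continuous_on_id)
  interpret prob_space \<kappa> by fact
  let ?I = "\<integral>\<^sup>+y. ennreal (logw (z + J y)) \<partial>\<kappa>" and ?R = "ennreal (logw z) + (\<integral>\<^sup>+y. ennreal (logw y) \<partial>\<kappa>)"
  have "?I = (\<integral>\<^sup>+y. ennreal (logw (z + J y)) \<partial>distr \<kappa> borel uminus)"
    using \<kappa>(3) by simp
  also have "\<dots> = (\<integral>\<^sup>+y. ennreal (logw (z - J y)) \<partial>\<kappa>)"
    by (subst nn_integral_distr) (auto simp: J um)
  finally have "?I + ?I = (\<integral>\<^sup>+y. ennreal (logw (z + J y)) \<partial>\<kappa>) + (\<integral>\<^sup>+y. ennreal (logw (z - J y)) \<partial>\<kappa>)"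
    by simp
  also have "\<dots> = (\<integral>\<^sup>+y. ennreal (logw (z + J y)) + ennreal (logw (z - J y)) \<partial>\<kappa>)"
    by (rule nn_integral_add[symmetric]) auto
  also have "\<dots> \<le> (\<integral>\<^sup>+y. 2 * (ennreal (logw z) + ennreal (logw y)) \<partial>\<kappa>)"
  proof (rule nn_integral_mono)
    fix y
    have "logw (z + J y) + logw (z - J y) \<le> 2 * logw z + 2 * logw y"
      using ln_parallelogram[of z "J y"] by (simp add: logw_def J)
    then have "ennreal (logw (z + J y) + logw (z - J y)) \<le> ennreal (2 * (logw z + logw y))"
      by (intro ennreal_leI) simp
    then show "ennreal (logw (z + J y)) + ennreal (logw (z - J y)) \<le> 2 * (ennreal (logw z) + ennreal (logw y))"
      by (simp add: logw_nonneg ennreal_mult ennreal_plus)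
  qed
  also have "\<dots> = 2 * ?R"
    by (simp add: nn_integral_cmult nn_integral_add emeasure_space_1)
  finally have "2 * ?I \<le> 2 * ?R" by (simp add: mult_2)
  then show ?thesis
    using ennreal_mult_le_mult_iff[of 2 ?I ?R] by simp
qed

text \<open>The drift part has weight $1/2$ and is run for time $2h$, the jump part has weight $hr$; this way
the generator is an exact sum and no composition of the two mechanisms has to be expanded.\<close>

definition step_rel ::
  "('a::euclidean_space \<times> 'a \<Rightarrow> 'a \<times> 'a) \<Rightarrow> 'a measure \<Rightarrow> real \<Rightarrow> real \<Rightarrow> ('a \<times> 'a) measure \<Rightarrow> ('a \<times> 'a) measure \<Rightarrow> bool" where
  "step_rel b \<kappa> r h \<mu> \<nu> \<longleftrightarrow>
     (\<forall>f\<in>borel_measurable borel. (\<integral>\<^sup>+z. f z \<partial>\<nu>) =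
       ennreal (1/2) * (\<integral>\<^sup>+z. f (z + (2 * h) *\<^sub>R b z) \<partial>\<mu>)
       + (ennreal (h * r) * (\<integral>\<^sup>+z. (\<integral>\<^sup>+y. f (z + (0, y)) \<partial>\<kappa>) \<partial>\<mu>)
       + ennreal (1/2 - h * r) * (\<integral>\<^sup>+z. f z \<partial>\<mu>))) \<and>
     (\<forall>f\<in>borel_measurable borel. \<forall>C. (\<forall>z. \<bar>f z :: real\<bar> \<le> C) \<longrightarrow> (\<integral>z. f z \<partial>\<nu>) =
       1/2 * (\<integral>z. f (z + (2 * h) *\<^sub>R b z) \<partial>\<mu>)
       + (h * r * (\<integral>z. (\<integral>y. f (z + (0, y)) \<partial>\<kappa>) \<partial>\<mu>)
       + (1/2 - h * r) * (\<integral>z. f z \<partial>\<mu>)))"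

section \<open>Volume and moment bounds along the chain\<close>

lemma ennreal_convex_le:
  fixes x y z X :: ennreal
  assumes "x \<le> X" "y \<le> X" "z \<le> X" and h: "0 \<le> p" "p \<le> 1/2"
  shows "ennreal (1/2) * x + (ennreal p * y + ennreal (1/2 - p) * z) \<le> X"
proof -
  have "ennreal (1/2) * x + (ennreal p * y + ennreal (1/2 - p) * z)
      \<le> ennreal (1/2) * X + (ennreal p * X + ennreal (1/2 - p) * X)"
    using assms by (intro add_mono mult_left_mono) auto
  also have "\<dots> = ennreal (1/2 + (p + (1/2 - p))) * X"
    using h by (subst ennreal_plus, simp, simp, subst ennreal_plus) (auto simp: distrib_right)
  finally show ?thesis by simp
qed

text \<open>Later \<open>L\<close>, \<open>B\<close> and \<open>C\<close> are common to all
  \<open>n\<close> while \<open>\<kappa>\<close>, \<open>r\<close> and \<open>h\<close> vary.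
  \<open>C\<close> bounds the rate at which jumps raise the logarithmic moment, so \<open>r\<close>
  itself may be large. The last condition keeps \<open>1 - 2 * (h * L)\<close> at least 1/2.\<close>

locale drift_jump_scheme =
  fixes b :: "'a::euclidean_space \<times> 'a \<Rightarrow> 'a \<times> 'a" and \<kappa> :: "'a measure" and L B C r h :: real
  assumes L: "0 \<le> L" "\<And>z w. norm (b z - b w) \<le> L * norm (z - w)"
    and B: "0 \<le> B" "\<And>z. norm (b z) \<le> B * (1 + norm z)"
    and \<kappa>: "prob_space \<kappa>" "sets \<kappa> = sets borel" "distr \<kappa> borel uminus = \<kappa>"
    and C: "0 \<le> C" "ennreal r * (\<integral>\<^sup>+y. ennreal (logw y) \<partial>\<kappa>) \<le> ennreal C"
    and h: "0 < h" "h \<le> 1" "0 \<le> r" "h * r \<le> 1/2" "4 * (h * L) \<le> 1"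
begin

lemma cont_b: "continuous_on S b"
  using L by (intro lipschitz_on_continuous_on[of L]) (auto simp: lipschitz_on_def dist_norm)

lemma borel_b [measurable]: "b \<in> borel_measurable borel"
  by (intro borel_measurable_continuous_onI cont_b)

text \<open>Volume factor of one drift step: the inverse of the drift map on its range has Lipschitz
  constant \<open>1 / (1 - 2 * (h * L))\<close>, raised to the dimension of phase space.\<close>

definition \<rho> :: real where "\<rho> = (1 / (1 - 2 * (h * L))) ^ DIM('a \<times> 'a)"

text \<open>\<open>1 / (1 - x) \<le> exp (2 * x)\<close> on [0, 1/2]. The exponential form bounds
  the product of \<open>k\<close> such factors uniformly as long as \<open>k * h\<close> stays
  bounded.\<close>

lemma \<rho>: "1 \<le> \<rho>" "\<rho> \<le> exp (4 * (h * L) * DIM('a \<times> 'a))"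
proof -
  define x where "x = 2 * (h * L)"
  have x: "0 \<le> x" "x \<le> 1/2" using h L by (auto simp: x_def)
  then show "1 \<le> \<rho>" by (auto simp: \<rho>_def x_def[symmetric] intro!: one_le_power)
  have "1 \<le> exp (2 * x) * (1 - x)"
  proof -
    have "0 \<le> x * (1 - 2 * x)" using x by simp
    then have "1 \<le> (1 + 2 * x) * (1 - x)" by (simp add: algebra_simps)
    also have "\<dots> \<le> exp (2 * x) * (1 - x)" using x by (intro mult_right_mono) auto
    finally show ?thesis .
  qed
  then have "1 / (1 - x) \<le> exp (2 * x)" using x by (simp add: field_simps)
  then have "\<rho> \<le> exp (2 * x) ^ DIM('a \<times> 'a)"
    unfolding \<rho>_def x_def[symmetric] using x by (intro power_mono) auto
  then show "\<rho> \<le> exp (4 * (h * L) * DIM('a \<times> 'a))"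
    by (simp add: x_def exp_of_nat_mult[symmetric] mult_ac)
qed

lemma emeasure_drift_preimage:
  assumes "A \<in> sets borel"
  shows "emeasure lborel ((\<lambda>z. z + (2 * h) *\<^sub>R b z) -` A) \<le> ennreal \<rho> * emeasure lborel A"
  unfolding \<rho>_def
proof (rule emeasure_vimage_expanding[OF _ _ _ assms])
  have hL: "0 < 1 - 2 * (h * L)" using h(5) by simp
  then show "0 < 1 / (1 - 2 * (h * L))" by simp
  show "continuous_on UNIV (\<lambda>z. z + (2 * h) *\<^sub>R b z)"
    by (intro continuous_intros cont_b)
  fix x y
  \<comment> \<open>Lower Lipschitz bound for a perturbation of the identity: the perturbation has
    Lipschitz constant \<open>2 * h * L\<close>, which is at most 1/2.\<close>
  have "norm (x - y) = norm ((x + (2 * h) *\<^sub>R b x - (y + (2 * h) *\<^sub>R b y)) - (2 * h) *\<^sub>R (b x - b y))"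
    by (simp add: algebra_simps)
  also have "\<dots> \<le> norm (x + (2 * h) *\<^sub>R b x - (y + (2 * h) *\<^sub>R b y)) + 2 * h * norm (b x - b y)"
    using norm_triangle_ineq4[of "x + (2 * h) *\<^sub>R b x - (y + (2 * h) *\<^sub>R b y)" "(2 * h) *\<^sub>R (b x - b y)"] h by simp
  also have "2 * h * norm (b x - b y) \<le> 2 * h * (L * norm (x - y))"
    using L h by (intro mult_left_mono) auto
  finally have "(1 - 2 * (h * L)) * norm (x - y) \<le> norm (x + (2 * h) *\<^sub>R b x - (y + (2 * h) *\<^sub>R b y))"
    by (simp add: algebra_simps)
  then show "norm (x - y) \<le> 1 / (1 - 2 * (h * L)) * norm (x + (2 * h) *\<^sub>R b x - (y + (2 * h) *\<^sub>R b y))"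
    using hL by (simp add: field_simps)
qed

lemma step_exists:
  assumes "prob_space \<mu>" "sets \<mu> = sets borel"
  shows "\<exists>\<nu>. prob_space \<nu> \<and> sets \<nu> = sets borel \<and> step_rel b \<kappa> r h \<mu> \<nu>"
proof -
  have "0 \<le> h" using h by simp
  show ?thesis
  proof (rule markov_step[OF assms \<kappa>(1,2) borel_b \<open>0 \<le> h\<close> h(3,4)], goal_cases)
    case (1 \<nu>)
    show ?case
      unfolding step_rel_def by (intro exI[of _ \<nu>] conjI ballI allI impI 1) blast+
  qed
qed

text \<open>Each branch alone obeys the bound, hence so does the convex combination. Rest changes
  nothing, a jump averages over translations, which preserve volume, and only the drift costs the
  factor \<open>\<rho>\<close>. The weights sum to one, which is why \<open>c\<close> is not
  amplified.\<close>

lemma step_emeasure_le: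
  assumes \<mu>: "prob_space \<mu>" "sets \<mu> = sets borel" and \<nu>: "sets \<nu> = sets borel" "step_rel b \<kappa> r h \<mu> \<nu>"
    and dom: "\<And>A. A \<in> sets borel \<Longrightarrow> emeasure \<mu> A \<le> c + K * emeasure lborel A"
    and A: "A \<in> sets borel"
  shows "emeasure \<nu> A \<le> c + ennreal \<rho> * K * emeasure lborel A"
proof -
  note [measurable_cong] = \<mu>(2) \<kappa>(2)
  note [measurable] = A
  interpret \<mu>: prob_space \<mu> by (rule \<mu>)
  interpret \<kappa>: prob_space \<kappa> by (rule \<kappa>)
  let ?X = "c + ennreal \<rho> * K * emeasure lborel A"
  have \<rho>1: "K * emeasure lborel A \<le> ennreal \<rho> * K * emeasure lborel A"
    using \<rho>(1) mult_right_mono[of 1 "ennreal \<rho>" "K * emeasure lborel A"] by (simp add: mult.assoc)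
  have "emeasure \<nu> A = (\<integral>\<^sup>+z. indicator A z \<partial>\<nu>)"
    using A \<nu> by simp
  also have "\<dots> = ennreal (1/2) * (\<integral>\<^sup>+z. indicator A (z + (2 * h) *\<^sub>R b z) \<partial>\<mu>)
       + (ennreal (h * r) * (\<integral>\<^sup>+z. (\<integral>\<^sup>+y. indicator A (z + (0, y)) \<partial>\<kappa>) \<partial>\<mu>)
       + ennreal (1/2 - h * r) * (\<integral>\<^sup>+z. indicator A z \<partial>\<mu>))"
  proof -
    have "(indicator A :: _ \<Rightarrow> ennreal) \<in> borel_measurable borel" by measurable
    with \<nu>(2) show ?thesis unfolding step_rel_def by blast
  qed
  also have "\<dots> \<le> ?X"
  proof (rule ennreal_convex_le)
    have T: "(\<lambda>z. z + (2 * h) *\<^sub>R b z) -` A \<in> sets borel"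
      using measurable_sets[of "\<lambda>z. z + (2 * h) *\<^sub>R b z" borel borel A] by simp
    have "(\<integral>\<^sup>+z. indicator A (z + (2 * h) *\<^sub>R b z) \<partial>\<mu>) = (\<integral>\<^sup>+z. indicator ((\<lambda>z. z + (2 * h) *\<^sub>R b z) -` A) z \<partial>\<mu>)"
      by (intro nn_integral_cong) (auto simp: indicator_def)
    also have "\<dots> = emeasure \<mu> ((\<lambda>z. z + (2 * h) *\<^sub>R b z) -` A)"
      using T \<mu>(2) by simp
    also have "\<dots> \<le> c + K * emeasure lborel ((\<lambda>z. z + (2 * h) *\<^sub>R b z) -` A)"
      by (rule dom[OF T])
    also have "\<dots> \<le> c + K * (ennreal \<rho> * emeasure lborel A)"
      by (intro add_left_mono mult_left_mono emeasure_drift_preimage A) simp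
    finally show "(\<integral>\<^sup>+z. indicator A (z + (2 * h) *\<^sub>R b z) \<partial>\<mu>) \<le> ?X"
      by (simp add: mult_ac)
    have "(\<integral>\<^sup>+z. indicator A z \<partial>\<mu>) = emeasure \<mu> A" using A \<mu>(2) by simp
    also have "\<dots> \<le> ?X" using dom[OF A] \<rho>1 by (meson add_left_mono order.trans)
    finally show "(\<integral>\<^sup>+z. indicator A z \<partial>\<mu>) \<le> ?X" .
    have slice: "(\<integral>\<^sup>+z. indicator A (z + (0, y)) \<partial>\<mu>) \<le> ?X" for y
    proof -
      have Y: "(\<lambda>z. z + (0, y)) -` A \<in> sets borel"
        using measurable_sets[of "\<lambda>z. z + (0, y)" borel borel A] by simp
      have "(\<integral>\<^sup>+z. indicator A (z + (0, y)) \<partial>\<mu>) = (\<integral>\<^sup>+z. indicator ((\<lambda>z. z + (0, y)) -` A) z \<partial>\<mu>)"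
        by (intro nn_integral_cong) (auto simp: indicator_def)
      also have "\<dots> = emeasure \<mu> ((\<lambda>z. z + (0, y)) -` A)"
        using Y \<mu>(2) by simp
      also have "\<dots> \<le> c + K * emeasure lborel ((\<lambda>z. z + (0, y)) -` A)"
        by (rule dom[OF Y])
      also have "emeasure lborel ((\<lambda>z. z + (0, y)) -` A) = emeasure (distr lborel borel ((+) (0, y))) A"
        by (subst emeasure_distr) (auto simp: add.commute intro!: arg_cong[where f = "emeasure lborel"])
      also have "\<dots> = emeasure lborel A" by (simp only: lborel_distr_plus)
      also have "c + K * emeasure lborel A \<le> ?X" using \<rho>1 by (rule add_left_mono)
      finally show ?thesis .
    qed
    \<comment> \<open>Exchanging the integrals freezes the jump first, so that the bound for a fixed
      translation can be averaged.\<close>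
    interpret pair_sigma_finite \<mu> \<kappa> by standard
    have "(\<integral>\<^sup>+z. (\<integral>\<^sup>+y. indicator A (z + (0, y)) \<partial>\<kappa>) \<partial>\<mu>) = (\<integral>\<^sup>+y. (\<integral>\<^sup>+z. indicator A (z + (0, y)) \<partial>\<mu>) \<partial>\<kappa>)"
      by (rule Fubini'[symmetric]) measurable
    also have "\<dots> \<le> (\<integral>\<^sup>+y. ?X \<partial>\<kappa>)"
      by (intro nn_integral_mono slice)
    also have "\<dots> = ?X" by (simp add: \<kappa>.emeasure_space_1)
    finally show "(\<integral>\<^sup>+z. (\<integral>\<^sup>+y. indicator A (z + (0, y)) \<partial>\<kappa>) \<partial>\<mu>) \<le> ?X" .
  qed (use h in auto)
  finally show ?thesis .
qed

text \<open>The drift contributes the increment of \<open>logw_drift\<close>. A jump adds on average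
  at most its own logarithmic moment, which the weight \<open>h * r\<close> turns into at most
  \<open>h * C\<close>.\<close>

lemma step_logw:
  assumes \<mu>: "prob_space \<mu>" "sets \<mu> = sets borel" and \<nu>: "step_rel b \<kappa> r h \<mu> \<nu>"
  shows "(\<integral>\<^sup>+z. ennreal (logw z) \<partial>\<nu>) \<le> (\<integral>\<^sup>+z. ennreal (logw z) \<partial>\<mu>) + ennreal (h * (8 * B + 8 * B\<^sup>2 + C))"
proof -
  note [measurable_cong] = \<mu>(2) \<kappa>(2)
  interpret \<mu>: prob_space \<mu> by (rule \<mu>)
  interpret \<kappa>: prob_space \<kappa> by (rule \<kappa>)
  let ?I = "\<integral>\<^sup>+z. ennreal (logw z) \<partial>\<mu>" and ?J = "\<integral>\<^sup>+y. ennreal (logw y) \<partial>\<kappa>"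
  have meas: "(\<lambda>z. ennreal (logw z)) \<in> borel_measurable borel" by measurable
  have "(\<integral>\<^sup>+z. ennreal (logw (z + (2 * h) *\<^sub>R b z)) \<partial>\<mu>) \<le> (\<integral>\<^sup>+z. ennreal (logw z) + ennreal (h * (8 * B + 8 * B\<^sup>2)) \<partial>\<mu>)"
  proof (rule nn_integral_mono)
    fix z
    have "logw (z + (2 * h) *\<^sub>R b z) \<le> logw z + h * (8 * B + 8 * B\<^sup>2)"
      using B h by (intro logw_drift) auto
    then have "ennreal (logw (z + (2 * h) *\<^sub>R b z)) \<le> ennreal (logw z + h * (8 * B + 8 * B\<^sup>2))"
      by (rule ennreal_leI)
    then show "ennreal (logw (z + (2 * h) *\<^sub>R b z)) \<le> ennreal (logw z) + ennreal (h * (8 * B + 8 * B\<^sup>2))"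
      using B h by (simp add: ennreal_plus logw_nonneg)
  qed
  also have "\<dots> = ?I + ennreal (h * (8 * B + 8 * B\<^sup>2))"
    by (subst nn_integral_add) (auto simp: \<mu>.emeasure_space_1)
  finally have 1: "(\<integral>\<^sup>+z. ennreal (logw (z + (2 * h) *\<^sub>R b z)) \<partial>\<mu>) \<le> ?I + ennreal (h * (8 * B + 8 * B\<^sup>2))" .
  have "(\<integral>\<^sup>+z. (\<integral>\<^sup>+y. ennreal (logw (z + (0, y))) \<partial>\<kappa>) \<partial>\<mu>) \<le> (\<integral>\<^sup>+z. ennreal (logw z) + ?J \<partial>\<mu>)"
    by (intro nn_integral_mono nn_integral_logw_jump \<kappa>) (auto simp: norm_Pair)
  also have "\<dots> = ?I + ?J"
    by (subst nn_integral_add) (auto simp: \<mu>.emeasure_space_1)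
  finally have 2: "(\<integral>\<^sup>+z. (\<integral>\<^sup>+y. ennreal (logw (z + (0, y))) \<partial>\<kappa>) \<partial>\<mu>) \<le> ?I + ?J" .
  have hJ: "ennreal (h * r) * ?J \<le> ennreal (h * C)"
    using mult_left_mono[OF C(2), of "ennreal h"] h C by (simp add: ennreal_mult mult.assoc)
  have "(\<integral>\<^sup>+z. ennreal (logw z) \<partial>\<nu>) = ennreal (1/2) * (\<integral>\<^sup>+z. ennreal (logw (z + (2 * h) *\<^sub>R b z)) \<partial>\<mu>)
       + (ennreal (h * r) * (\<integral>\<^sup>+z. (\<integral>\<^sup>+y. ennreal (logw (z + (0, y))) \<partial>\<kappa>) \<partial>\<mu>)
       + ennreal (1/2 - h * r) * ?I)"
    using \<nu> meas unfolding step_rel_def by blast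
  also have "\<dots> \<le> ennreal (1/2) * (?I + ennreal (h * (8 * B + 8 * B\<^sup>2))) + (ennreal (h * r) * (?I + ?J) + ennreal (1/2 - h * r) * ?I)"
    using 1 2 by (intro add_mono mult_left_mono) auto
  also have "\<dots> = (ennreal (1/2) * ?I + (ennreal (h * r) * ?I + ennreal (1/2 - h * r) * ?I))
      + (ennreal (1/2) * ennreal (h * (8 * B + 8 * B\<^sup>2)) + ennreal (h * r) * ?J)"
    by (simp only: distrib_left add_ac)
  also have "\<dots> \<le> ?I + (ennreal (h * (8 * B + 8 * B\<^sup>2)) + ennreal (h * C))"
  proof (intro add_mono hJ ennreal_convex_le)
    have "ennreal (1/2) \<le> ennreal 1" by (rule ennreal_leI) simp
    then have "ennreal (1/2) * ennreal (h * (8 * B + 8 * B\<^sup>2)) \<le> ennreal 1 * ennreal (h * (8 * B + 8 * B\<^sup>2))"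
      by (intro mult_right_mono) auto
    then show "ennreal (1/2) * ennreal (h * (8 * B + 8 * B\<^sup>2)) \<le> ennreal (h * (8 * B + 8 * B\<^sup>2))" by simp
  qed (use h in auto)
  also have "ennreal (h * (8 * B + 8 * B\<^sup>2)) + ennreal (h * C) = ennreal (h * (8 * B + 8 * B\<^sup>2 + C))"
    using h B C by (subst ennreal_plus[symmetric]) (auto simp: distrib_left)
  finally show ?thesis .
qed

text \<open>\<open>c\<close> and \<open>K\<close> are quantified after the chain is fixed, so one
  chain satisfies the volume bounds for all truncation levels of the initial density at
  once.\<close>

lemma chain_exists:
  assumes \<mu>0: "prob_space \<mu>0" "sets \<mu>0 = sets borel"
  obtains \<mu> where "\<mu> 0 = \<mu>0" "\<And>k. prob_space (\<mu> k)" "\<And>k. sets (\<mu> k) = sets borel"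
    "\<And>k. step_rel b \<kappa> r h (\<mu> k) (\<mu> (Suc k))"
    "\<And>c K k A. (\<And>A. A \<in> sets borel \<Longrightarrow> emeasure \<mu>0 A \<le> c + K * emeasure lborel A) \<Longrightarrow> A \<in> sets borel \<Longrightarrow>
       emeasure (\<mu> k) A \<le> c + ennreal (\<rho> ^ k) * K * emeasure lborel A"
    "\<And>k. (\<integral>\<^sup>+z. ennreal (logw z) \<partial>\<mu> k) \<le> (\<integral>\<^sup>+z. ennreal (logw z) \<partial>\<mu>0) + ennreal (real k * h * (8 * B + 8 * B\<^sup>2 + C))"
proof -
  have "\<exists>\<mu>. \<forall>k. (prob_space (\<mu> k) \<and> sets (\<mu> k) = sets borel \<and> (k = 0 \<longrightarrow> \<mu> k = \<mu>0)) \<and> step_rel b \<kappa> r h (\<mu> k) (\<mu> (Suc k))"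
    by (rule dependent_nat_choice) (use \<mu>0 step_exists in auto)
  then obtain \<mu> where \<mu>: "\<mu> 0 = \<mu>0" "\<And>k. prob_space (\<mu> k)" "\<And>k. sets (\<mu> k) = sets borel"
    "\<And>k. step_rel b \<kappa> r h (\<mu> k) (\<mu> (Suc k))" by blast
  show thesis
  proof (rule that[OF \<mu>])
    fix c K :: ennreal and k and A :: "('a \<times> 'a) set"
    assume dom: "\<And>A. A \<in> sets borel \<Longrightarrow> emeasure \<mu>0 A \<le> c + K * emeasure lborel A" and A: "A \<in> sets borel"
    show "emeasure (\<mu> k) A \<le> c + ennreal (\<rho> ^ k) * K * emeasure lborel A"
      using A
    proof (induction k arbitrary: A)
      case 0
      then show ?case using dom \<mu>(1) by simp
    next
      case (Suc k)
      have "emeasure (\<mu> (Suc k)) A \<le> c + ennreal \<rho> * (ennreal (\<rho> ^ k) * K) * emeasure lborel A"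
        by (rule step_emeasure_le[OF \<mu>(2) \<mu>(3) \<mu>(3) \<mu>(4) Suc.IH Suc.prems])
      also have "ennreal \<rho> * (ennreal (\<rho> ^ k) * K) = ennreal (\<rho> ^ Suc k) * K"
        using \<rho>(1) by (simp add: ennreal_mult mult.assoc)
      finally show ?case .
    qed
  next
    fix k
    show "(\<integral>\<^sup>+z. ennreal (logw z) \<partial>\<mu> k) \<le> (\<integral>\<^sup>+z. ennreal (logw z) \<partial>\<mu>0) + ennreal (real k * h * (8 * B + 8 * B\<^sup>2 + C))"
    proof (induction k)
      case 0
      then show ?case using \<mu>(1) by simp
    next
      case (Suc k)
      have "(\<integral>\<^sup>+z. ennreal (logw z) \<partial>\<mu> (Suc k)) \<le> (\<integral>\<^sup>+z. ennreal (logw z) \<partial>\<mu> k) + ennreal (h * (8 * B + 8 * B\<^sup>2 + C))"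
        by (rule step_logw[OF \<mu>(2) \<mu>(3) \<mu>(4)])
      also have "\<dots> \<le> (\<integral>\<^sup>+z. ennreal (logw z) \<partial>\<mu>0) + ennreal (real k * h * (8 * B + 8 * B\<^sup>2 + C)) + ennreal (h * (8 * B + 8 * B\<^sup>2 + C))"
        by (intro add_right_mono Suc.IH)
      also have "\<dots> = (\<integral>\<^sup>+z. ennreal (logw z) \<partial>\<mu>0) + ennreal (real k * h * (8 * B + 8 * B\<^sup>2 + C) + h * (8 * B + 8 * B\<^sup>2 + C))"
        using h B C by (simp add: ennreal_plus add.assoc)
      also have "real k * h * (8 * B + 8 * B\<^sup>2 + C) + h * (8 * B + 8 * B\<^sup>2 + C) = real (Suc k) * h * (8 * B + 8 * B\<^sup>2 + C)"
        by (simp add: algebra_simps)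
      finally show ?case .
    qed
  qed
qed

end

section \<open>Space-time laws and their limit\<close>

lemma nat_floor_divide:
  fixes t h :: real
  assumes "0 < h" "0 < t" "t < real N * h"
  shows "nat \<lfloor>t / h\<rfloor> < N" "real (nat \<lfloor>t / h\<rfloor>) * h \<le> t" "t < (real (nat \<lfloor>t / h\<rfloor>) + 1) * h"
proof -
  have 0: "0 \<le> t / h" using assms by simp
  have "t / h < real N" using assms by (simp add: field_simps)
  then show "nat \<lfloor>t / h\<rfloor> < N" using 0 by linarith
  have "real (nat \<lfloor>t / h\<rfloor>) \<le> t / h" using 0 by linarith
  then show "real (nat \<lfloor>t / h\<rfloor>) * h \<le> t" using assms(1) by (simp only: pos_le_divide_eq)
  have "t / h < real (nat \<lfloor>t / h\<rfloor>) + 1" using 0 by linarith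
  then show "t < (real (nat \<lfloor>t / h\<rfloor>) + 1) * h" using assms(1) by (simp only: pos_divide_less_eq)
qed

lemma integral_step_function:
  fixes G :: "nat \<Rightarrow> real"
  assumes h: "0 < h"
  shows "integrable lborel (\<lambda>t. indicator {0<..<real N * h} t * G (nat \<lfloor>t / h\<rfloor>))"
    and "(\<integral>t. indicator {0<..<real N * h} t * G (nat \<lfloor>t / h\<rfloor>) \<partial>lborel) = h * (\<Sum>k<N. G k)"
proof -
  let ?f = "\<lambda>t. indicator {0<..<real N * h} t * G (nat \<lfloor>t / h\<rfloor>)"
  let ?I = "\<lambda>k. {real k * h..<(real k + 1) * h}"
  let ?g = "\<lambda>t. \<Sum>k<N. G k * indicator (?I k) t"
  have em: "emeasure lborel (?I k) = ennreal h" for k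
    using h by (simp add: algebra_simps)
  have int: "integrable lborel (\<lambda>t. G k * indicator (?I k) t)" for k
    using em by (intro integrable_mult_right) (simp add: integrable_indicator_iff)
  have "(\<integral>t. G k * indicator (?I k) t \<partial>lborel) = G k * h" for k
    using h by (simp add: algebra_simps)
  then have g: "has_bochner_integral lborel ?g (\<Sum>k<N. G k * h)"
    using int by (intro has_bochner_integral_sum) (simp add: has_bochner_integral_iff)
  have f: "?f \<in> borel_measurable lborel" by measurable
  \<comment> \<open>The half-open cells contain \<open>t = 0\<close>, the open interval does not;
    this single point is discarded.\<close>
  have "AE t in lborel. ?g t = ?f t"
    using AE_lborel_singleton[of 0]
  proof eventually_elim
    case (elim t)
    have mem: "t \<in> ?I k \<longleftrightarrow> 0 \<le> t \<and> k = nat \<lfloor>t / h\<rfloor>" for k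
    proof
      assume "t \<in> ?I k"
      then have t: "real k * h \<le> t" "t < (real k + 1) * h" by auto
      then have "real k \<le> t / h" "t / h < real k + 1" using h by (auto simp: field_simps)
      moreover from this have "\<lfloor>t / h\<rfloor> = int k" by linarith
      ultimately show "0 \<le> t \<and> k = nat \<lfloor>t / h\<rfloor>"
        using t h by (auto intro: order.trans[OF _ t(1)])
    next
      assume k: "0 \<le> t \<and> k = nat \<lfloor>t / h\<rfloor>"
      have "0 \<le> t / h" using k h by simp
      then have "real k \<le> t / h" "t / h < real k + 1" using k by linarith+
      then show "t \<in> ?I k" using h by (auto simp: field_simps)
    qed
    show "?g t = ?f t"
    proof (cases "0 < t \<and> t < real N * h")
      case True
      then have "nat \<lfloor>t / h\<rfloor> < N" using nat_floor_divide(1)[OF h] by blast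
      moreover have "?g t = (\<Sum>k<N. if k = nat \<lfloor>t / h\<rfloor> then G k else 0)"
        using True by (intro sum.cong) (auto simp: indicator_def mem simp del: atLeastLessThan_iff)
      ultimately show ?thesis using True by simp
    next
      case False
      have "\<not> t \<in> ?I k" if "k < N" for k
      proof
        assume t: "t \<in> ?I k"
        then have "0 < t" using elim mem by force
        moreover have "(real k + 1) * h \<le> real N * h"
          using that h by (intro mult_right_mono) auto
        ultimately show False using False t by auto
      qed
      then have "?g t = 0" by (intro sum.neutral) (auto simp: indicator_def)
      with False show ?thesis by (auto simp: indicator_def)
    qed
  qed
  with g f have "has_bochner_integral lborel ?f (\<Sum>k<N. G k * h)"
    by (subst has_bochner_integral_cong_AE[symmetric, where f = ?g]) auto
  then show "integrable lborel ?f" "integral\<^sup>L lborel ?f = h * (\<Sum>k<N. G k)"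
    by (auto simp: has_bochner_integral_iff sum_distrib_left mult.commute)
qed

text \<open>\<open>m\<close> is the joint law of the state of the chain at step
  \<open>\<lfloor>t / h\<rfloor>\<close> and of a time \<open>t\<close> uniform in (0, T). The last
  estimate compares an integral with a mean over the steps and allows \<open>F\<close> to vary in
  time inside a cell, at the cost of \<open>d\<close>.\<close>

lemma space_time_average:
  fixes \<mu> :: "nat \<Rightarrow> 'e::euclidean_space measure"
  assumes \<mu>: "\<And>k. prob_space (\<mu> k)" "\<And>k. sets (\<mu> k) = sets borel" and h: "0 < h" and N: "0 < N"
  defines "T \<equiv> real N * h"
  obtains m :: "('e \<times> real) measure" where "prob_space m" "sets m = sets borel"
    "\<And>f X. f \<in> borel_measurable borel \<Longrightarrow> X \<in> borel_measurable borel \<Longrightarrow>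
       (\<And>k t. k < N \<Longrightarrow> (\<integral>\<^sup>+z. f (z, t) \<partial>\<mu> k) \<le> X t) \<Longrightarrow>
       (\<integral>\<^sup>+p. f p \<partial>m) \<le> ennreal (1 / T) * (\<integral>\<^sup>+t. X t * indicator {0<..<T} t \<partial>lborel)"
    "\<And>J. J \<in> sets borel \<Longrightarrow> emeasure m (UNIV \<times> J) = ennreal (1 / T) * emeasure lborel (J \<inter> {0<..<T})"
    "\<And>F C G d. F \<in> borel_measurable borel \<Longrightarrow> (\<And>p. \<bar>F p\<bar> \<le> (C::real)) \<Longrightarrow>
       (\<And>k t. k < N \<Longrightarrow> real k * h \<le> t \<Longrightarrow> t \<le> (real k + 1) * h \<Longrightarrow> \<bar>(\<integral>z. F (z, t) \<partial>\<mu> k) - G k\<bar> \<le> d) \<Longrightarrow>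
       \<bar>(\<integral>p. F p \<partial>m) - (\<Sum>k<N. G k) / real N\<bar> \<le> d"
proof -
  have T: "0 < T" using h N by (simp add: T_def)
  define U where "U = uniform_measure lborel {0<..<T}"
  have U0: "emeasure lborel {0<..<T} = ennreal T" using T by simp
  interpret U: prob_space U
    unfolding U_def using T by (intro prob_space_uniform_measure) auto
  have setsU [measurable_cong]: "sets U = sets borel" by (simp add: U_def)
  have nnU: "(\<integral>\<^sup>+t. f t \<partial>U) = ennreal (1 / T) * (\<integral>\<^sup>+t. f t * indicator {0<..<T} t \<partial>lborel)"
    if "f \<in> borel_measurable borel" for f
    unfolding U_def using that T
    by (subst nn_integral_uniform_measure) (auto simp: divide_ennreal_def inverse_ennreal mult.commute inverse_eq_divide)
  have AEU: "AE t in U. t \<in> {0<..<T}"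
    unfolding U_def using T by (intro AE_uniform_measureI) auto
  \<comment> \<open>The true time \<open>t\<close> is recorded, not the grid point below it. Hence
    the time marginal is exactly uniform, and \<open>m\<close> can be dominated by volume in
    space-time.\<close>
  define K where "K t = distr (\<mu> (nat \<lfloor>t / h\<rfloor>)) borel (\<lambda>z. (z, t))" for t
  have pairm [measurable]: "(\<lambda>z. (z, t)) \<in> borel_measurable borel" for t :: real
    by (intro borel_measurable_continuous_onI continuous_intros)
  have pairm' [measurable]: "(\<lambda>z. (z, t)) \<in> borel_measurable (\<mu> k)" for t :: real and k
    unfolding measurable_cong_sets[OF \<mu>(2) refl] by (rule pairm)
  have K: "K \<in> measurable U (subprob_algebra borel)"
    unfolding K_def
  proof (rule measurable_distr2[where M = borel])
    have "(\<lambda>(t, z). (z, t)) \<in> borel_measurable (borel :: (real \<times> 'e) measure)"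
      by (intro borel_measurable_continuous_onI) (auto simp: case_prod_beta' intro!: continuous_intros)
    then show "(\<lambda>(t, z). (z, t)) \<in> borel_measurable (U \<Otimes>\<^sub>M (borel :: 'e measure))"
      by (simp add: borel_prod[symmetric] cong: measurable_cong_sets sets_pair_measure_cong[OF setsU refl])
    have "(\<lambda>t. nat \<lfloor>t / h\<rfloor>) \<in> measurable U (count_space UNIV)" by measurable
    moreover have "\<mu> \<in> measurable (count_space UNIV) (subprob_algebra borel)"
      using \<mu> by (auto simp: space_subprob_algebra prob_space_imp_subprob_space)
    ultimately show "(\<lambda>t. \<mu> (nat \<lfloor>t / h\<rfloor>)) \<in> measurable U (subprob_algebra borel)"
      by (rule measurable_compose)
  qed
  have K1: "prob_space (K t)" for t
    unfolding K_def by (intro prob_space.prob_space_distr \<mu> pairm')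
  define m where "m = U \<bind> K"
  have setsm: "sets m = sets borel"
    unfolding m_def by (rule sets_bind) (auto simp: K_def U.not_empty)
  have nnK: "(\<integral>\<^sup>+p. f p \<partial>K t) = (\<integral>\<^sup>+z. f (z, t) \<partial>\<mu> (nat \<lfloor>t / h\<rfloor>))" if "f \<in> borel_measurable borel" for f t
    unfolding K_def using that by (intro nn_integral_distr) auto
  have nnm: "(\<integral>\<^sup>+p. f p \<partial>m) = (\<integral>\<^sup>+t. (\<integral>\<^sup>+p. f p \<partial>K t) \<partial>U)" if "f \<in> borel_measurable borel" for f
    unfolding m_def by (rule nn_integral_bind[OF that K])
  show thesis
  proof
    show "prob_space m"
      unfolding m_def by (rule U.prob_space_bind[OF _ K]) (simp add: K1)
    show "sets m = sets borel" by (rule setsm)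
  next
    fix f :: "'e \<times> real \<Rightarrow> ennreal" and X :: "real \<Rightarrow> ennreal"
    assume f: "f \<in> borel_measurable borel" and X: "X \<in> borel_measurable borel"
      and le: "\<And>k t. k < N \<Longrightarrow> (\<integral>\<^sup>+z. f (z, t) \<partial>\<mu> k) \<le> X t"
    have "(\<integral>\<^sup>+p. f p \<partial>m) \<le> (\<integral>\<^sup>+t. X t \<partial>U)"
      unfolding nnm[OF f] nnK[OF f]
    proof (rule nn_integral_mono_AE)
      show "AE t in U. (\<integral>\<^sup>+z. f (z, t) \<partial>\<mu> (nat \<lfloor>t / h\<rfloor>)) \<le> X t"
        using AEU by eventually_elim (use le nat_floor_divide(1)[OF h] in \<open>auto simp: T_def\<close>)
    qed
    then show "(\<integral>\<^sup>+p. f p \<partial>m) \<le> ennreal (1 / T) * (\<integral>\<^sup>+t. X t * indicator {0<..<T} t \<partial>lborel)"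
      by (simp add: nnU[OF X])
  next
    fix J :: "real set" assume J: "J \<in> sets borel"
    then have UJ: "UNIV \<times> J \<in> sets (borel :: ('e \<times> real) measure)"
      by (intro borel_Times) auto
    have "emeasure m (UNIV \<times> J) = (\<integral>\<^sup>+p. indicator (UNIV \<times> J) p \<partial>m)"
      using UJ setsm by simp
    also have "\<dots> = (\<integral>\<^sup>+t. (\<integral>\<^sup>+z. indicator (UNIV \<times> J) (z, t) \<partial>\<mu> (nat \<lfloor>t / h\<rfloor>)) \<partial>U)"
      using UJ by (subst nnm) (auto simp: nnK)
    also have "\<dots> = (\<integral>\<^sup>+t. indicator J t \<partial>U)"
      by (intro nn_integral_cong) (simp add: indicator_def prob_space.emeasure_space_1[OF \<mu>(1)])
    also have "\<dots> = ennreal (1 / T) * (\<integral>\<^sup>+t. indicator J t * indicator {0<..<T} t \<partial>lborel)"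
      using J by (intro nnU) auto
    also have "(\<integral>\<^sup>+t. indicator J t * indicator {0<..<T} t \<partial>lborel) = (\<integral>\<^sup>+t. indicator (J \<inter> {0<..<T}) t \<partial>lborel)"
      by (intro nn_integral_cong) (auto simp: indicator_def)
    also have "\<dots> = emeasure lborel (J \<inter> {0<..<T})"
      using J by simp
    finally show "emeasure m (UNIV \<times> J) = ennreal (1 / T) * emeasure lborel (J \<inter> {0<..<T})" .
  next
    fix F :: "'e \<times> real \<Rightarrow> real" and C d :: real and G :: "nat \<Rightarrow> real"
    assume F: "F \<in> borel_measurable borel" "\<And>p. \<bar>F p\<bar> \<le> C"
      and G: "\<And>k t. k < N \<Longrightarrow> real k * h \<le> t \<Longrightarrow> t \<le> (real k + 1) * h \<Longrightarrow> \<bar>(\<integral>z. F (z, t) \<partial>\<mu> k) - G k\<bar> \<le> d"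
    let ?I = "\<lambda>t. \<integral>p. F p \<partial>K t" and ?G = "\<lambda>t. indicator {0<..<T} t * G (nat \<lfloor>t / h\<rfloor>)"
    have Im: "?I \<in> borel_measurable U"
      using K by (rule measurable_compose) (rule integral_measurable_subprob_algebra[OF F(1)])
    have IC: "\<bar>?I t\<bar> \<le> C" for t
    proof -
      interpret Kt: prob_space "K t" by (rule K1)
      have "integrable (K t) F"
        by (rule Kt.integrable_const_bound[of _ C]) (use F in \<open>auto simp: K_def\<close>)
      then have "\<bar>?I t\<bar> \<le> (\<integral>p. \<bar>F p\<bar> \<partial>K t)" "integrable (K t) (\<lambda>p. \<bar>F p\<bar>)"
        by (auto intro: integral_abs_bound)
      moreover from this have "(\<integral>p. \<bar>F p\<bar> \<partial>K t) \<le> (\<integral>p. C \<partial>K t)"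
        using F by (intro integral_mono) auto
      moreover have "(\<integral>p. C \<partial>K t) = C" using Kt.prob_space by simp
      ultimately show ?thesis by linarith
    qed
    have intI: "integrable U ?I"
      by (rule U.integrable_const_bound[OF _ Im, of C]) (simp add: IC)
    have denU: "U = density lborel (\<lambda>t. ennreal (indicator {0<..<T} t / T))"
      unfolding U_def uniform_measure_def
      using T by (intro density_cong) (auto simp: divide_ennreal_def inverse_ennreal indicator_def inverse_eq_divide)
    have intG: "integrable U ?G" "integral\<^sup>L U ?G = (\<Sum>k<N. G k) / real N"
    proof -
      have eq: "indicator {0<..<T} t / T * ?G t = (1 / T) * ?G t" for t
        by (simp add: indicator_def)
      show "integrable U ?G"
        unfolding denU using T integral_step_function(1)[OF h, of N G]
        by (subst integrable_real_density) (auto simp only: eq, auto simp: T_def)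
      have "integral\<^sup>L U ?G = (\<integral>t. (1 / T) * ?G t \<partial>lborel)"
        unfolding denU using T by (subst integral_real_density) (auto simp only: eq, auto)
      also have "\<dots> = (1 / T) * (h * (\<Sum>k<N. G k))"
        using integral_step_function(2)[OF h, of N G] by (simp add: T_def)
      also have "\<dots> = (\<Sum>k<N. G k) / real N" using h by (simp add: T_def)
      finally show "integral\<^sup>L U ?G = (\<Sum>k<N. G k) / real N" .
    qed
    have "(\<integral>p. F p \<partial>m) = (\<integral>t. ?I t \<partial>U)"
      unfolding m_def
      by (rule integral_bind[OF F(1) F(2) K U.finite_measure_axioms, where B' = 1])
        (auto simp: prob_space.emeasure_space_1[OF K1])
    then have "\<bar>(\<integral>p. F p \<partial>m) - (\<Sum>k<N. G k) / real N\<bar> = \<bar>\<integral>t. ?I t - ?G t \<partial>U\<bar>"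
      using intI intG by simp
    also have "\<dots> \<le> (\<integral>t. \<bar>?I t - ?G t\<bar> \<partial>U)"
      by (rule integral_abs_bound)
    also have "\<dots> \<le> (\<integral>t. d \<partial>U)"
    proof (rule integral_mono_AE)
      show "AE t in U. \<bar>?I t - ?G t\<bar> \<le> d"
        using AEU
      proof eventually_elim
        case (elim t)
        then have t: "0 < t" "t < real N * h" by (auto simp: T_def)
        have "?I t = (\<integral>z. F (z, t) \<partial>\<mu> (nat \<lfloor>t / h\<rfloor>))"
          unfolding K_def using F by (intro integral_distr) auto
        with G[of "nat \<lfloor>t / h\<rfloor>" t] nat_floor_divide[OF h t] elim show ?case
          by (simp add: less_imp_le)
      qed
    qed (use intI intG in auto)
    also have "\<dots> = d" using U.prob_space by simp
    finally show "\<bar>(\<integral>p. F p \<partial>m) - (\<Sum>k<N. G k) / real N\<bar> \<le> d" .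
  qed
qed

text \<open>Expected change of \<open>\<phi>\<close> in one step from the state \<open>z\<close> at
  time \<open>t\<close>, with the weights 1/2, \<open>h * r\<close> and \<open>1/2 - h * r\<close>
  regrouped around \<open>\<phi> (z, t + h)\<close>. Divided by \<open>h\<close> it is the discrete
  analogue of time derivative plus generator.\<close>

definition scheme_incr ::
  "('a::euclidean_space \<times> 'a \<Rightarrow> 'a \<times> 'a) \<Rightarrow> 'a measure \<Rightarrow> real \<Rightarrow> real \<Rightarrow> (('a \<times> 'a) \<times> real \<Rightarrow> real) \<Rightarrow> real \<Rightarrow> 'a \<times> 'a \<Rightarrow> real" where
  "scheme_incr b \<kappa> r h \<phi> t z = \<phi> (z, t + h) - \<phi> (z, t)
     + 1/2 * (\<phi> (z + (2 * h) *\<^sub>R b z, t + h) - \<phi> (z, t + h))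
     + h * r * ((\<integral>y. \<phi> (z + (0, y), t + h) \<partial>\<kappa>) - \<phi> (z, t + h))"

lemma borel_measurable_logw_fst [measurable]:
  "(\<lambda>p. logw (fst p)) \<in> borel_measurable (borel :: ('b::euclidean_space \<times> 'c::euclidean_space) measure)"
proof -
  have "fst \<in> borel_measurable (borel :: ('b \<times> 'c) measure)"
    by (intro borel_measurable_continuous_onI continuous_on_fst continuous_on_id)
  then show ?thesis by (rule measurable_compose) measurable
qed

text \<open>The expectations \<open>S k\<close> of \<open>\<phi>\<close> along the chain change by
  the mean of \<open>scheme_incr\<close>, start at the initial integral and end at 0 because
  \<open>\<phi>\<close> vanishes at time \<open>T\<close>. If \<open>h * F\<close> reproduces the
  increments up to \<open>h * d\<close>, the space-time mean of \<open>F\<close> is minus the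
  initial integral over \<open>T\<close>, up to \<open>d\<close>.\<close>

lemma (in drift_jump_scheme) scheme_average:
  fixes g0 :: "'a \<times> 'a \<Rightarrow> real" and N :: nat
  assumes g0: "g0 \<in> borel_measurable borel" "\<And>z. 0 \<le> g0 z" "(\<integral>\<^sup>+z. ennreal (g0 z) \<partial>lborel) = 1"
    and N: "0 < N" and T: "T = real N * h"
  obtains m :: "(('a \<times> 'a) \<times> real) measure" where "prob_space m" "sets m = sets borel"
    "\<And>c K A. (\<And>A. A \<in> sets borel \<Longrightarrow> emeasure (density lborel (\<lambda>z. ennreal (g0 z))) A \<le> c + K * emeasure lborel A) \<Longrightarrow> A \<in> sets borel \<Longrightarrow>
       emeasure m A \<le> c + ennreal (1 / T) * (ennreal (exp (4 * T * L * DIM('a \<times> 'a))) * K * emeasure lborel A)"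
    "(\<integral>\<^sup>+p. ennreal (logw (fst p)) \<partial>m) \<le> (\<integral>\<^sup>+z. ennreal (logw z) * ennreal (g0 z) \<partial>lborel) + ennreal (T * (8 * B + 8 * B\<^sup>2 + C))"
    "\<And>J. J \<in> sets borel \<Longrightarrow> emeasure m (UNIV \<times> J) = ennreal (1 / T) * emeasure lborel (J \<inter> {0<..<T})"
    "\<And>F \<phi> C C' d. F \<in> borel_measurable borel \<Longrightarrow> (\<And>p. \<bar>F p\<bar> \<le> C) \<Longrightarrow> \<phi> \<in> borel_measurable borel \<Longrightarrow>
       (\<And>p. \<bar>\<phi> p\<bar> \<le> C') \<Longrightarrow> (\<And>z. \<phi> (z, T) = 0) \<Longrightarrow>
       (\<And>k t z. k < N \<Longrightarrow> real k * h \<le> t \<Longrightarrow> t \<le> real k * h + h \<Longrightarrow>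
          \<bar>scheme_incr b \<kappa> r h \<phi> (real k * h) z - h * F (z, t)\<bar> \<le> h * d) \<Longrightarrow>
       \<bar>(\<integral>p. F p \<partial>m) + (\<integral>z. g0 z * \<phi> (z, 0) \<partial>lborel) / T\<bar> \<le> d"
proof -
  define \<mu>0 where "\<mu>0 = density lborel (\<lambda>z. ennreal (g0 z))"
  have T0: "0 < T" using T N h by simp
  have \<mu>0: "prob_space \<mu>0" "sets \<mu>0 = sets borel"
    using g0 by (auto simp: \<mu>0_def emeasure_density intro!: prob_spaceI)
  obtain \<mu> where \<mu>: "\<mu> 0 = \<mu>0" "\<And>k. prob_space (\<mu> k)" "\<And>k. sets (\<mu> k) = sets borel"
    "\<And>k. step_rel b \<kappa> r h (\<mu> k) (\<mu> (Suc k))"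
    and dom: "\<And>c K k A. (\<And>A. A \<in> sets borel \<Longrightarrow> emeasure \<mu>0 A \<le> c + K * emeasure lborel A) \<Longrightarrow> A \<in> sets borel \<Longrightarrow>
       emeasure (\<mu> k) A \<le> c + ennreal (\<rho> ^ k) * K * emeasure lborel A"
    and mom: "\<And>k. (\<integral>\<^sup>+z. ennreal (logw z) \<partial>\<mu> k) \<le> (\<integral>\<^sup>+z. ennreal (logw z) \<partial>\<mu>0) + ennreal (real k * h * (8 * B + 8 * B\<^sup>2 + C))"
    using chain_exists[OF \<mu>0] by blast
  note [measurable_cong] = \<mu>(3) \<kappa>(2)
  have pairm [measurable]: "(\<lambda>z. (z, t)) \<in> borel_measurable (borel :: ('a \<times> 'a) measure)" for t :: real
    by (intro borel_measurable_continuous_onI continuous_intros)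
  obtain m :: "(('a \<times> 'a) \<times> real) measure" where m: "prob_space m" "sets m = sets borel"
    and m_le: "\<And>f X. f \<in> borel_measurable borel \<Longrightarrow> X \<in> borel_measurable borel \<Longrightarrow>
       (\<And>k t. k < N \<Longrightarrow> (\<integral>\<^sup>+z. f (z, t) \<partial>\<mu> k) \<le> X t) \<Longrightarrow>
       (\<integral>\<^sup>+p. f p \<partial>m) \<le> ennreal (1 / T) * (\<integral>\<^sup>+t. X t * indicator {0<..<T} t \<partial>lborel)"
    and m_time: "\<And>J. J \<in> sets borel \<Longrightarrow> emeasure m (UNIV \<times> J) = ennreal (1 / T) * emeasure lborel (J \<inter> {0<..<T})"
    and m_sum: "\<And>F C G d. F \<in> borel_measurable borel \<Longrightarrow> (\<And>p. \<bar>F p\<bar> \<le> (C::real)) \<Longrightarrow>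
       (\<And>k t. k < N \<Longrightarrow> real k * h \<le> t \<Longrightarrow> t \<le> (real k + 1) * h \<Longrightarrow> \<bar>(\<integral>z. F (z, t) \<partial>\<mu> k) - G k\<bar> \<le> d) \<Longrightarrow>
       \<bar>(\<integral>p. F p \<partial>m) - (\<Sum>k<N. G k) / real N\<bar> \<le> d"
  proof (rule space_time_average[of \<mu>, OF \<mu>(2,3) h(1) N, folded T], goal_cases)
    case (1 m)
    show ?case by (rule 1(1)[OF 1(2-)])
  qed
  have U: "ennreal (1 / T) * (\<integral>\<^sup>+t. c * indicator {0<..<T} t \<partial>lborel) = c" for c
  proof -
    have "ennreal (1 / T) * (\<integral>\<^sup>+t. c * indicator {0<..<T} t \<partial>lborel) = ennreal (1 / T) * (c * ennreal T)"
      using T0 by (simp add: nn_integral_cmult_indicator)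
    also have "\<dots> = c * ennreal (1 / T * T)"
      using T0 by (subst ennreal_mult) (auto simp: mult_ac)
    finally show ?thesis using T0 by simp
  qed
  show thesis
  proof (rule that[OF m])
    fix c K A
    assume d: "\<And>A. A \<in> sets borel \<Longrightarrow> emeasure (density lborel (\<lambda>z. ennreal (g0 z))) A \<le> c + K * emeasure lborel A"
      and A: "A \<in> sets (borel :: (('a \<times> 'a) \<times> real) measure)"
    define E where "E = ennreal (exp (4 * T * L * DIM('a \<times> 'a)))"
    have A' [measurable]: "A \<in> sets ((borel :: ('a \<times> 'a) measure) \<Otimes>\<^sub>M (borel :: real measure))"
      by (subst borel_prod) (rule A)
    \<comment> \<open>The volume of the time slice appears; integrating it over all times gives the
      volume of \<open>A\<close>.\<close>
    let ?X = "\<lambda>t. c + E * K * (\<integral>\<^sup>+z. indicator A (z, t) \<partial>lborel)"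
    have slice: "(\<lambda>z. (z, t)) -` A \<in> sets borel" for t
      using measurable_sets[OF pairm A] by simp
    have ind: "(\<integral>\<^sup>+z. indicator A (z, t) \<partial>M) = emeasure M ((\<lambda>z. (z, t)) -` A)" if "sets M = sets borel" for M t
    proof -
      have "(\<integral>\<^sup>+z. indicator A (z, t) \<partial>M) = (\<integral>\<^sup>+z. indicator ((\<lambda>z. (z, t)) -` A) z \<partial>M)"
        by (intro nn_integral_cong) (auto simp: indicator_def)
      then show ?thesis using that slice by simp
    qed
    have "emeasure m A = (\<integral>\<^sup>+p. indicator A p \<partial>m)" using A m by simp
    also have "\<dots> \<le> ennreal (1 / T) * (\<integral>\<^sup>+t. ?X t * indicator {0<..<T} t \<partial>lborel)"
    proof (rule m_le)
      show "(indicator A :: _ \<Rightarrow> ennreal) \<in> borel_measurable borel" using A by simp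
      show "?X \<in> borel_measurable borel" by measurable
      fix k t assume k: "k < N"
      have "\<rho> ^ k \<le> \<rho> ^ N" using \<rho>(1) k by (intro power_increasing) auto
      also have "\<dots> \<le> exp (4 * (h * L) * DIM('a \<times> 'a)) ^ N"
        using \<rho> by (intro power_mono) auto
      also have "\<dots> = exp (4 * T * L * DIM('a \<times> 'a))"
        by (simp add: exp_of_nat_mult[symmetric] T mult_ac)
      finally have "ennreal (\<rho> ^ k) \<le> E" unfolding E_def by (rule ennreal_leI)
      then have "c + ennreal (\<rho> ^ k) * K * emeasure lborel ((\<lambda>z. (z, t)) -` A)
          \<le> c + E * K * emeasure lborel ((\<lambda>z. (z, t)) -` A)"
        by (intro add_left_mono mult_right_mono) auto
      moreover have "emeasure (\<mu> k) ((\<lambda>z. (z, t)) -` A) \<le> c + ennreal (\<rho> ^ k) * K * emeasure lborel ((\<lambda>z. (z, t)) -` A)"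
        by (rule dom[OF _ slice]) (use d in \<open>simp add: \<mu>0_def\<close>)
      ultimately have "emeasure (\<mu> k) ((\<lambda>z. (z, t)) -` A) \<le> c + E * K * emeasure lborel ((\<lambda>z. (z, t)) -` A)"
        by (rule order.trans[rotated])
      then show "(\<integral>\<^sup>+z. indicator A (z, t) \<partial>\<mu> k) \<le> ?X t"
        by (subst (1 2) ind) (auto simp: \<mu>(3))
    qed
    also have "(\<integral>\<^sup>+t. ?X t * indicator {0<..<T} t \<partial>lborel) \<le>
       (\<integral>\<^sup>+t. c * indicator {0<..<T} t + E * K * (\<integral>\<^sup>+z. indicator A (z, t) \<partial>lborel) \<partial>lborel)"
      by (intro nn_integral_mono) (auto simp: indicator_def)
    also have "\<dots> = (\<integral>\<^sup>+t. c * indicator {0<..<T} t \<partial>lborel) + E * K * (\<integral>\<^sup>+t. (\<integral>\<^sup>+z. indicator A (z, t) \<partial>lborel) \<partial>lborel)"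
      by (subst nn_integral_add) (auto simp: nn_integral_cmult)
    also have "(\<integral>\<^sup>+t. (\<integral>\<^sup>+z. indicator A (z, t) \<partial>lborel) \<partial>lborel) = (\<integral>\<^sup>+p. indicator A p \<partial>(lborel \<Otimes>\<^sub>M lborel))"
      by (rule lborel_pair.nn_integral_snd) simp
    also have "\<dots> = emeasure lborel A"
      using A by (simp add: lborel_prod)
    finally show "emeasure m A \<le> c + ennreal (1 / T) * (ennreal (exp (4 * T * L * DIM('a \<times> 'a))) * K * emeasure lborel A)"
      by (simp add: distrib_left U E_def mult_left_mono)
  next
    let ?X = "(\<integral>\<^sup>+z. ennreal (logw z) \<partial>\<mu>0) + ennreal (T * (8 * B + 8 * B\<^sup>2 + C))"
    have "(\<integral>\<^sup>+p. ennreal (logw (fst p)) \<partial>m) \<le> ennreal (1 / T) * (\<integral>\<^sup>+t. ?X * indicator {0<..<T} t \<partial>lborel)"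
    proof (rule m_le)
      show "(\<lambda>p. ennreal (logw (fst p))) \<in> borel_measurable (borel :: (('a \<times> 'a) \<times> real) measure)"
        by measurable
      fix k t assume "k < N"
      then have "real k * h * (8 * B + 8 * B\<^sup>2 + C) \<le> T * (8 * B + 8 * B\<^sup>2 + C)"
        unfolding T using h B C by (intro mult_right_mono) auto
      then have "ennreal (real k * h * (8 * B + 8 * B\<^sup>2 + C)) \<le> ennreal (T * (8 * B + 8 * B\<^sup>2 + C))"
        by (rule ennreal_leI)
      with mom[of k] show "(\<integral>\<^sup>+z. ennreal (logw (fst (z, t))) \<partial>\<mu> k) \<le> ?X"
        by (simp add: add_left_mono order.trans)
    qed simp
    also have "\<dots> = ?X" by (rule U)
    also have "(\<integral>\<^sup>+z. ennreal (logw z) \<partial>\<mu>0) = (\<integral>\<^sup>+z. ennreal (logw z) * ennreal (g0 z) \<partial>lborel)"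
      using g0 unfolding \<mu>0_def by (subst nn_integral_density) (auto simp: mult.commute)
    finally show "(\<integral>\<^sup>+p. ennreal (logw (fst p)) \<partial>m) \<le> (\<integral>\<^sup>+z. ennreal (logw z) * ennreal (g0 z) \<partial>lborel) + ennreal (T * (8 * B + 8 * B\<^sup>2 + C))" .
  next
    fix J :: "real set" assume "J \<in> sets borel"
    then show "emeasure m (UNIV \<times> J) = ennreal (1 / T) * emeasure lborel (J \<inter> {0<..<T})" by (rule m_time)
  next
    fix F \<phi> :: "('a \<times> 'a) \<times> real \<Rightarrow> real" and C C' d
    assume F: "F \<in> borel_measurable borel" "\<And>p. \<bar>F p\<bar> \<le> C"
      and \<phi>: "\<phi> \<in> borel_measurable borel" "\<And>p. \<bar>\<phi> p\<bar> \<le> C'" "\<And>z. \<phi> (z, T) = 0"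
      and cons: "\<And>k t z. k < N \<Longrightarrow> real k * h \<le> t \<Longrightarrow> t \<le> real k * h + h \<Longrightarrow>
          \<bar>scheme_incr b \<kappa> r h \<phi> (real k * h) z - h * F (z, t)\<bar> \<le> h * d"
    interpret \<kappa>: prob_space \<kappa> by (rule \<kappa>)
    have [measurable]: "(\<lambda>z. F (z, t)) \<in> borel_measurable borel" "(\<lambda>z. \<phi> (z, t)) \<in> borel_measurable borel" for t
      using measurable_compose[OF pairm F(1)] measurable_compose[OF pairm \<phi>(1)] by auto
    define S where "S k = (\<integral>z. \<phi> (z, real k * h) \<partial>\<mu> k)" for k
    \<comment> \<open>Difference quotient in time of the expectation; its mean over the steps
      telescopes to \<open>(S N - S 0) / T\<close>.\<close>
    define G where "G k = (S (Suc k) - S k) / h" for k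
    have "\<bar>(\<integral>p. F p \<partial>m) - (\<Sum>k<N. G k) / real N\<bar> \<le> d"
    proof (rule m_sum[OF F])
      fix k t assume k: "k < N" "real k * h \<le> t" "t \<le> (real k + 1) * h"
      interpret \<mu>: prob_space "\<mu> k" by (rule \<mu>)
      define f where "f z = \<phi> (z, real k * h + h)" for z
      have [measurable]: "f \<in> borel_measurable borel" unfolding f_def[abs_def] by measurable
      have fC: "\<bar>f z\<bar> \<le> C'" for z by (simp add: f_def \<phi>)
      have C': "\<bar>\<integral>y. f (z + (0, y)) \<partial>\<kappa>\<bar> \<le> C'" for z
      proof -
        have i: "integrable \<kappa> (\<lambda>y. f (z + (0, y)))"
          by (rule \<kappa>.integrable_const_bound[of _ C']) (auto simp: fC)
        have "\<bar>\<integral>y. f (z + (0, y)) \<partial>\<kappa>\<bar> \<le> (\<integral>y. \<bar>f (z + (0, y))\<bar> \<partial>\<kappa>)" by (rule integral_abs_bound)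
        also have "\<dots> \<le> (\<integral>y. C' \<partial>\<kappa>)" using i fC by (intro integral_mono) auto
        finally show ?thesis using \<kappa>.prob_space by simp
      qed
      have i1: "integrable (\<mu> k) f" by (rule \<mu>.integrable_const_bound[of _ C']) (auto simp: fC)
      have i2: "integrable (\<mu> k) (\<lambda>z. f (z + (2 * h) *\<^sub>R b z))" by (rule \<mu>.integrable_const_bound[of _ C']) (auto simp: fC)
      have i3: "integrable (\<mu> k) (\<lambda>z. \<integral>y. f (z + (0, y)) \<partial>\<kappa>)" by (rule \<mu>.integrable_const_bound[of _ C']) (auto simp: C')
      have i4: "integrable (\<mu> k) (\<lambda>z. \<phi> (z, real k * h))" by (rule \<mu>.integrable_const_bound[of _ C']) (auto simp: \<phi>)
      have i5: "integrable (\<mu> k) (\<lambda>z. F (z, t))" by (rule \<mu>.integrable_const_bound[of _ C]) (auto simp: F)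
      have incr: "scheme_incr b \<kappa> r h \<phi> (real k * h) = (\<lambda>z. f z - \<phi> (z, real k * h) + 1/2 * (f (z + (2 * h) *\<^sub>R b z) - f z)
          + h * r * ((\<integral>y. f (z + (0, y)) \<partial>\<kappa>) - f z))"
        by (simp add: scheme_incr_def f_def fun_eq_iff)
      have iincr: "integrable (\<mu> k) (scheme_incr b \<kappa> r h \<phi> (real k * h))"
        unfolding incr using i1 i2 i3 i4 by auto
      have "S (Suc k) = (\<integral>z. f z \<partial>\<mu> (Suc k))"
        by (simp add: S_def f_def algebra_simps)
      also have "\<dots> = 1/2 * (\<integral>z. f (z + (2 * h) *\<^sub>R b z) \<partial>\<mu> k)
       + (h * r * (\<integral>z. (\<integral>y. f (z + (0, y)) \<partial>\<kappa>) \<partial>\<mu> k)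
       + (1/2 - h * r) * (\<integral>z. f z \<partial>\<mu> k))"
        using \<mu>(4)[of k] \<open>f \<in> borel_measurable borel\<close> fC unfolding step_rel_def by blast
      finally have "S (Suc k) - S k = (\<integral>z. scheme_incr b \<kappa> r h \<phi> (real k * h) z \<partial>\<mu> k)"
        unfolding incr S_def using i1 i2 i3 i4 by (simp add: algebra_simps)
      then have "(\<integral>z. F (z, t) \<partial>\<mu> k) - G k = (\<integral>z. F (z, t) - scheme_incr b \<kappa> r h \<phi> (real k * h) z / h \<partial>\<mu> k)"
        using i5 iincr by (simp add: G_def)
      then have "\<bar>(\<integral>z. F (z, t) \<partial>\<mu> k) - G k\<bar> \<le> (\<integral>z. \<bar>F (z, t) - scheme_incr b \<kappa> r h \<phi> (real k * h) z / h\<bar> \<partial>\<mu> k)"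
        by (simp add: integral_abs_bound)
      also have "\<dots> \<le> (\<integral>z. d \<partial>\<mu> k)"
      proof (rule integral_mono)
        fix z
        have "F (z, t) - scheme_incr b \<kappa> r h \<phi> (real k * h) z / h = - (scheme_incr b \<kappa> r h \<phi> (real k * h) z - h * F (z, t)) / h"
          using h by (simp add: field_simps)
        then have "\<bar>F (z, t) - scheme_incr b \<kappa> r h \<phi> (real k * h) z / h\<bar> = \<bar>scheme_incr b \<kappa> r h \<phi> (real k * h) z - h * F (z, t)\<bar> / h"
          using h by (simp only: abs_divide abs_minus_cancel abs_of_pos)
        also have "\<dots> \<le> (h * d) / h"
          using cons[OF k(1,2), of z] k(3) h by (intro divide_right_mono) (auto simp: algebra_simps)
        finally show "\<bar>F (z, t) - scheme_incr b \<kappa> r h \<phi> (real k * h) z / h\<bar> \<le> d"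
          using h by simp
      qed (use i5 iincr in auto)
      also have "\<dots> = d" using \<mu>.prob_space by simp
      finally show "\<bar>(\<integral>z. F (z, t) \<partial>\<mu> k) - G k\<bar> \<le> d" .
    qed
    moreover have "(\<Sum>k<N. G k) / real N = (S N - S 0) / T"
      unfolding G_def T by (simp add: sum_divide_distrib[symmetric] sum_lessThan_telescope mult.commute)
    moreover have "S N = 0" using \<phi>(3) by (simp add: S_def T[symmetric])
    moreover have "S 0 = (\<integral>z. g0 z * \<phi> (z, 0) \<partial>lborel)"
      unfolding S_def \<mu>(1) \<mu>0_def using g0 by (simp add: integral_density)
    ultimately show "\<bar>(\<integral>p. F p \<partial>m) + (\<integral>z. g0 z * \<phi> (z, 0) \<partial>lborel) / T\<bar> \<le> d"
      by simp
  qed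
qed

text \<open>\<open>ennreal\<close> sends negative reals to 0, so the integrand is the part of
  \<open>g\<close> above the level \<open>K\<close>. It tends to 0 pointwise and is dominated by the
  positive part of \<open>g\<close>.\<close>

lemma nn_integral_truncation_small:
  fixes g :: "'b \<Rightarrow> real"
  assumes g: "g \<in> borel_measurable M" "(\<integral>\<^sup>+x. ennreal (g x) \<partial>M) < \<infinity>" and e: "0 < e"
  obtains K :: nat where "(\<integral>\<^sup>+x. ennreal (g x - real K) \<partial>M) < ennreal e"
proof -
  have "(\<lambda>n. \<integral>\<^sup>+x. ennreal (g x - real n) \<partial>M) \<longlonglongrightarrow> (\<integral>\<^sup>+x. 0 \<partial>M)"
  proof (rule nn_integral_dominated_convergence[where w = "\<lambda>x. ennreal (g x)"])
    show "AE x in M. (\<lambda>n. ennreal (g x - real n)) \<longlonglongrightarrow> 0"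
    proof (rule AE_I2)
      fix x
      have "\<forall>\<^sub>F n in sequentially. ennreal (g x - real n) = 0"
        using eventually_ge_at_top[of "nat \<lceil>g x\<rceil>"]
        by eventually_elim (subst ennreal_eq_0_iff, linarith)
      then show "(\<lambda>n. ennreal (g x - real n)) \<longlonglongrightarrow> 0" by (rule tendsto_eventually)
    qed
  qed (use g in \<open>auto intro!: ennreal_leI\<close>)
  then have "\<forall>\<^sub>F n in sequentially. (\<integral>\<^sup>+x. ennreal (g x - real n) \<partial>M) < ennreal e"
    using e by (intro order_tendstoD(2)[of _ 0]) auto
  then show thesis using that by (auto simp: eventually_sequentially)
qed

text \<open>Up to times outside (0, T), which carry no mass, \<open>A\<close> is covered by its part
  in a ball and the set where \<open>logw\<close> is at least \<open>l\<close>. Markov's inequality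
  makes the latter at most \<open>e / 2\<close>; the other \<open>e / 2\<close> is the constant in
  \<open>dom\<close>. The radius is \<open>R + T\<close> because the norm of a pair is at most the
  sum of the norms.\<close>

lemma uniform_integrability:
  fixes m :: "('e::euclidean_space \<times> real) measure"
  assumes m: "prob_space m" "sets m = sets borel" and T: "0 < T"
    and dom: "\<And>A. A \<in> sets borel \<Longrightarrow> emeasure m A \<le> ennreal (e / 2) + K * emeasure lborel A"
    and mom: "(\<integral>\<^sup>+p. ennreal (logw (fst p)) \<partial>m) \<le> ennreal X"
    and time: "emeasure m (UNIV \<times> {0<..<T}) = 1"
    and K: "K < \<infinity>" and e: "0 < e" and R: "0 < R" "X \<le> e / 2 * ln (1 + R\<^sup>2)" "0 \<le> X" and A: "A \<in> sets borel"
  shows "measure m A \<le> e + enn2real K * measure lborel (A \<inter> cball 0 (R + T))"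
proof -
  interpret prob_space m by fact
  define l where "l = ln (1 + R\<^sup>2)"
  have l: "0 < l" unfolding l_def by (rule ln_gt_zero) (use R in simp)
  have [simp]: "space m = UNIV" using sets_eq_imp_space_eq[OF m(2)] by simp
  let ?S = "UNIV \<times> {0<..<T} :: ('e \<times> real) set"
  let ?V = "{p :: 'e \<times> real. l \<le> logw (fst p)}"
  have S: "?S \<in> sets m" unfolding m(2) by (intro borel_Times) auto
  have logm: "(\<lambda>p. logw (fst p)) \<in> borel_measurable m"
    unfolding measurable_cong_sets[OF m(2) refl] by measurable
  have V: "?V \<in> sets m" unfolding m(2) by measurable
  have sub: "A \<subseteq> (A \<inter> cball 0 (R + T)) \<union> ?V \<union> (UNIV - ?S)"
  proof
    fix p assume p: "p \<in> A"
    obtain z t where zt: "p = (z, t)" by (cases p)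
    show "p \<in> (A \<inter> cball 0 (R + T)) \<union> ?V \<union> (UNIV - ?S)"
    proof (cases "0 < t \<and> t < T \<and> norm z < R")
      case True
      have "norm p \<le> norm z + norm t" unfolding zt by (rule norm_Pair_le)
      then show ?thesis using True p by simp
    next
      case False
      moreover have "l \<le> logw z" if "R \<le> norm z"
        using that R unfolding l_def logw_def
        by (subst ln_le_cancel_iff) (auto intro!: add_pos_nonneg power_mono)
      ultimately show ?thesis by (auto simp: zt not_less)
    qed
  qed
  have ball: "A \<inter> cball 0 (R + T) \<in> sets borel" using A by auto
  have "measure m A \<le> measure m (A \<inter> cball 0 (R + T) \<union> ?V \<union> (UNIV - ?S))"
    using sub V S ball m(2) by (intro finite_measure_mono) (auto simp del: space_borel)
  also have "\<dots> \<le> measure m (A \<inter> cball 0 (R + T)) + measure m ?V + measure m (UNIV - ?S)"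
    using V S ball m(2) by (intro order.trans[OF measure_Un_le] add_right_mono measure_Un_le) auto
  also have "measure m (UNIV - ?S) = 0"
  proof -
    have "measure m ?S = 1" using time by (simp add: measure_def)
    then show ?thesis using prob_compl[OF S] by simp
  qed
  also have "measure m ?V \<le> e / 2"
  proof -
    have "ennreal l * emeasure m ?V = (\<integral>\<^sup>+p. ennreal l * indicator ?V p \<partial>m)"
      using V by (simp add: nn_integral_cmult_indicator)
    also have "\<dots> \<le> (\<integral>\<^sup>+p. ennreal (logw (fst p)) \<partial>m)"
      by (intro nn_integral_mono) (auto simp: indicator_def intro: ennreal_leI)
    also have "\<dots> \<le> ennreal (e / 2 * l)" using mom R by (auto simp: l_def intro: order.trans ennreal_leI)
    finally have "ennreal (l * measure m ?V) \<le> ennreal (e / 2 * l)"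
      using l by (simp add: emeasure_eq_measure ennreal_mult)
    then have "l * measure m ?V \<le> e / 2 * l" using l e by (subst (asm) ennreal_le_iff) auto
    then show ?thesis using l by (simp add: mult.commute)
  qed
  also have "measure m (A \<inter> cball 0 (R + T)) \<le> e / 2 + enn2real K * measure lborel (A \<inter> cball 0 (R + T))"
  proof -
    have "emeasure lborel (A \<inter> cball 0 (R + T)) < \<infinity>"
      using emeasure_mono[of "A \<inter> cball 0 (R + T)" "cball 0 (R + T)" lborel]
        emeasure_lborel_cball_finite[of "0 :: 'e \<times> real" "R + T"]
      by (auto simp: less_top[symmetric] top_unique)
    then have "emeasure lborel (A \<inter> cball 0 (R + T)) = ennreal (measure lborel (A \<inter> cball 0 (R + T)))"
      by (intro emeasure_eq_ennreal_measure) auto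
    moreover have "K = ennreal (enn2real K)" using K by (simp add: less_top)
    ultimately have "ennreal (measure m (A \<inter> cball 0 (R + T))) \<le> ennreal (e / 2) + ennreal (enn2real K) * ennreal (measure lborel (A \<inter> cball 0 (R + T)))"
      using dom[OF ball] by (simp add: emeasure_eq_measure)
    also have "\<dots> = ennreal (e / 2 + enn2real K * measure lborel (A \<inter> cball 0 (R + T)))"
      using e by (simp add: ennreal_mult ennreal_plus)
    finally show ?thesis using e by (subst (asm) ennreal_le_iff) auto
  qed
  finally show ?thesis by simp
qed

text \<open>An abstract convergence theorem: bounds uniform in \<open>n\<close> give the limit
  density, and any bounded \<open>F\<close> with which the increments of \<open>\<phi>\<close> are
  consistent enters the equation. \<open>D\<close> has total mass one on space-time, which is the
  origin of the factors \<open>1 / T\<close>; rescaling is left to the end.\<close>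

theorem kinetic_scheme_limit:
  fixes b :: "'a::euclidean_space \<times> 'a \<Rightarrow> 'a \<times> 'a" and \<kappa> :: "nat \<Rightarrow> 'a measure" and r :: "nat \<Rightarrow> real"
    and N :: "nat \<Rightarrow> nat" and g0 :: "'a \<times> 'a \<Rightarrow> real"
  assumes T: "0 < T"
    and scheme: "\<And>n. drift_jump_scheme b (\<kappa> n) L B C (r n) (T / real (N n))"
    and N: "\<And>n. 0 < N n"
    and g0: "g0 \<in> borel_measurable borel" "\<And>z. 0 \<le> g0 z" "(\<integral>\<^sup>+z. ennreal (g0 z) \<partial>lborel) = 1"
      "(\<integral>\<^sup>+z. ennreal (logw z) * ennreal (g0 z) \<partial>lborel) < \<infinity>"
  obtains D :: "('a \<times> 'a) \<times> real \<Rightarrow> real" where "D \<in> borel_measurable borel" "\<And>p. 0 \<le> D p" "integrable lborel D"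
    "\<And>J. J \<in> sets borel \<Longrightarrow> (\<integral>p. D p * indicator (UNIV \<times> J) p \<partial>lborel) = measure lborel (J \<inter> {0<..<T}) / T"
    "\<And>F \<phi> C C'. F \<in> borel_measurable borel \<Longrightarrow> (\<And>p. \<bar>F p\<bar> \<le> C) \<Longrightarrow> \<phi> \<in> borel_measurable borel \<Longrightarrow>
       (\<And>p. \<bar>\<phi> p\<bar> \<le> C') \<Longrightarrow> (\<And>z. \<phi> (z, T) = 0) \<Longrightarrow>
       (\<And>d. 0 < d \<Longrightarrow> \<forall>\<^sub>F n in sequentially. \<forall>k z t. k < N n \<longrightarrow> real k * (T / N n) \<le> t \<longrightarrow> t \<le> real k * (T / N n) + T / N n \<longrightarrow>
          \<bar>scheme_incr b (\<kappa> n) (r n) (T / N n) \<phi> (real k * (T / N n)) z - (T / N n) * F (z, t)\<bar> \<le> (T / N n) * d) \<Longrightarrow>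
       (\<integral>p. D p * F p \<partial>lborel) + (\<integral>z. g0 z * \<phi> (z, 0) \<partial>lborel) / T = 0"
proof -
  define E where "E = ennreal (exp (4 * T * L * DIM('a \<times> 'a)))"
  define X where "X = enn2real (\<integral>\<^sup>+z. ennreal (logw z) * ennreal (g0 z) \<partial>lborel) + T * (8 * B + 8 * B\<^sup>2 + C)"
  have BC: "0 \<le> B" "0 \<le> C"
    using scheme[of 0] by (auto simp: drift_jump_scheme_def)
  have X0: "0 \<le> X" using BC T by (auto simp: X_def)
  have X: "(\<integral>\<^sup>+z. ennreal (logw z) * ennreal (g0 z) \<partial>lborel) + ennreal (T * (8 * B + 8 * B\<^sup>2 + C)) = ennreal X"
    unfolding X_def using g0(4) BC T by (subst ennreal_plus) (auto simp: less_top)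
  let ?good = "\<lambda>n m. prob_space m \<and> sets m = sets borel \<and>
    (\<forall>c K A. (\<forall>A\<in>sets borel. emeasure (density lborel (\<lambda>z. ennreal (g0 z))) A \<le> c + K * emeasure lborel A) \<longrightarrow> A \<in> sets borel \<longrightarrow>
       emeasure m A \<le> c + ennreal (1 / T) * (E * K * emeasure lborel A)) \<and>
    (\<integral>\<^sup>+p. ennreal (logw (fst p)) \<partial>m) \<le> ennreal X \<and>
    (\<forall>J\<in>sets borel. emeasure m (UNIV \<times> J) = ennreal (1 / T) * emeasure lborel (J \<inter> {0<..<T})) \<and>
    (\<forall>F \<phi> C C' d. F \<in> borel_measurable borel \<longrightarrow> (\<forall>p. \<bar>F p\<bar> \<le> C) \<longrightarrow> \<phi> \<in> borel_measurable borel \<longrightarrow>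
       (\<forall>p. \<bar>\<phi> p\<bar> \<le> C') \<longrightarrow> (\<forall>z. \<phi> (z, T) = 0) \<longrightarrow>
       (\<forall>k z t. k < N n \<longrightarrow> real k * (T / N n) \<le> t \<longrightarrow> t \<le> real k * (T / N n) + T / N n \<longrightarrow>
          \<bar>scheme_incr b (\<kappa> n) (r n) (T / N n) \<phi> (real k * (T / N n)) z - (T / N n) * F (z, t)\<bar> \<le> (T / N n) * d) \<longrightarrow>
       \<bar>(\<integral>p. F p \<partial>m) + (\<integral>z. g0 z * \<phi> (z, 0) \<partial>lborel) / T\<bar> \<le> d)"
  have "\<exists>m. ?good n m" for n
  proof -
    interpret drift_jump_scheme b "\<kappa> n" L B C "r n" "T / real (N n)" by (rule scheme)
    have TN: "T = real (N n) * (T / real (N n))" using N[of n] by simp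
    show ?thesis
    proof (rule scheme_average[OF g0(1-3) N TN], goal_cases)
      case (1 m)
      have *: "\<bar>(\<integral>p. F p \<partial>m) + (\<integral>z. g0 z * \<phi> (z, 0) \<partial>lborel) / T\<bar> \<le> d"
        if "F \<in> borel_measurable borel" "\<forall>p. \<bar>F p\<bar> \<le> C" "\<phi> \<in> borel_measurable borel"
          "\<forall>p. \<bar>\<phi> p\<bar> \<le> C'" "\<forall>z. \<phi> (z, T) = 0"
          "\<forall>k z t. k < N n \<longrightarrow> real k * (T / N n) \<le> t \<longrightarrow> t \<le> real k * (T / N n) + T / N n \<longrightarrow>
          \<bar>scheme_incr b (\<kappa> n) (r n) (T / N n) \<phi> (real k * (T / N n)) z - (T / N n) * F (z, t)\<bar> \<le> (T / N n) * d"
        for F \<phi> C C' d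
        by (rule 1(6)[of F C \<phi> C']) (use that in auto)
      show ?case
        unfolding E_def X[symmetric]
      proof (intro exI[of _ m] conjI)
        show "prob_space m" "sets m = sets borel" by (rule 1)+
        show "\<forall>c K A. (\<forall>A\<in>sets borel. emeasure (density lborel (\<lambda>z. ennreal (g0 z))) A \<le> c + K * emeasure lborel A) \<longrightarrow> A \<in> sets borel \<longrightarrow>
           emeasure m A \<le> c + ennreal (1 / T) * (ennreal (exp (4 * T * L * DIM('a \<times> 'a))) * K * emeasure lborel A)"
          by (intro allI impI, rule 1(3)) (erule bspec, assumption, assumption)
        show "(\<integral>\<^sup>+p. ennreal (logw (fst p)) \<partial>m) \<le> (\<integral>\<^sup>+z. ennreal (logw z) * ennreal (g0 z) \<partial>lborel) + ennreal (T * (8 * B + 8 * B\<^sup>2 + C))"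
          by (rule 1(4))
        show "\<forall>J\<in>sets borel. emeasure m (UNIV \<times> J) = ennreal (1 / T) * emeasure lborel (J \<inter> {0<..<T})"
          by (rule ballI) (rule 1(5))
      qed (intro allI impI, rule *; assumption)
    qed
  qed
  then have "\<exists>m. \<forall>n. ?good n (m n)"
    by (intro choice allI)
  then obtain m where "\<forall>n. ?good n (m n)"
    by (rule exE)
  then have m: "?good n (m n)" for n
    by (rule spec)
  note m_rest = m[THEN conjunct2, THEN conjunct2]
  note prob = m[THEN conjunct1] m[THEN conjunct2, THEN conjunct1]
  note m_dom = m_rest[THEN conjunct1, rule_format]
  note m_mom = m_rest[THEN conjunct2, THEN conjunct1]
  note m_time = m_rest[THEN conjunct2, THEN conjunct2, THEN conjunct1, rule_format]
  note m_dyn = m_rest[THEN conjunct2, THEN conjunct2, THEN conjunct2, rule_format]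
  have UI: "\<exists>K R. \<forall>n. \<forall>A\<in>sets borel. measure (m n) A \<le> e + K * measure lborel (A \<inter> cball 0 R)" if e: "0 < e" for e
  proof -
    \<comment> \<open>Cutting at height \<open>K0\<close> splits the initial density into a part of
      mass below \<open>e / 2\<close> and a part bounded by \<open>K0\<close>, which is the kind of
      domination that the chain propagates.\<close>
    obtain K0 :: nat where K0: "(\<integral>\<^sup>+z. ennreal (g0 z - real K0) \<partial>lborel) < ennreal (e / 2)"
      using nn_integral_truncation_small[of g0 lborel "e / 2"] g0 e by auto
    have dom0: "emeasure (density lborel (\<lambda>z. ennreal (g0 z))) A \<le> ennreal (e / 2) + ennreal (real K0) * emeasure lborel A"
      if A: "A \<in> sets borel" for A
    proof -
      have "emeasure (density lborel (\<lambda>z. ennreal (g0 z))) A = (\<integral>\<^sup>+z. ennreal (g0 z) * indicator A z \<partial>lborel)"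
        using g0 A by (simp add: emeasure_density)
      also have "\<dots> \<le> (\<integral>\<^sup>+z. ennreal (g0 z - real K0) + ennreal (real K0) * indicator A z \<partial>lborel)"
      proof (rule nn_integral_mono)
        fix z
        have "ennreal (g0 z) \<le> ennreal (g0 z - real K0) + ennreal (real K0)"
        proof (cases "real K0 \<le> g0 z")
          case True
          then show ?thesis by (subst ennreal_plus[symmetric]) auto
        next
          case False
          then show ?thesis by (intro add_increasing ennreal_leI) auto
        qed
        then show "ennreal (g0 z) * indicator A z \<le> ennreal (g0 z - real K0) + ennreal (real K0) * indicator A z"
          by (auto simp: indicator_def)
      qed
      also have "\<dots> = (\<integral>\<^sup>+z. ennreal (g0 z - real K0) \<partial>lborel) + ennreal (real K0) * emeasure lborel A"
        using g0 A by (subst nn_integral_add) (auto simp: nn_integral_cmult_indicator)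
      also have "\<dots> \<le> ennreal (e / 2) + ennreal (real K0) * emeasure lborel A"
        using K0 by (intro add_right_mono) auto
      finally show ?thesis .
    qed
    define K where "K = ennreal (1 / T) * (E * ennreal (real K0))"
    have K: "K < \<infinity>" by (simp add: K_def E_def ennreal_mult_less_top)
    \<comment> \<open>Chosen so that \<open>ln (1 + R\<^sup>2)\<close> is at least
      \<open>2 * X / e\<close>, the level at which Markov's inequality yields
      \<open>e / 2\<close>.\<close>
    define R where "R = sqrt (exp (2 * X / e))"
    have R: "0 < R" "X \<le> e / 2 * ln (1 + R\<^sup>2)"
    proof -
      show "0 < R" by (simp add: R_def)
      have "2 * X / e \<le> ln (1 + exp (2 * X / e))"
        by (subst ln_ge_iff) (auto simp: add_pos_pos)
      then show "X \<le> e / 2 * ln (1 + R\<^sup>2)"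
        using e by (simp add: R_def field_simps)
    qed
    have "measure (m n) A \<le> e + enn2real K * measure lborel (A \<inter> cball 0 (R + T))" if "A \<in> sets borel" for n A
    proof (rule uniform_integrability[OF prob T _ _ _ K e R X0 that])
      show "emeasure (m n) A \<le> ennreal (e / 2) + K * emeasure lborel A" if "A \<in> sets borel" for A
      proof -
        have "emeasure (m n) A \<le> ennreal (e / 2) + ennreal (1 / T) * (E * ennreal (real K0) * emeasure lborel A)"
          by (rule m_dom[OF dom0 that])
        then show ?thesis by (simp add: K_def mult.assoc)
      qed
      show "(\<integral>\<^sup>+p. ennreal (logw (fst p)) \<partial>m n) \<le> ennreal X" by (rule m_mom)
      have "emeasure (m n) (UNIV \<times> {0<..<T}) = ennreal (1 / T) * emeasure lborel ({0<..<T} \<inter> {0<..<T})"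
        by (rule m_time) simp
      also have "\<dots> = ennreal (1 / T * T)" using T by (subst ennreal_mult) auto
      finally show "emeasure (m n) (UNIV \<times> {0<..<T}) = 1" using T by simp
    qed
    then show ?thesis by blast
  qed
  obtain H and D :: "('a \<times> 'a) \<times> real \<Rightarrow> real" where H: "H \<noteq> bot" "H \<le> sequentially"
    and D: "D \<in> borel_measurable borel" "\<And>x. 0 \<le> D x" "integrable lborel D" "integral\<^sup>L lborel D = 1"
    and lim: "\<And>(g :: ('a \<times> 'a) \<times> real \<Rightarrow> real) C. g \<in> borel_measurable borel \<Longrightarrow> (\<And>x. \<bar>g x\<bar> \<le> C) \<Longrightarrow>
       ((\<lambda>n. integral\<^sup>L (m n) g) \<longlongrightarrow> (\<integral>x. D x * g x \<partial>lborel)) H"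
    using weak_L1_limit[OF prob UI] by blast
  show thesis
  proof (rule that[OF D(1-3)])
    fix J :: "real set" assume J: "J \<in> sets borel"
    have UJ: "UNIV \<times> J \<in> sets (borel :: (('a \<times> 'a) \<times> real) measure)"
      using J by (intro borel_Times) auto
    have "((\<lambda>n. \<integral>p. indicator (UNIV \<times> J) p \<partial>m n) \<longlongrightarrow> (\<integral>p. D p * indicator (UNIV \<times> J) p \<partial>lborel)) H"
      using UJ by (intro lim[of _ 1]) (auto simp: indicator_def)
    moreover have "(\<integral>p. indicator (UNIV \<times> J) p \<partial>m n) = measure lborel (J \<inter> {0<..<T}) / T" for n
    proof -
      have "emeasure (m n) (UNIV \<times> J) = ennreal (1 / T) * emeasure lborel (J \<inter> {0<..<T})"
        by (rule m_time[OF J])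
      then have "measure (m n) (UNIV \<times> J) = measure lborel (J \<inter> {0<..<T}) / T"
        using T by (simp add: measure_def enn2real_mult)
      moreover have "space (m n) = UNIV" using sets_eq_imp_space_eq[OF prob(2)] by simp
      ultimately show ?thesis using UJ prob(2) by simp
    qed
    ultimately show "(\<integral>p. D p * indicator (UNIV \<times> J) p \<partial>lborel) = measure lborel (J \<inter> {0<..<T}) / T"
      using H(1) by (simp add: tendsto_const_iff)
  next
    fix F \<phi> :: "('a \<times> 'a) \<times> real \<Rightarrow> real" and C C'
    assume F: "F \<in> borel_measurable borel" "\<And>p. \<bar>F p\<bar> \<le> C"
      and \<phi>: "\<phi> \<in> borel_measurable borel" "\<And>p. \<bar>\<phi> p\<bar> \<le> C'" "\<And>z. \<phi> (z, T) = 0"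
      and cons: "\<And>d. 0 < d \<Longrightarrow> \<forall>\<^sub>F n in sequentially. \<forall>k z t. k < N n \<longrightarrow> real k * (T / N n) \<le> t \<longrightarrow> t \<le> real k * (T / N n) + T / N n \<longrightarrow>
          \<bar>scheme_incr b (\<kappa> n) (r n) (T / N n) \<phi> (real k * (T / N n)) z - (T / N n) * F (z, t)\<bar> \<le> (T / N n) * d"
    let ?S = "(\<integral>z. g0 z * \<phi> (z, 0) \<partial>lborel) / T"
    have "(\<lambda>n. (\<integral>p. F p \<partial>m n) + ?S) \<longlonglongrightarrow> 0"
    proof (rule tendstoI)
      fix e :: real assume "0 < e"
      then have "0 < e / 2" by simp
      from cons[OF this] show "\<forall>\<^sub>F n in sequentially. dist ((\<integral>p. F p \<partial>m n) + ?S) 0 < e"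
      proof eventually_elim
        case (elim n)
        have "\<bar>(\<integral>p. F p \<partial>m n) + ?S\<bar> \<le> e / 2"
          by (rule m_dyn[OF F \<phi>]) (use elim in blast)
        then show ?case using \<open>0 < e\<close> by simp
      qed
    qed
    \<comment> \<open>Consistency gives the limit 0 along all large \<open>n\<close>, hence along
      the finer filter \<open>H\<close>, where the integrals also converge to those against
      \<open>D\<close>; the two limits coincide.\<close>
    then have "((\<lambda>n. (\<integral>p. F p \<partial>m n) + ?S) \<longlongrightarrow> 0) H"
      using H(2) by (rule tendsto_mono[rotated])
    moreover have "((\<lambda>n. (\<integral>p. F p \<partial>m n) + ?S) \<longlongrightarrow> (\<integral>p. D p * F p \<partial>lborel) + ?S) H"
      by (intro tendsto_intros lim[of F C] F)
    ultimately show "(\<integral>p. D p * F p \<partial>lborel) + ?S = 0"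
      using H(1) tendsto_unique by blast
  qed
qed

section \<open>Test functions\<close>

text \<open>Smoothness and compact support as in \<open>test_fun\<close>, without its restriction on
  times and over any Euclidean space.\<close>

definition csmooth :: "('b::euclidean_space \<Rightarrow> real) \<Rightarrow> bool" where
  "csmooth g \<longleftrightarrow> smooth_fun g \<and> compact (closure {p. g p \<noteq> 0})"

text \<open>For smooth \<open>g\<close> this is the differential at \<open>p\<close> applied to
  \<open>q\<close>. It is expressed by coordinate partials because \<open>smooth_fun\<close> speaks
  about these; bounds on the partials thus pass to every direction.\<close>

definition ddir :: "('b::euclidean_space \<Rightarrow> real) \<Rightarrow> 'b \<Rightarrow> 'b \<Rightarrow> real" where
  "ddir g p q = (\<Sum>b\<in>Basis. (q \<bullet> b) * partial b g p)"

lemma partial_eq_of_has_derivative: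
  assumes "(g has_derivative g') (at p)"
  shows "partial b g p = g' b"
proof -
  interpret bounded_linear g' using assms by (rule has_derivative_bounded_linear)
  have "((\<lambda>h. p + h *\<^sub>R b) has_derivative (\<lambda>h. h *\<^sub>R b)) (at 0)"
    by (auto intro!: derivative_eq_intros)
  moreover have "(g has_derivative g') (at (p + 0 *\<^sub>R b))"
    using assms by simp
  ultimately have "((\<lambda>h. g (p + h *\<^sub>R b)) has_derivative (\<lambda>h. g' (h *\<^sub>R b))) (at 0)"
    by (rule has_derivative_compose)
  then have "((\<lambda>h. g (p + h *\<^sub>R b)) has_field_derivative g' b) (at 0)"
    unfolding has_field_derivative_def by (simp add: scaleR mult_commute_abs)
  then show ?thesis
    unfolding partial_def by (rule DERIV_imp_deriv)
qed

lemma smooth_fun_has_derivative: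
  assumes "smooth_fun g"
  shows "(g has_derivative ddir g p) (at p)"
proof -
  \<comment> \<open>The empty list of directions: \<open>smooth_fun\<close> includes
    differentiability of \<open>g\<close> itself.\<close>
  have "iter_partial [] g differentiable (at p)"
    using assms by (auto simp: smooth_fun_def simp del: iter_partial_def)
  then obtain g' where g': "(g has_derivative g') (at p)"
    by (auto simp: iter_partial_def differentiable_def)
  interpret bounded_linear g' using g' by (rule has_derivative_bounded_linear)
  have "g' q = ddir g p q" for q
  proof -
    have "g' q = g' (\<Sum>b\<in>Basis. (q \<bullet> b) *\<^sub>R b)" by (simp add: euclidean_representation)
    also have "\<dots> = ddir g p q"
      unfolding ddir_def by (simp add: sum scaleR partial_eq_of_has_derivative[OF g'])
    finally show ?thesis .
  qed
  then have "g' = ddir g p" by auto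
  with g' show ?thesis by simp
qed

lemma linear_ddir: "smooth_fun g \<Longrightarrow> linear (ddir g p)"
  using smooth_fun_has_derivative has_derivative_linear by blast

lemma smooth_fun_DERIV_line:
  assumes "smooth_fun g"
  shows "((\<lambda>h. g (p + h *\<^sub>R q)) has_real_derivative ddir g (p + r *\<^sub>R q) q) (at r)"
proof -
  have "((\<lambda>h. p + h *\<^sub>R q) has_derivative (\<lambda>h. h *\<^sub>R q)) (at r)"
    by (auto intro!: derivative_eq_intros)
  then have "((\<lambda>h. g (p + h *\<^sub>R q)) has_derivative (\<lambda>h. ddir g (p + r *\<^sub>R q) (h *\<^sub>R q))) (at r)"
    by (rule has_derivative_compose) (rule smooth_fun_has_derivative[OF assms])
  then show ?thesis
    unfolding has_field_derivative_def
    by (simp add: linear_cmul[OF linear_ddir[OF assms]] mult_commute_abs)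
qed

lemma smooth_fun_continuous: "smooth_fun g \<Longrightarrow> continuous_on UNIV g"
  using smooth_fun_has_derivative
  by (metis has_derivative_continuous continuous_at_imp_continuous_on)

lemma smooth_fun_partial:
  fixes g :: "'b::euclidean_space \<Rightarrow> real"
  assumes "smooth_fun g" "b \<in> Basis"
  shows "smooth_fun (partial b g)"
  unfolding smooth_fun_def
proof (intro allI impI)
  fix bs :: "'b list" and x assume bs: "set bs \<subseteq> Basis"
  have "iter_partial bs (partial b g) = iter_partial (bs @ [b]) g"
    by (simp add: iter_partial_def)
  moreover have "set (bs @ [b]) \<subseteq> Basis" using bs assms by simp
  ultimately show "iter_partial bs (partial b g) differentiable at x"
    using assms(1) unfolding smooth_fun_def by metis
qed

lemma partial_eq_ddir: "b \<in> Basis \<Longrightarrow> partial b g p = ddir g p b"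
  unfolding ddir_def by (simp add: inner_Basis if_distrib[of "\<lambda>x. x * _"] sum.delta cong: if_cong)

lemma ddir_eq_0_outside:
  assumes "smooth_fun g" "p \<notin> closure {p. g p \<noteq> 0}"
  shows "ddir g p q = 0"
proof -
  have "((\<lambda>_. 0) has_derivative (\<lambda>_. 0)) (at p)" by simp
  then have "(g has_derivative (\<lambda>_. 0)) (at p)"
    by (rule has_derivative_transform_within_open[of _ _ _ _ "- closure {p. g p \<noteq> 0}"])
      (use assms(2) closure_subset[of "{p. g p \<noteq> 0}"] in auto)
  then have "ddir g p = (\<lambda>_. 0)"
    using smooth_fun_has_derivative[OF assms(1), of p] has_derivative_unique by blast
  then show ?thesis by simp
qed

lemma csmooth_partial:
  assumes "csmooth g" "b \<in> Basis"
  shows "csmooth (partial b g)"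
proof -
  have "{p. partial b g p \<noteq> 0} \<subseteq> closure {p. g p \<noteq> 0}"
    using assms ddir_eq_0_outside by (auto simp: csmooth_def partial_eq_ddir)
  then have "closure {p. partial b g p \<noteq> 0} \<subseteq> closure {p. g p \<noteq> 0}"
    by (simp add: closure_minimal)
  moreover have "compact (closure {p. g p \<noteq> 0})"
    using assms(1) by (simp add: csmooth_def)
  ultimately have "compact (closure {p. partial b g p \<noteq> 0})"
    by (metis closed_Int_compact closed_closure inf.orderE)
  with assms show ?thesis by (simp add: csmooth_def smooth_fun_partial)
qed

lemma csmooth_support:
  fixes g :: "'b::euclidean_space \<Rightarrow> real"
  assumes "csmooth g"
  obtains R where "0 < R" "\<And>p. R < norm p \<Longrightarrow> g p = 0" "\<And>p q. R < norm p \<Longrightarrow> ddir g p q = 0"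
proof -
  have "bounded (closure {p. g p \<noteq> 0})"
    using assms compact_imp_bounded by (auto simp: csmooth_def)
  then obtain R where R: "0 < R" "\<And>p. p \<in> closure {p. g p \<noteq> 0} \<Longrightarrow> norm p \<le> R"
    by (auto simp: bounded_pos)
  show thesis
  proof (rule that[OF R(1)])
    fix p q :: 'b assume p: "R < norm p"
    then have *: "p \<notin> closure {p. g p \<noteq> 0}" using R(2) by force
    then show "g p = 0" using closure_subset[of "{p. g p \<noteq> 0}"] by auto
    show "ddir g p q = 0"
      using * assms by (intro ddir_eq_0_outside) (auto simp: csmooth_def)
  qed
qed

lemma csmooth_bounded:
  assumes "csmooth g"
  obtains C where "0 \<le> C" "\<And>p. \<bar>g p\<bar> \<le> C"
proof -
  obtain R where R: "\<And>p. R < norm p \<Longrightarrow> g p = 0" "0 < R"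
    using csmooth_support[OF assms] by metis
  have "compact (g ` cball 0 R)"
    using assms by (intro compact_continuous_image)
      (auto simp: csmooth_def intro: continuous_on_subset[OF smooth_fun_continuous])
  then have "bounded (g ` cball 0 R)" by (rule compact_imp_bounded)
  then obtain C where C: "0 < C" "\<And>p. norm p \<le> R \<Longrightarrow> \<bar>g p\<bar> \<le> C"
    by (auto simp: bounded_pos)
  have "\<bar>g p\<bar> \<le> C" for p
    using C R(1)[of p] by (cases "norm p \<le> R") auto
  with C show thesis by (intro that[of C]) auto
qed

lemma csmooth_lipschitz:
  assumes g: "csmooth g"
  obtains C where "0 \<le> C" "\<And>p q. \<bar>g p - g q\<bar> \<le> C * norm (p - q)"
proof -
  have "\<exists>C. 0 \<le> C \<and> (\<forall>p. \<bar>partial b g p\<bar> \<le> C)" if "b \<in> Basis" for b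
    using csmooth_bounded[OF csmooth_partial[OF g that]] by metis
  then obtain C where C: "\<And>b. b \<in> Basis \<Longrightarrow> 0 \<le> C b" "\<And>b p. b \<in> Basis \<Longrightarrow> \<bar>partial b g p\<bar> \<le> C b"
    by metis
  have "norm (g p - g q) \<le> (\<Sum>b\<in>Basis. C b) * norm (p - q)" for p q
  proof (rule differentiable_bound[of UNIV g "ddir g"])
    fix x
    show "(g has_derivative ddir g x) (at x within UNIV)"
      using g smooth_fun_has_derivative by (auto simp: csmooth_def)
    show "onorm (ddir g x) \<le> (\<Sum>b\<in>Basis. C b)"
    proof (rule onorm_le)
      fix y
      have "norm (ddir g x y) \<le> (\<Sum>b\<in>Basis. \<bar>(y \<bullet> b) * partial b g x\<bar>)"
        unfolding ddir_def real_norm_def by (rule sum_abs)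
      also have "\<dots> \<le> (\<Sum>b\<in>Basis. norm y * C b)"
        unfolding abs_mult using C Basis_le_norm by (intro sum_mono mult_mono) auto
      finally show "norm (ddir g x y) \<le> (\<Sum>b\<in>Basis. C b) * norm y"
        by (simp add: sum_distrib_left mult.commute)
    qed
  qed auto
  then show thesis
    using C(1) by (intro that[of "\<Sum>b\<in>Basis. C b"]) (auto intro: sum_nonneg)
qed

lemma csmooth_ddir_lipschitz:
  assumes g: "csmooth g"
  obtains C where "0 \<le> C" "\<And>p p' q. \<bar>ddir g p q - ddir g p' q\<bar> \<le> C * norm q * norm (p - p')"
proof -
  have "\<exists>C. 0 \<le> C \<and> (\<forall>p q. \<bar>partial b g p - partial b g q\<bar> \<le> C * norm (p - q))" if "b \<in> Basis" for b
    using csmooth_lipschitz[OF csmooth_partial[OF g that]] by metis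
  then obtain C where C: "\<And>b. b \<in> Basis \<Longrightarrow> 0 \<le> C b"
    "\<And>b p q. b \<in> Basis \<Longrightarrow> \<bar>partial b g p - partial b g q\<bar> \<le> C b * norm (p - q)"
    by metis
  have "\<bar>ddir g p q - ddir g p' q\<bar> \<le> (\<Sum>b\<in>Basis. C b) * norm q * norm (p - p')" for p p' q
  proof -
    have "\<bar>ddir g p q - ddir g p' q\<bar> = \<bar>\<Sum>b\<in>Basis. (q \<bullet> b) * (partial b g p - partial b g p')\<bar>"
      unfolding ddir_def by (simp add: sum_subtractf right_diff_distrib)
    also have "\<dots> \<le> (\<Sum>b\<in>Basis. \<bar>(q \<bullet> b) * (partial b g p - partial b g p')\<bar>)"
      by (rule sum_abs)
    also have "\<dots> \<le> (\<Sum>b\<in>Basis. norm q * (C b * norm (p - p')))"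
      unfolding abs_mult using C Basis_le_norm by (intro sum_mono mult_mono) auto
    also have "\<dots> = (\<Sum>b\<in>Basis. C b) * norm q * norm (p - p')"
      by (simp add: sum_distrib_left sum_distrib_right mult_ac)
    finally show ?thesis .
  qed
  then show thesis
    using C(1) by (intro that[of "\<Sum>b\<in>Basis. C b"]) (auto intro: sum_nonneg)
qed

lemma smooth_fun_mvt:
  assumes "smooth_fun g"
  obtains \<theta> where "0 < \<theta>" "\<theta> < 1" "g (p + q) - g p = ddir g (p + \<theta> *\<^sub>R q) q"
proof -
  have "\<exists>z::real. 0 < z \<and> z < 1 \<and> g (p + 1 *\<^sub>R q) - g (p + 0 *\<^sub>R q) = (1 - 0) * ddir g (p + z *\<^sub>R q) q"
    by (rule MVT2) (use smooth_fun_DERIV_line[OF assms] in auto)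
  with that show thesis by auto
qed

text \<open>Mean value theorem, with the intermediate point replaced by \<open>p\<close> at the cost
  of the Lipschitz constant of \<open>ddir\<close>.\<close>

lemma csmooth_taylor1:
  assumes g: "csmooth g"
  obtains C where "0 \<le> C" "\<And>p q. \<bar>g (p + q) - g p - ddir g p q\<bar> \<le> C * (norm q)\<^sup>2"
proof -
  obtain C where C: "0 \<le> C" "\<And>p p' q. \<bar>ddir g p q - ddir g p' q\<bar> \<le> C * norm q * norm (p - p')"
    using csmooth_ddir_lipschitz[OF g] by metis
  have "\<bar>g (p + q) - g p - ddir g p q\<bar> \<le> C * (norm q)\<^sup>2" for p q
  proof -
    obtain \<theta> where \<theta>: "0 < \<theta>" "\<theta> < 1" "g (p + q) - g p = ddir g (p + \<theta> *\<^sub>R q) q"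
      using smooth_fun_mvt[of g] g unfolding csmooth_def by metis
    have "\<bar>g (p + q) - g p - ddir g p q\<bar> \<le> C * norm q * norm (p + \<theta> *\<^sub>R q - p)"
      unfolding \<theta>(3) by (rule C)
    also have "\<dots> \<le> C * norm q * norm q"
      using C \<theta> by (intro mult_left_mono) (auto simp: mult_left_le_one_le)
    finally show ?thesis by (simp add: power2_eq_square mult_ac)
  qed
  with C show thesis by (intro that)
qed

text \<open>\<open>ddir g p\<close> is odd, so the first order terms of the two expansions
  cancel.\<close>

lemma csmooth_second_difference:
  assumes g: "csmooth g"
  obtains C where "0 \<le> C" "\<And>p q. \<bar>g (p + q) + g (p - q) - 2 * g p\<bar> \<le> C * (norm q)\<^sup>2"
proof -
  obtain C where C: "0 \<le> C" "\<And>p q. \<bar>g (p + q) - g p - ddir g p q\<bar> \<le> C * (norm q)\<^sup>2"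
    using csmooth_taylor1[OF g] by metis
  have "\<bar>g (p + q) + g (p - q) - 2 * g p\<bar> \<le> 2 * C * (norm q)\<^sup>2" for p q
  proof -
    have "ddir g p (- q) = - ddir g p q"
      by (simp add: ddir_def sum_negf)
    then show ?thesis using C(2)[of p q] C(2)[of p "- q"] by simp
  qed
  with C show thesis by (intro that[of "2 * C"]) auto
qed

text \<open>Taylor expansions at \<open>h\<close> and \<open>-h\<close> with third order remainder:
  the first order terms cancel and, beyond the second derivative, only the two remainders are left.
  After division by \<open>h\<^sup>2\<close> the error is still linear in \<open>h\<close>.\<close>

lemma csmooth_second_partial:
  assumes g: "csmooth g" and b: "b \<in> Basis"
  obtains C where "0 \<le> C"
    "\<And>p h. \<bar>g (p + h *\<^sub>R b) + g (p - h *\<^sub>R b) - 2 * g p - h\<^sup>2 * partial b (partial b g) p\<bar> \<le> C * \<bar>h\<bar> ^ 3"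
proof -
  define D where "D m = (partial b ^^ m) g" for m
  have D: "csmooth (D m)" for m
    by (induction m) (auto simp: D_def g csmooth_partial b)
  obtain C where C: "0 \<le> C" "\<And>p. \<bar>D 3 p\<bar> \<le> C"
    using csmooth_bounded[OF D] by metis
  have expand: "\<exists>c. \<bar>c\<bar> \<le> C \<and> g (p + h *\<^sub>R b) = g p + D 1 p * h + D 2 p / 2 * h\<^sup>2 + c / 6 * h ^ 3" for p h
  proof -
    have "\<forall>m x. ((\<lambda>r. D m (p + r *\<^sub>R b)) has_real_derivative D (Suc m) (p + x *\<^sub>R b)) (at x)"
    proof (intro allI)
      fix m x
      have "D (Suc m) q = ddir (D m) q b" for q
        using b by (simp add: D_def partial_eq_ddir)
      then show "((\<lambda>r. D m (p + r *\<^sub>R b)) has_real_derivative D (Suc m) (p + x *\<^sub>R b)) (at x)"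
        using smooth_fun_DERIV_line[of "D m"] D[of m] by (simp add: csmooth_def)
    qed
    from Maclaurin_all_le[OF refl this, of h 3]
    obtain t where "D 0 (p + h *\<^sub>R b) = (\<Sum>m<3. D m (p + 0 *\<^sub>R b) / fact m * h ^ m) + D 3 (p + t *\<^sub>R b) / fact 3 * h ^ 3"
      by auto
    then show ?thesis
      using C by (intro exI[of _ "D 3 (p + t *\<^sub>R b)"])
        (simp add: D_def eval_nat_numeral lessThan_Suc)
  qed
  have "\<bar>g (p + h *\<^sub>R b) + g (p - h *\<^sub>R b) - 2 * g p - h\<^sup>2 * partial b (partial b g) p\<bar> \<le> C * \<bar>h\<bar> ^ 3" for p h
  proof -
    obtain c where c: "\<bar>c\<bar> \<le> C" "g (p + h *\<^sub>R b) = g p + D 1 p * h + D 2 p / 2 * h\<^sup>2 + c / 6 * h ^ 3"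
      using expand by blast
    obtain c' where c': "\<bar>c'\<bar> \<le> C" "g (p + (-h) *\<^sub>R b) = g p + D 1 p * (-h) + D 2 p / 2 * (-h)\<^sup>2 + c' / 6 * (-h) ^ 3"
      using expand by blast
    have "D 2 = partial b (partial b g)" by (simp add: D_def eval_nat_numeral)
    then have eq: "g (p + h *\<^sub>R b) + g (p - h *\<^sub>R b) - 2 * g p - h\<^sup>2 * partial b (partial b g) p = (c - c') / 6 * h ^ 3"
      using c(2) c'(2) by (simp add: field_simps)
    then have "\<bar>g (p + h *\<^sub>R b) + g (p - h *\<^sub>R b) - 2 * g p - h\<^sup>2 * partial b (partial b g) p\<bar> = \<bar>c - c'\<bar> / 6 * \<bar>h\<bar> ^ 3"
      unfolding eq by (simp add: abs_mult power_abs)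
    also have "\<dots> \<le> C * \<bar>h\<bar> ^ 3"
      using c c' by (intro mult_right_mono) auto
    finally show ?thesis .
  qed
  with C show thesis by (intro that)
qed

section \<open>Jump laws approximating the fractional Laplacian\<close>

text \<open>Replaces polar coordinates: a radial function is compared with constants on dyadic balls.\<close>

lemma nn_integral_dyadic_finite:
  fixes f :: "'a::euclidean_space \<Rightarrow> real" and c R :: "nat \<Rightarrow> real"
  assumes cover: "\<And>y. 0 < f y \<Longrightarrow> \<exists>k. f y \<le> c k \<and> norm y < R k"
    and nonneg: "\<And>k. 0 \<le> c k" "\<And>k. 0 \<le> R k"
    and sum: "summable (\<lambda>k. c k * R k ^ DIM('a))"
  shows "(\<integral>\<^sup>+y. ennreal (f y) \<partial>lborel) < \<infinity>"
proof -
  have "(\<integral>\<^sup>+y. ennreal (f y) \<partial>lborel) \<le> (\<integral>\<^sup>+(y :: 'a). (\<Sum>k. ennreal (c k) * indicator (ball 0 (R k)) y) \<partial>lborel)"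
  proof (rule nn_integral_mono)
    fix y
    show "ennreal (f y) \<le> (\<Sum>k. ennreal (c k) * indicator (ball 0 (R k)) y)"
    proof (cases "0 < f y")
      case True
      then obtain k where k: "f y \<le> c k" "norm y < R k" using cover by blast
      define g where "g i = ennreal (c i) * indicator (ball 0 (R i)) y" for i
      have "ennreal (f y) \<le> g k"
        using k by (simp add: g_def indicator_def ennreal_leI)
      also have "g k = sum g {k}" by simp
      also have "\<dots> \<le> (\<Sum>i. g i)"
        by (rule sum_le_suminf) auto
      finally show ?thesis by (simp add: g_def)
    qed (simp add: ennreal_neg)
  qed
  also have "\<dots> = (\<Sum>k. \<integral>\<^sup>+(y :: 'a). ennreal (c k) * indicator (ball 0 (R k)) y \<partial>lborel)"
    by (rule nn_integral_suminf) (auto intro!: borel_measurable_times_ennreal borel_measurable_indicator)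
  also have "\<dots> = (\<Sum>k. ennreal (unit_ball_vol (DIM('a)) * (c k * R k ^ DIM('a))))"
    using nonneg by (intro suminf_cong)
      (simp add: nn_integral_cmult_indicator emeasure_ball ennreal_mult[symmetric] unit_ball_vol_nonneg mult_ac)
  also have "\<dots> < \<infinity>"
    using nonneg summable_mult[OF sum, of "unit_ball_vol (DIM('a))"]
    by (subst suminf_ennreal2) (auto simp: unit_ball_vol_nonneg)
  finally show ?thesis .
qed

text \<open>On the shell between \<open>2 powr (- (k + 1))\<close> and \<open>2 powr (- k)\<close>
  the integrand is at most \<open>?c k\<close>. The covering ball is open, hence the larger radius
  \<open>?R k\<close>. The products of bound and volume form a geometric series of ratio
  \<open>2 powr (- a)\<close>.\<close>

lemma nn_integral_powr_near_finite:
  assumes a: "0 < a"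
  shows "(\<integral>\<^sup>+y. ennreal (if norm y \<le> 1 then norm y powr (a - real DIM('a)) else 0) \<partial>(lborel :: 'a::euclidean_space measure)) < \<infinity>"
proof (rule nn_integral_dyadic_finite)
  let ?d = "real DIM('a)"
  let ?c = "\<lambda>k::nat. 2 powr (- real k * a) * 2 powr ((real k + 1) * ?d)" and ?R = "\<lambda>k::nat. 2 powr (1 - real k)"
  fix y :: 'a
  assume "0 < (if norm y \<le> 1 then norm y powr (a - ?d) else 0)"
  then have y: "0 < norm y" "norm y \<le> 1" by (auto split: if_splits)
  define k where "k = nat \<lfloor>- log 2 (norm y)\<rfloor>"
  have "0 \<le> - log 2 (norm y)" using y by simp
  then have k: "real k \<le> - log 2 (norm y)" "- log 2 (norm y) < real k + 1"
    unfolding k_def by linarith+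
  have up: "norm y \<le> 2 powr (- real k)"
    using k(1) y by (subst log_le_iff[symmetric]) auto
  have low: "2 powr (- (real k + 1)) \<le> norm y"
    using k(2) y by (subst le_log_iff[symmetric]) auto
  \<comment> \<open>The two factors are monotone in opposite directions, so the outer radius of the
    shell bounds one and the inner radius the other.\<close>
  have "norm y powr (a - ?d) = norm y powr a * norm y powr (- ?d)"
    using y by (simp add: powr_add[symmetric])
  also have "\<dots> \<le> (2 powr (- real k)) powr a * (2 powr (- (real k + 1))) powr (- ?d)"
    using up low a y by (intro mult_mono powr_mono2 powr_mono2') auto
  also have "\<dots> = ?c k" by (simp add: powr_powr algebra_simps)
  finally have "norm y powr (a - ?d) \<le> ?c k" .
  moreover have "norm y < ?R k"
    using up by (rule le_less_trans) (intro powr_less_mono, auto)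
  ultimately show "\<exists>k. (if norm y \<le> 1 then norm y powr (a - ?d) else 0) \<le> ?c k \<and> norm y < ?R k"
    using y by (intro exI[of _ k]) auto
next
  let ?d = "real DIM('a)"
  have "2 powr (- real k * a) * 2 powr ((real k + 1) * ?d) * (2 powr (1 - real k)) ^ DIM('a) = 2 powr (2 * ?d) * (2 powr (- a)) ^ k" for k
    by (simp add: powr_realpow[symmetric] powr_powr powr_add[symmetric] algebra_simps)
  moreover have "summable (\<lambda>k. 2 powr (2 * ?d) * (2 powr (- a)) ^ k)"
    using a by (intro summable_mult summable_geometric) (simp add: powr_less_one)
  ultimately show "summable (\<lambda>k. 2 powr (- real k * a) * 2 powr ((real k + 1) * ?d) * (2 powr (1 - real k)) ^ DIM('a))"
    by simp
qed auto

text \<open>On the shell between \<open>2 powr k\<close> and \<open>2 powr (k + 1)\<close> the decay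
  of the integrand beats the growth of the volume by the factor
  \<open>(2 powr (- a)) ^ k\<close>.\<close>

lemma nn_integral_powr_far_finite:
  assumes a: "0 < a"
  shows "(\<integral>\<^sup>+y. ennreal (if 1 \<le> norm y then norm y powr (- (real DIM('a) + a)) else 0) \<partial>(lborel :: 'a::euclidean_space measure)) < \<infinity>"
proof (rule nn_integral_dyadic_finite)
  let ?d = "real DIM('a)"
  let ?c = "\<lambda>k::nat. 2 powr (- real k * (?d + a))" and ?R = "\<lambda>k::nat. 2 powr (real k + 1)"
  fix y :: 'a
  assume "0 < (if 1 \<le> norm y then norm y powr (- (?d + a)) else 0)"
  then have y: "1 \<le> norm y" by (auto split: if_splits)
  define k where "k = nat \<lfloor>log 2 (norm y)\<rfloor>"
  have "0 \<le> log 2 (norm y)" using y by (subst zero_le_log_cancel_iff) auto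
  then have k: "real k \<le> log 2 (norm y)" "log 2 (norm y) < real k + 1"
    unfolding k_def by linarith+
  have low: "2 powr (real k) \<le> norm y"
    using k(1) y by (subst le_log_iff[symmetric]) auto
  have up: "norm y < 2 powr (real k + 1)"
    using k(2) y by (subst log_less_iff[symmetric]) auto
  have "norm y powr (- (?d + a)) \<le> (2 powr real k) powr (- (?d + a))"
    using low a y by (intro powr_mono2') auto
  also have "\<dots> = ?c k" by (simp add: powr_powr algebra_simps)
  finally show "\<exists>k. (if 1 \<le> norm y then norm y powr (- (?d + a)) else 0) \<le> ?c k \<and> norm y < ?R k"
    using y up by (intro exI[of _ k]) auto
next
  let ?d = "real DIM('a)"
  have "2 powr (- real k * (?d + a)) * (2 powr (real k + 1)) ^ DIM('a) = 2 powr (?d) * (2 powr (- a)) ^ k" for k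
    by (simp add: powr_realpow[symmetric] powr_powr powr_add[symmetric] algebra_simps)
  moreover have "summable (\<lambda>k. 2 powr (?d) * (2 powr (- a)) ^ k)"
    using a by (intro summable_mult summable_geometric) (simp add: powr_less_one)
  ultimately show "summable (\<lambda>k. 2 powr (- real k * (?d + a)) * (2 powr (real k + 1)) ^ DIM('a))"
    by simp
qed auto

text \<open>Levy density of the fractional Laplacian without the factor \<open>frac_const\<close>.
  At the origin it is 0 by the conventions for \<open>powr\<close> and division.\<close>

definition levy_weight :: "real \<Rightarrow> 'a::euclidean_space \<Rightarrow> real" where
  "levy_weight s y = 1 / norm y powr (real DIM('a) + 2 * s)"

text \<open>One majorant, up to constants, both for the second differences of a test function
  (quadratic near 0, bounded far away) and for \<open>logw\<close>. The exponent \<open>s\<close> at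
  infinity dominates both and stays below the integrability threshold \<open>2 * s\<close>.\<close>

definition levy_cut :: "real \<Rightarrow> 'a::euclidean_space \<Rightarrow> real" where
  "levy_cut s y = (if norm y \<le> 1 then (norm y)\<^sup>2 else norm y powr s)"

lemma levy_weight_measurable [measurable]: "levy_weight s \<in> borel_measurable borel"
  unfolding levy_weight_def[abs_def] by measurable

lemma levy_cut_measurable [measurable]: "levy_cut s \<in> borel_measurable borel"
  unfolding levy_cut_def[abs_def] by measurable

lemma levy_weight_nonneg: "0 \<le> levy_weight s y" by (simp add: levy_weight_def)

lemma levy_cut_nonneg: "0 \<le> levy_cut s y" by (simp add: levy_cut_def)

text \<open>Near 0 the exponent exceeds \<open>- ?d\<close> by \<open>2 - 2 * s\<close>, which is
  positive as \<open>s < 1\<close>; at infinity it lies below \<open>- ?d\<close> by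
  \<open>s\<close>.\<close>

lemma levy_integrable:
  assumes s: "0 < s" "s < 1"
  shows "integrable lborel (\<lambda>y :: 'a::euclidean_space. levy_cut s y * levy_weight s y)"
proof -
  let ?d = "real DIM('a)"
  let ?n = "\<lambda>y::'a. if norm y \<le> 1 then norm y powr ((2 - 2 * s) - ?d) else 0"
  let ?f = "\<lambda>y::'a. if 1 \<le> norm y then norm y powr (- (?d + s)) else 0"
  have "(\<integral>\<^sup>+y. ennreal (norm (levy_cut s y * levy_weight s (y :: 'a))) \<partial>lborel) \<le> (\<integral>\<^sup>+y. ennreal (?n y) + ennreal (?f y) \<partial>lborel)"
  proof (rule nn_integral_mono)
    fix y :: 'a
    have "norm (levy_cut s y * levy_weight s y) \<le> ?n y + ?f y"
    proof (cases "y = 0")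
      case False
      then have y: "0 < norm y" by simp
      have "(norm y)\<^sup>2 * levy_weight s y = norm y powr ((2 - 2 * s) - ?d)"
      proof -
        have sq: "(norm y)\<^sup>2 = norm y powr 2" using y by simp
        show ?thesis
          unfolding sq using y
          by (simp add: levy_weight_def powr_add[symmetric] divide_powr_uminus algebra_simps del: powr_numeral)
      qed
      moreover have "norm y powr s * levy_weight s y = norm y powr (- (?d + s))"
        using y by (simp add: levy_weight_def divide_powr_uminus powr_add[symmetric] algebra_simps)
      ultimately show ?thesis
        using y by (auto simp: levy_cut_def levy_weight_nonneg abs_mult)
    qed (simp add: levy_cut_def)
    then have "ennreal (norm (levy_cut s y * levy_weight s y)) \<le> ennreal (?n y + ?f y)"
      by (rule ennreal_leI)
    also have "\<dots> = ennreal (?n y) + ennreal (?f y)"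
      by (rule ennreal_plus) auto
    finally show "ennreal (norm (levy_cut s y * levy_weight s y)) \<le> ennreal (?n y) + ennreal (?f y)" .
  qed
  also have "\<dots> = (\<integral>\<^sup>+y. ennreal (?n y) \<partial>lborel) + (\<integral>\<^sup>+y. ennreal (?f y) \<partial>lborel)"
    by (rule nn_integral_add) measurable
  also have "\<dots> < \<infinity>"
    using nn_integral_powr_near_finite[of "2 - 2 * s", where ?'a = 'a] nn_integral_powr_far_finite[of s, where ?'a = 'a] s
    by simp
  finally show ?thesis
    by (intro integrableI_bounded) measurable
qed

text \<open>Averaging with the reflected copy turns the first difference of the generator into the
  second difference used in \<open>frac_lap\<close>, whose quadratic smallness at 0 compensates the
  singularity of the Levy density.\<close>

lemma integral_symmetric_difference:
  fixes \<kappa> :: "'a::euclidean_space measure" and f :: "'a \<Rightarrow> real"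
  assumes \<kappa>: "prob_space \<kappa>" "sets \<kappa> = sets borel" "distr \<kappa> borel uminus = \<kappa>"
    and f: "f \<in> borel_measurable borel" "\<And>y. \<bar>f y\<bar> \<le> C"
  shows "(\<integral>y. f y - c \<partial>\<kappa>) = 1/2 * (\<integral>y. f y + f (- y) - 2 * c \<partial>\<kappa>)"
proof -
  note [measurable_cong] = \<kappa>(2)
  note [measurable] = f(1)
  interpret prob_space \<kappa> by fact
  have um: "uminus \<in> borel_measurable \<kappa>"
    unfolding measurable_cong_sets[OF \<kappa>(2) refl]
    by (intro borel_measurable_continuous_onI continuous_on_minus continuous_on_id)
  have i: "integrable \<kappa> f" "integrable \<kappa> (\<lambda>y. f (- y))"
    by (rule integrable_const_bound[of _ C]; simp add: f)+
  have "(\<integral>y. f y \<partial>\<kappa>) = (\<integral>y. f y \<partial>distr \<kappa> borel uminus)" using \<kappa>(3) by simp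
  also have "\<dots> = (\<integral>y. f (- y) \<partial>\<kappa>)" by (rule integral_distr[OF um f(1)])
  finally show ?thesis
    using i by (simp add: prob_space)
qed

lemma distr_uminus_lborel: "distr lborel borel uminus = (lborel :: 'a::euclidean_space measure)"
  by (subst (2) lborel_affine[of "-1" 0]) (auto simp: density_1)

text \<open>The rate \<open>c * \<Lambda> n\<close> undoes the normalisation: \<open>r n\<close>
  times the law has exactly the density \<open>c * levy_weight\<close> outside a small ball. The
  generator thus differs from the fractional Laplacian only by the integral over that ball, which is
  at most \<open>c / 2 * (K * \<delta> n)\<close> at every point.\<close>

lemma jump_data_fractional:
  fixes s :: real
  assumes s: "0 < s" "s < 1"
  obtains \<kappa> :: "nat \<Rightarrow> 'a::euclidean_space measure" and r :: "nat \<Rightarrow> real" and C :: real where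
    "\<And>n. prob_space (\<kappa> n)" "\<And>n. sets (\<kappa> n) = sets borel" "\<And>n. distr (\<kappa> n) borel uminus = \<kappa> n"
    "\<And>n. 0 \<le> r n" "0 \<le> C" "\<And>n. ennreal (r n) * (\<integral>\<^sup>+y. ennreal (logw y) \<partial>\<kappa> n) \<le> ennreal C"
    "\<And>\<phi> e. csmooth \<phi> \<Longrightarrow> 0 < e \<Longrightarrow> \<forall>\<^sub>F n in sequentially. \<forall>(x :: 'a) v (t :: real).
       \<bar>r n * (\<integral>y. \<phi> (x, v + y, t) - \<phi> (x, v, t) \<partial>\<kappa> n) + frac_lap s (\<lambda>w. \<phi> (x, w, t)) v\<bar> \<le> e"
proof -
  define c where "c = frac_const DIM('a) s"
  \<comment> \<open>\<open>Gamma (1 - s)\<close> is positive because \<open>s < 1\<close>.\<close>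
  have c: "0 < c"
    unfolding c_def frac_const_def using s
    by (intro divide_pos_pos mult_pos_pos Gamma_real_pos) auto
  let ?w = "levy_weight s :: 'a \<Rightarrow> real" and ?\<eta> = "levy_cut s :: 'a \<Rightarrow> real"
  define S where "S n = {y :: 'a. 1 / real (Suc n) < norm y}" for n
  have [measurable]: "S n \<in> sets borel" for n unfolding S_def by measurable
  have I: "integrable lborel (\<lambda>y. ?\<eta> y * ?w y)" by (rule levy_integrable[OF s])
  \<comment> \<open>Outside the small ball \<open>levy_cut\<close> is bounded below, so the Levy
    density has finite mass there by comparison with \<open>levy_integrable\<close>.\<close>
  have S\<eta>: "1 \<le> (real (Suc n))\<^sup>2 * ?\<eta> y" if "y \<in> S n" for n y
  proof (cases "norm y \<le> 1")
    case True
    have "1 \<le> real (Suc n) * norm y" using that by (simp add: S_def field_simps del: of_nat_Suc)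
    then have "1\<^sup>2 \<le> (real (Suc n) * norm y)\<^sup>2" by (intro power_mono) auto
    with True show ?thesis by (simp add: levy_cut_def power_mult_distrib)
  next
    case False
    then have "1 \<le> norm y powr s" using s by (intro ge_one_powr_ge_zero) auto
    moreover have "1 \<le> (real (Suc n))\<^sup>2" by simp
    ultimately show ?thesis using False mult_mono[of 1 "(real (Suc n))\<^sup>2" 1 "norm y powr s"]
      by (simp add: levy_cut_def)
  qed
  have intS: "integrable lborel (\<lambda>y. indicator (S n) y * ?w y)" for n
  proof (rule Bochner_Integration.integrable_bound[OF integrable_mult_right[OF I, of "(real (Suc n))\<^sup>2"]])
    show "AE y in lborel. norm (indicator (S n) y * ?w y) \<le> norm ((real (Suc n))\<^sup>2 * (?\<eta> y * ?w y))"
    proof (rule AE_I2)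
      fix y
      show "norm (indicator (S n) y * ?w y) \<le> norm ((real (Suc n))\<^sup>2 * (?\<eta> y * ?w y))"
        using mult_right_mono[OF S\<eta>[of y n] levy_weight_nonneg[of s y]]
        by (cases "y \<in> S n") (auto simp: abs_mult levy_weight_nonneg levy_cut_nonneg mult.assoc simp del: of_nat_Suc)
    qed
  qed measurable
  define \<Lambda> where "\<Lambda> n = (\<integral>y. indicator (S n) y * ?w y \<partial>lborel)" for n
  have \<Lambda>: "0 < \<Lambda> n" for n
  proof -
    have "0 \<le> \<Lambda> n" unfolding \<Lambda>_def by (intro integral_nonneg_AE AE_I2) (simp add: levy_weight_nonneg)
    \<comment> \<open>The density is positive on \<open>S n\<close>, and a non-empty open set is not
      negligible.\<close>
    moreover have "\<Lambda> n \<noteq> 0"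
    proof
      assume "\<Lambda> n = 0"
      then have "AE y in lborel. indicator (S n) y * ?w y = 0"
        unfolding \<Lambda>_def using intS[of n]
        by (subst (asm) integral_nonneg_eq_0_iff_AE) (auto simp: levy_weight_nonneg)
      then have "AE y in lborel. y \<notin> S n"
        by eventually_elim (auto simp: S_def levy_weight_def indicator_def split: if_splits)
      then have "S n \<in> null_sets lborel"
        by (subst AE_iff_null_sets) auto
      then have "negligible (S n)"
        unfolding negligible_iff_null_sets by (rule null_sets_completionI)
      moreover have "open (S n)" unfolding S_def by (intro open_Collect_less continuous_intros)
      moreover obtain b :: 'a where "b \<in> Basis" using nonempty_Basis by blast
      then have "2 *\<^sub>R b \<in> S n" by (simp add: S_def field_simps)
      ultimately show False using open_not_negligible[of "S n"] by blast
    qed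
    ultimately show ?thesis by simp
  qed
  define dens where "dens n y = indicator (S n) y * ?w y / \<Lambda> n" for n y
  have [measurable]: "dens n \<in> borel_measurable borel" for n unfolding dens_def[abs_def] by measurable
  have dens0: "0 \<le> dens n y" for n y
    using \<Lambda>[of n] by (simp add: dens_def levy_weight_nonneg)
  define \<kappa> where "\<kappa> n = density lborel (\<lambda>y. ennreal (dens n y))" for n
  have sets: "sets (\<kappa> n) = sets borel" for n by (simp add: \<kappa>_def)
  have prob: "prob_space (\<kappa> n)" for n
  proof (rule prob_spaceI)
    have "integrable lborel (dens n)" unfolding dens_def[abs_def] using intS by auto
    then have "(\<integral>\<^sup>+y. ennreal (dens n y) \<partial>lborel) = ennreal (\<integral>y. dens n y \<partial>lborel)"
      using dens0 by (intro nn_integral_eq_integral) auto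
    also have "(\<integral>y. dens n y \<partial>lborel) = 1"
      unfolding dens_def using \<Lambda>[of n] by (simp add: \<Lambda>_def[symmetric])
    finally show "emeasure (\<kappa> n) (space (\<kappa> n)) = 1" by (simp add: \<kappa>_def emeasure_density)
  qed
  have sym: "distr (\<kappa> n) borel uminus = \<kappa> n" for n
  proof -
    have um: "uminus \<in> borel_measurable (lborel :: 'a measure)"
      unfolding measurable_cong_sets[OF sets_lborel refl]
      by (intro borel_measurable_continuous_onI continuous_on_minus continuous_on_id)
    have "dens n (- y) = dens n y" for y by (simp add: dens_def S_def levy_weight_def indicator_def)
    then have "distr (\<kappa> n) borel uminus = distr (density lborel (\<lambda>y. ennreal (dens n (- y)))) borel uminus"
      by (simp add: \<kappa>_def)
    also have "\<dots> = density (distr lborel borel uminus) (\<lambda>y. ennreal (dens n y))"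
      by (rule density_distr[symmetric, OF _ um]) measurable
    finally show ?thesis by (simp add: \<kappa>_def distr_uminus_lborel)
  qed
  define r where "r n = c * \<Lambda> n" for n
  have r: "0 \<le> r n" for n using c \<Lambda>[of n] by (simp add: r_def)
  have r_dens: "r n * dens n y = c * (indicator (S n) y * ?w y)" for n y
    using \<Lambda>[of n] by (simp add: r_def dens_def)
  \<comment> \<open>From \<open>ln x \<le> x powr a / a\<close> with \<open>a = s / 2\<close>, so
    that the square inside \<open>logw\<close> becomes the power \<open>s\<close> of the norm; the
    summand 1 serves the unit ball.\<close>
  define Cl where "Cl = 1 + 2 powr (s / 2) * (2 / s)"
  have Cl: "logw y \<le> Cl * ?\<eta> y" for y :: 'a
  proof (cases "norm y \<le> 1")
    case True
    have "logw y \<le> (norm y)\<^sup>2" unfolding logw_def by (rule ln_add_one_self_le_self) simp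
    also have "\<dots> \<le> Cl * (norm y)\<^sup>2"
      using s mult_right_mono[of 1 Cl "(norm y)\<^sup>2"] by (simp add: Cl_def)
    finally show ?thesis using True by (simp add: levy_cut_def)
  next
    case False
    then have y: "1 < norm y" by simp
    have "logw y \<le> (1 + (norm y)\<^sup>2) powr (s / 2) / (s / 2)"
      unfolding logw_def using s by (intro ln_powr_bound) auto
    also have "\<dots> \<le> (2 * (norm y)\<^sup>2) powr (s / 2) / (s / 2)"
      using y s by (intro divide_right_mono powr_mono2) auto
    also have "\<dots> = 2 powr (s / 2) * (2 / s) * norm y powr s"
    proof -
      have "(norm y)\<^sup>2 = norm y powr 2" using y by simp
      then have "((norm y)\<^sup>2) powr (s / 2) = norm y powr s" by (simp add: powr_powr del: powr_numeral)
      then show ?thesis using y by (simp add: powr_mult)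
    qed
    also have "\<dots> \<le> Cl * norm y powr s" unfolding Cl_def by (intro mult_right_mono) auto
    finally show ?thesis using y by (simp add: levy_cut_def)
  qed
  define C where "C = c * Cl * (\<integral>y. ?\<eta> y * ?w y \<partial>lborel)"
  have C0: "0 \<le> C"
    unfolding C_def using c s
    by (intro mult_nonneg_nonneg integral_nonneg_AE AE_I2) (auto simp: Cl_def levy_cut_nonneg levy_weight_nonneg)
  have mom: "ennreal (r n) * (\<integral>\<^sup>+y. ennreal (logw y) \<partial>\<kappa> n) \<le> ennreal C" for n
  proof -
    have "ennreal (r n) * (\<integral>\<^sup>+y. ennreal (logw y) \<partial>\<kappa> n) = ennreal (r n) * (\<integral>\<^sup>+y. ennreal (dens n y) * ennreal (logw y) \<partial>lborel)"
      unfolding \<kappa>_def by (subst nn_integral_density) auto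
    also have "\<dots> = (\<integral>\<^sup>+y. ennreal (r n) * (ennreal (dens n y) * ennreal (logw y)) \<partial>lborel)"
      by (rule nn_integral_cmult[symmetric]) measurable
    also have "\<dots> \<le> (\<integral>\<^sup>+y. ennreal (c * Cl * (?\<eta> y * ?w y)) \<partial>lborel)"
    proof (rule nn_integral_mono)
      fix y
      have "r n * (dens n y * logw y) = c * (indicator (S n) y * ?w y) * logw y"
        by (simp add: r_dens[symmetric])
      also have "\<dots> \<le> c * ?w y * (Cl * ?\<eta> y)"
        using c Cl[of y] by (intro mult_mono) (auto simp: indicator_def levy_weight_nonneg logw_nonneg)
      finally have "r n * (dens n y * logw y) \<le> c * Cl * (?\<eta> y * ?w y)" by (simp add: mult_ac)
      then show "ennreal (r n) * (ennreal (dens n y) * ennreal (logw y)) \<le> ennreal (c * Cl * (?\<eta> y * ?w y))"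
        using r dens0 by (simp add: ennreal_mult[symmetric] logw_nonneg ennreal_leI)
    qed
    also have "\<dots> = ennreal (\<integral>y. c * Cl * (?\<eta> y * ?w y) \<partial>lborel)"
      using I c s
      by (intro nn_integral_eq_integral integrable_mult_right)
        (auto intro!: mult_nonneg_nonneg simp: Cl_def levy_cut_nonneg levy_weight_nonneg)
    also have "\<dots> = ennreal C" by (simp add: C_def)
    finally show ?thesis .
  qed
  \<comment> \<open>Weight of the part cut away, independent of the test function. It tends to 0 by
    dominated convergence because every \<open>y \<noteq> 0\<close> eventually belongs to
    \<open>S n\<close>.\<close>
  define \<delta> where "\<delta> n = (\<integral>y. indicator (- S n) y * (?\<eta> y * ?w y) \<partial>lborel)" for n
  have \<delta>lim: "\<delta> \<longlonglongrightarrow> 0"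
  proof -
    have "(\<lambda>n. \<integral>y. indicator (- S n) y * (?\<eta> y * ?w y) \<partial>lborel) \<longlonglongrightarrow> (\<integral>y. 0 \<partial>(lborel :: 'a measure))"
    proof (rule integral_dominated_convergence[OF _ _ I])
      show "AE y in lborel. (\<lambda>n. indicator (- S n) y * (?\<eta> y * ?w y)) \<longlonglongrightarrow> 0"
      proof (rule AE_I2)
        fix y :: 'a
        show "(\<lambda>n. indicator (- S n) y * (?\<eta> y * ?w y)) \<longlonglongrightarrow> 0"
        proof (cases "y = 0")
          case False
          then have "\<forall>\<^sub>F n in sequentially. 1 / real (Suc n) < norm y"
            using LIMSEQ_inverse_real_of_nat by (intro order_tendstoD(2)[of _ 0]) (auto simp: inverse_eq_divide)
          then have "\<forall>\<^sub>F n in sequentially. indicator (- S n) y * (?\<eta> y * ?w y) = 0"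
            by eventually_elim (simp add: S_def)
          then show ?thesis by (rule tendsto_eventually)
        qed (simp add: levy_cut_def)
      qed
      show "AE y in lborel. norm (indicator (- S n) y * (?\<eta> y * ?w y)) \<le> ?\<eta> y * ?w y" for n
        by (intro AE_I2) (auto simp: indicator_def levy_cut_nonneg levy_weight_nonneg)
    qed measurable
    then show ?thesis by (simp add: \<delta>_def[abs_def])
  qed
  show thesis
  proof (rule that[OF prob sets sym r C0 mom])
    fix \<phi> :: "'a \<times> 'a \<times> real \<Rightarrow> real" and e :: real
    assume \<phi>: "csmooth \<phi>" and e: "0 < e"
    obtain M where M: "0 \<le> M" "\<And>p. \<bar>\<phi> p\<bar> \<le> M" using csmooth_bounded[OF \<phi>] by blast
    obtain C2 where C2: "0 \<le> C2" "\<And>p q. \<bar>\<phi> (p + q) + \<phi> (p - q) - 2 * \<phi> p\<bar> \<le> C2 * (norm q)\<^sup>2"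
      using csmooth_second_difference[OF \<phi>] by blast
    \<comment> \<open>\<open>C2\<close> is the Taylor constant, used inside the unit ball; outside,
      a second difference of a function bounded by \<open>M\<close> is at most
      \<open>4 * M\<close>.\<close>
    define K where "K = max C2 (4 * M)"
    have K: "0 \<le> K" "C2 \<le> K" "4 * M \<le> K" using C2 by (auto simp: K_def)
    have bound: "\<bar>r n * (\<integral>y. \<phi> (x, v + y, t) - \<phi> (x, v, t) \<partial>\<kappa> n) + frac_lap s (\<lambda>w. \<phi> (x, w, t)) v\<bar> \<le> c / 2 * (K * \<delta> n)"
      for x v t n
    proof -
      define f where "f y = \<phi> (x, v + y, t)" for y
      have contf: "continuous_on UNIV f"
        unfolding f_def[abs_def]
        by (rule continuous_on_compose2[OF smooth_fun_continuous]) (use \<phi> in \<open>auto simp: csmooth_def intro!: continuous_intros\<close>)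
      then have [measurable]: "f \<in> borel_measurable borel" by (rule borel_measurable_continuous_onI)
      have [measurable]: "(\<lambda>y. f (- y)) \<in> borel_measurable borel"
        by (intro borel_measurable_continuous_onI continuous_on_compose2[OF contf] continuous_intros) auto
      define g where "g y = f y + f (- y) - 2 * \<phi> (x, v, t)" for y
      have [measurable]: "g \<in> borel_measurable borel" unfolding g_def[abs_def] by measurable
      have g\<eta>: "\<bar>g y\<bar> \<le> K * ?\<eta> y" for y
      proof (cases "norm y \<le> 1")
        case True
        have "\<bar>g y\<bar> \<le> C2 * (norm y)\<^sup>2"
          using C2(2)[of "(x, v, t)" "(0, y, 0)"] by (simp add: g_def f_def norm_Pair)
        also have "\<dots> \<le> K * (norm y)\<^sup>2" using K by (intro mult_right_mono) auto
        finally show ?thesis using True by (simp add: levy_cut_def)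
      next
        case False
        have "\<bar>g y\<bar> \<le> 4 * M"
          using M(2)[of "(x, v + y, t)"] M(2)[of "(x, v - y, t)"] M(2)[of "(x, v, t)"] by (simp add: g_def f_def)
        also have "\<dots> \<le> K * 1" using K by simp
        also have "\<dots> \<le> K * norm y powr s"
          using K False s by (intro mult_left_mono ge_one_powr_ge_zero) auto
        finally show ?thesis using False by (simp add: levy_cut_def)
      qed
      have gw: "norm (g y * ?w y) \<le> K * (?\<eta> y * ?w y)" for y
        using mult_right_mono[OF g\<eta>[of y] levy_weight_nonneg[of s y]]
        by (simp add: abs_mult levy_weight_nonneg mult.assoc)
      have ig: "integrable lborel (\<lambda>y. g y * ?w y)"
      proof (rule Bochner_Integration.integrable_bound[OF integrable_mult_right[OF I, of K]])
        show "AE y in lborel. norm (g y * ?w y) \<le> norm (K * (?\<eta> y * ?w y))"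
          using order.trans[OF gw abs_ge_self] by (intro AE_I2) simp
      qed measurable
      have iS: "integrable lborel (\<lambda>y. indicator (S n) y * (g y * ?w y))"
        using integrable_mult_indicator[of "S n" lborel, OF _ ig] by simp
      have iS': "integrable lborel (\<lambda>y. indicator (- S n) y * (g y * ?w y))"
        using integrable_mult_indicator[of "- S n" lborel, OF _ ig] by simp
      have i\<delta>: "integrable lborel (\<lambda>y. indicator (- S n) y * (?\<eta> y * ?w y))"
        using integrable_mult_indicator[of "- S n" lborel, OF _ I] by simp
      have "r n * (\<integral>y. \<phi> (x, v + y, t) - \<phi> (x, v, t) \<partial>\<kappa> n) = r n * (1/2 * (\<integral>y. g y \<partial>\<kappa> n))"
      proof -
        have "(\<integral>y. f y - \<phi> (x, v, t) \<partial>\<kappa> n) = 1/2 * (\<integral>y. f y + f (- y) - 2 * \<phi> (x, v, t) \<partial>\<kappa> n)"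
          by (rule integral_symmetric_difference[OF prob sets sym, of f M]) (simp_all add: f_def[of "_ :: 'a"] M)
        then show ?thesis by (simp only: f_def g_def)
      qed
      also have "(\<integral>y. g y \<partial>\<kappa> n) = (\<integral>y. dens n y * g y \<partial>lborel)"
        unfolding \<kappa>_def using dens0 by (subst integral_density) auto
      also have "r n * (1/2 * (\<integral>y. dens n y * g y \<partial>lborel)) = 1/2 * (\<integral>y. r n * dens n y * g y \<partial>lborel)"
        by (simp add: mult.assoc)
      also have "\<dots> = c / 2 * (\<integral>y. indicator (S n) y * (g y * ?w y) \<partial>lborel)"
        unfolding r_dens by (simp add: mult_ac)
      finally have 1: "r n * (\<integral>y. \<phi> (x, v + y, t) - \<phi> (x, v, t) \<partial>\<kappa> n) = c / 2 * (\<integral>y. indicator (S n) y * (g y * ?w y) \<partial>lborel)" .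
      have 2: "frac_lap s (\<lambda>w. \<phi> (x, w, t)) v = - (c / 2) * (\<integral>y. g y * ?w y \<partial>lborel)"
        using s by (simp add: frac_lap_def c_def g_def f_def levy_weight_def)
      have "(\<integral>y. g y * ?w y \<partial>lborel) = (\<integral>y. indicator (S n) y * (g y * ?w y) + indicator (- S n) y * (g y * ?w y) \<partial>lborel)"
        by (intro Bochner_Integration.integral_cong refl) (auto simp: indicator_def)
      also have "\<dots> = (\<integral>y. indicator (S n) y * (g y * ?w y) \<partial>lborel) + (\<integral>y. indicator (- S n) y * (g y * ?w y) \<partial>lborel)"
        by (rule Bochner_Integration.integral_add[OF iS iS'])
      finally have "r n * (\<integral>y. \<phi> (x, v + y, t) - \<phi> (x, v, t) \<partial>\<kappa> n) + frac_lap s (\<lambda>w. \<phi> (x, w, t)) v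
          = - (c / 2) * (\<integral>y. indicator (- S n) y * (g y * ?w y) \<partial>lborel)"
        unfolding 1 2 by (simp add: algebra_simps)
      then have "\<bar>r n * (\<integral>y. \<phi> (x, v + y, t) - \<phi> (x, v, t) \<partial>\<kappa> n) + frac_lap s (\<lambda>w. \<phi> (x, w, t)) v\<bar>
          = c / 2 * \<bar>\<integral>y. indicator (- S n) y * (g y * ?w y) \<partial>lborel\<bar>"
        using c by (simp add: abs_mult)
      also have "\<bar>\<integral>y. indicator (- S n) y * (g y * ?w y) \<partial>lborel\<bar> \<le> (\<integral>y. \<bar>indicator (- S n) y * (g y * ?w y)\<bar> \<partial>lborel)"
        by (rule integral_abs_bound)
      also have "\<dots> \<le> (\<integral>y. K * (indicator (- S n) y * (?\<eta> y * ?w y)) \<partial>lborel)"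
        using iS' i\<delta> gw by (intro integral_mono integrable_abs integrable_mult_right) (auto simp: indicator_def)
      also have "\<dots> = K * \<delta> n" by (simp add: \<delta>_def)
      finally show ?thesis using c by (simp add: mult_left_mono)
    qed
    have "(\<lambda>n. c / 2 * (K * \<delta> n)) \<longlonglongrightarrow> c / 2 * (K * 0)"
      by (intro tendsto_intros \<delta>lim)
    then have "\<forall>\<^sub>F n in sequentially. c / 2 * (K * \<delta> n) < e"
      using e by (intro order_tendstoD(2)[of _ 0]) auto
    then show "\<forall>\<^sub>F n in sequentially. \<forall>x v t.
       \<bar>r n * (\<integral>y. \<phi> (x, v + y, t) - \<phi> (x, v, t) \<partial>\<kappa> n) + frac_lap s (\<lambda>w. \<phi> (x, w, t)) v\<bar> \<le> e"
    proof eventually_elim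
      case (elim n)
      show ?case by (intro allI order.trans[OF bound less_imp_le[OF elim]])
    qed
  qed
qed

text \<open>Uniform law on the points at distance \<open>\<delta> n\<close> from 0 on the coordinate
  axes. The rate is the number of these points over the square of the step, so the jump term is a
  sum of second difference quotients. As the logarithmic moment is at most
  \<open>(\<delta> n)\<^sup>2\<close>, the number of points bounds the rate-weighted moment.\<close>

lemma jump_data_laplacian:
  obtains \<kappa> :: "nat \<Rightarrow> 'a::euclidean_space measure" and r :: "nat \<Rightarrow> real" and C :: real where
    "\<And>n. prob_space (\<kappa> n)" "\<And>n. sets (\<kappa> n) = sets borel" "\<And>n. distr (\<kappa> n) borel uminus = \<kappa> n"
    "\<And>n. 0 \<le> r n" "0 \<le> C" "\<And>n. ennreal (r n) * (\<integral>\<^sup>+y. ennreal (logw y) \<partial>\<kappa> n) \<le> ennreal C"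
    "\<And>\<phi> e. csmooth \<phi> \<Longrightarrow> 0 < e \<Longrightarrow> \<forall>\<^sub>F n in sequentially. \<forall>(x :: 'a) v (t :: real).
       \<bar>r n * (\<integral>y. \<phi> (x, v + y, t) - \<phi> (x, v, t) \<partial>\<kappa> n) + frac_lap 1 (\<lambda>w. \<phi> (x, w, t)) v\<bar> \<le> e"
proof -
  \<comment> \<open>The sign is a separate component, so that reflection of a jump is the bijection
    flipping it.\<close>
  define A where "A = (Basis :: 'a set) \<times> {1, - 1 :: real}"
  have A: "finite A" "A \<noteq> {}" by (auto simp: A_def)
  have cardA: "real (card A) = 2 * real DIM('a)" by (simp add: A_def)
  define p where "p = pmf_of_set A"
  define \<delta> where "\<delta> n = 1 / real (Suc n)" for n
  have \<delta>: "0 < \<delta> n" for n by (simp add: \<delta>_def)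
  define J where "J n i = (snd i * \<delta> n) *\<^sub>R fst i" for n and i :: "'a \<times> real"
  define \<kappa> where "\<kappa> n = distr (measure_pmf p) borel (J n)" for n
  define r where "r n = 2 * real DIM('a) / (\<delta> n)\<^sup>2" for n
  have sets: "sets (\<kappa> n) = sets borel" for n by (simp add: \<kappa>_def)
  have prob: "prob_space (\<kappa> n)" for n
    unfolding \<kappa>_def by (intro prob_space.prob_space_distr prob_space_measure_pmf) simp
  have sym: "distr (\<kappa> n) borel uminus = \<kappa> n" for n
  proof -
    let ?g = "\<lambda>i. (fst i, - snd i) :: 'a \<times> real"
    have "bij_betw ?g A A"
      by (rule bij_betw_byWitness[where f' = ?g]) (auto simp: A_def)
    then have "map_pmf ?g p = p"
      unfolding p_def using A by (intro map_pmf_of_set_bij_betw)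
    then have "\<kappa> n = distr (distr (measure_pmf p) (count_space UNIV) ?g) borel (J n)"
      unfolding \<kappa>_def by (metis map_pmf_rep_eq)
    also have "\<dots> = distr (measure_pmf p) borel (J n \<circ> ?g)"
      by (rule distr_distr) auto
    also have "J n \<circ> ?g = uminus \<circ> J n"
      by (auto simp: J_def fun_eq_iff)
    also have "distr (measure_pmf p) borel (uminus \<circ> J n) = distr (\<kappa> n) borel uminus"
      unfolding \<kappa>_def
      by (rule distr_distr[symmetric]) (auto intro!: borel_measurable_continuous_onI continuous_on_minus continuous_on_id)
    finally show ?thesis by simp
  qed
  have r: "0 \<le> r n" for n by (simp add: r_def)
  have mom: "ennreal (r n) * (\<integral>\<^sup>+y. ennreal (logw y) \<partial>\<kappa> n) \<le> ennreal (2 * real DIM('a))" for n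
  proof -
    have "(\<integral>\<^sup>+y. ennreal (logw y) \<partial>\<kappa> n) = (\<integral>\<^sup>+i. ennreal (logw (J n i)) \<partial>measure_pmf p)"
      unfolding \<kappa>_def by (rule nn_integral_distr) auto
    also have "\<dots> \<le> (\<integral>\<^sup>+i. ennreal ((\<delta> n)\<^sup>2) \<partial>measure_pmf p)"
    proof (rule nn_integral_mono_AE)
      show "AE i in measure_pmf p. ennreal (logw (J n i)) \<le> ennreal ((\<delta> n)\<^sup>2)"
        unfolding AE_measure_pmf_iff
      proof
        fix i assume "i \<in> set_pmf p"
        then have "norm (J n i) = \<delta> n"
          using A \<delta>[of n] by (auto simp: p_def A_def J_def)
        then have "logw (J n i) \<le> (\<delta> n)\<^sup>2"
          unfolding logw_def by (simp add: ln_add_one_self_le_self)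
        then show "ennreal (logw (J n i)) \<le> ennreal ((\<delta> n)\<^sup>2)" by (rule ennreal_leI)
      qed
    qed
    also have "\<dots> = ennreal ((\<delta> n)\<^sup>2)" by simp
    finally have "ennreal (r n) * (\<integral>\<^sup>+y. ennreal (logw y) \<partial>\<kappa> n) \<le> ennreal (r n) * ennreal ((\<delta> n)\<^sup>2)"
      by (rule mult_left_mono) simp
    also have "\<dots> = ennreal (r n * (\<delta> n)\<^sup>2)" by (rule ennreal_mult[symmetric]) (auto simp: r)
    finally show ?thesis using \<delta>[of n] by (simp add: r_def)
  qed
  show thesis
  proof (rule that[OF prob sets sym r _ mom])
    fix \<phi> :: "'a \<times> 'a \<times> real \<Rightarrow> real" and e :: real
    assume \<phi>: "csmooth \<phi>" and e: "0 < e"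
    let ?q = "\<lambda>b::'a. (0 :: 'a, b, 0 :: real)"
    have q: "?q b \<in> Basis" if "b \<in> Basis" for b using that by (auto simp: Basis_prod_def)
    have "\<exists>C. 0 \<le> C \<and> (\<forall>p h. \<bar>\<phi> (p + h *\<^sub>R ?q b) + \<phi> (p - h *\<^sub>R ?q b) - 2 * \<phi> p - h\<^sup>2 * partial (?q b) (partial (?q b) \<phi>) p\<bar> \<le> C * \<bar>h\<bar> ^ 3)"
      if "b \<in> Basis" for b
      using csmooth_second_partial[OF \<phi> q[OF that]] by metis
    then obtain C where C: "\<And>b. b \<in> Basis \<Longrightarrow> 0 \<le> C b"
      "\<And>b p h. b \<in> Basis \<Longrightarrow> \<bar>\<phi> (p + h *\<^sub>R ?q b) + \<phi> (p - h *\<^sub>R ?q b) - 2 * \<phi> p - h\<^sup>2 * partial (?q b) (partial (?q b) \<phi>) p\<bar> \<le> C b * \<bar>h\<bar> ^ 3"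
      by metis
    have lap: "laplacian (\<lambda>w. \<phi> (x, w, t)) v = (\<Sum>b\<in>Basis. partial (?q b) (partial (?q b) \<phi>) (x, v, t))" for x v t
      unfolding laplacian_def
    proof (rule sum.cong[OF refl])
      fix b :: 'a assume b: "b \<in> Basis"
      have "deriv (\<lambda>k. \<phi> (x, v + k *\<^sub>R b, t)) h = partial (?q b) \<phi> (x, v + h *\<^sub>R b, t)" for h
      proof -
        have "((\<lambda>k. \<phi> ((x, v, t) + k *\<^sub>R ?q b)) has_real_derivative ddir \<phi> ((x, v, t) + h *\<^sub>R ?q b) (?q b)) (at h)"
          using \<phi> by (intro smooth_fun_DERIV_line) (simp add: csmooth_def)
        then show ?thesis
          using q[OF b] by (simp add: partial_eq_ddir DERIV_imp_deriv)
      qed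
      then show "deriv (\<lambda>h. deriv (\<lambda>k. \<phi> (x, v + k *\<^sub>R b, t)) h) 0 = partial (?q b) (partial (?q b) \<phi>) (x, v, t)"
        unfolding partial_def[of _ "partial (?q b) \<phi>"] by simp
    qed
    obtain M where M: "\<And>p. \<bar>\<phi> p\<bar> \<le> M" using csmooth_bounded[OF \<phi>] by blast
    have bound: "\<bar>r n * (\<integral>y. \<phi> (x, v + y, t) - \<phi> (x, v, t) \<partial>\<kappa> n) + frac_lap 1 (\<lambda>w. \<phi> (x, w, t)) v\<bar> \<le> (\<Sum>b\<in>Basis. C b) * \<delta> n"
      for x v t n
    proof -
      let ?f = "\<lambda>y. \<phi> (x, v + y, t) - \<phi> (x, v, t)"
      have "continuous_on UNIV ?f"
        by (intro continuous_intros continuous_on_compose2[OF smooth_fun_continuous[of \<phi>], where s = UNIV])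
          (use \<phi> in \<open>auto simp: csmooth_def intro!: continuous_intros\<close>)
      then have "?f \<in> borel_measurable borel" by (rule borel_measurable_continuous_onI)
      then have "(\<integral>y. ?f y \<partial>\<kappa> n) = (\<integral>i. ?f (J n i) \<partial>measure_pmf p)"
        unfolding \<kappa>_def by (intro integral_distr) auto
      also have "\<dots> = (\<Sum>i\<in>A. ?f (J n i)) / (2 * real DIM('a))"
        unfolding p_def cardA[symmetric] using A by (intro integral_pmf_of_set) auto
      also have "(\<Sum>i\<in>A. ?f (J n i)) = (\<Sum>b\<in>Basis. \<Sum>\<sigma>\<in>{1, - 1}. ?f (J n (b, \<sigma>)))"
        unfolding A_def by (subst sum.cartesian_product) (simp add: case_prod_beta')
      also have "\<dots> = (\<Sum>b\<in>Basis. \<phi> ((x, v, t) + \<delta> n *\<^sub>R ?q b) + \<phi> ((x, v, t) - \<delta> n *\<^sub>R ?q b) - 2 * \<phi> (x, v, t))"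
        by (intro sum.cong refl) (simp add: J_def)
      finally have "r n * (\<integral>y. ?f y \<partial>\<kappa> n) = (\<Sum>b\<in>Basis. (\<phi> ((x, v, t) + \<delta> n *\<^sub>R ?q b) + \<phi> ((x, v, t) - \<delta> n *\<^sub>R ?q b) - 2 * \<phi> (x, v, t)) / (\<delta> n)\<^sup>2)"
        by (simp only: sum_divide_distrib[symmetric] r_def) simp
      then have "r n * (\<integral>y. ?f y \<partial>\<kappa> n) + frac_lap 1 (\<lambda>w. \<phi> (x, w, t)) v
         = (\<Sum>b\<in>Basis. (\<phi> ((x, v, t) + \<delta> n *\<^sub>R ?q b) + \<phi> ((x, v, t) - \<delta> n *\<^sub>R ?q b) - 2 * \<phi> (x, v, t)) / (\<delta> n)\<^sup>2 - partial (?q b) (partial (?q b) \<phi>) (x, v, t))"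
        by (simp add: frac_lap_def lap sum_subtractf)
      also have "\<bar>\<dots>\<bar> \<le> (\<Sum>b\<in>Basis. C b * \<delta> n)"
      proof (rule order.trans[OF sum_abs sum_mono])
        fix b :: 'a assume b: "b \<in> Basis"
        let ?u = "\<phi> ((x, v, t) + \<delta> n *\<^sub>R ?q b) + \<phi> ((x, v, t) - \<delta> n *\<^sub>R ?q b) - 2 * \<phi> (x, v, t)"
        let ?w = "partial (?q b) (partial (?q b) \<phi>) (x, v, t)"
        have "\<bar>?u / (\<delta> n)\<^sup>2 - ?w\<bar> = \<bar>?u - (\<delta> n)\<^sup>2 * ?w\<bar> / (\<delta> n)\<^sup>2"
        proof -
          have "?u / (\<delta> n)\<^sup>2 - ?w = (?u - (\<delta> n)\<^sup>2 * ?w) / (\<delta> n)\<^sup>2"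
            using \<delta>[of n] by (simp add: diff_divide_distrib)
          then show ?thesis by (simp only: abs_divide abs_power2)
        qed
        also have "\<dots> \<le> C b * \<bar>\<delta> n\<bar> ^ 3 / (\<delta> n)\<^sup>2"
          using C(2)[OF b] by (intro divide_right_mono) auto
        also have "\<dots> = C b * \<delta> n"
          using \<delta>[of n] by (simp add: power3_eq_cube power2_eq_square)
        finally show "\<bar>?u / (\<delta> n)\<^sup>2 - ?w\<bar> \<le> C b * \<delta> n" .
      qed
      finally show ?thesis by (simp add: sum_distrib_right)
    qed
    have "\<delta> \<longlonglongrightarrow> 0"
      unfolding \<delta>_def[abs_def] using LIMSEQ_inverse_real_of_nat by (simp add: inverse_eq_divide)
    then have "(\<lambda>n. (\<Sum>b\<in>Basis. C b) * \<delta> n) \<longlonglongrightarrow> (\<Sum>b\<in>Basis. C b) * 0"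
      by (intro tendsto_intros)
    then have "\<forall>\<^sub>F n in sequentially. (\<Sum>b\<in>Basis. C b) * \<delta> n < e"
      using e by (intro order_tendstoD(2)[of _ 0]) auto
    then show "\<forall>\<^sub>F n in sequentially. \<forall>x v t.
       \<bar>r n * (\<integral>y. \<phi> (x, v + y, t) - \<phi> (x, v, t) \<partial>\<kappa> n) + frac_lap 1 (\<lambda>w. \<phi> (x, w, t)) v\<bar> \<le> e"
    proof eventually_elim
      case (elim n)
      show ?case by (intro allI order.trans[OF bound less_imp_le[OF elim]])
    qed
  qed simp
qed

text \<open>The three one-dimensional derivatives of \<open>weak_op\<close> are directional
  derivatives, and linearity merges them into one along the drift field of the chain with time
  added.\<close>

lemma weak_op_eq:
  assumes "smooth_fun \<phi>"
  shows "weak_op s gradPsi \<phi> (x, v, t) = ddir \<phi> (x, v, t) (v, - gradPsi v, 1) - frac_lap s (\<lambda>w. \<phi> (x, w, t)) v"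
proof -
  have *: "deriv (\<lambda>h. \<phi> ((x, v, t) + h *\<^sub>R q)) 0 = ddir \<phi> (x, v, t) q" for q
    using smooth_fun_DERIV_line[OF assms, of "(x, v, t)" q 0] by (simp add: DERIV_imp_deriv)
  have "((\<lambda>\<tau>. \<phi> ((x, v, 0) + \<tau> *\<^sub>R (0, 0, 1))) has_real_derivative ddir \<phi> ((x, v, 0) + t *\<^sub>R (0, 0, 1)) (0, 0, 1)) (at t)"
    by (rule smooth_fun_DERIV_line[OF assms])
  then have 1: "deriv (\<lambda>\<tau>. \<phi> (x, v, \<tau>)) t = ddir \<phi> (x, v, t) (0, 0, 1)"
    by (simp add: DERIV_imp_deriv)
  have 2: "deriv (\<lambda>h. \<phi> (x + h *\<^sub>R v, v, t)) 0 = ddir \<phi> (x, v, t) (v, 0, 0)"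
    using *[of "(v, 0, 0)"] by simp
  have 3: "deriv (\<lambda>h. \<phi> (x, v + h *\<^sub>R gradPsi v, t)) 0 = ddir \<phi> (x, v, t) (0, gradPsi v, 0)"
    using *[of "(0, gradPsi v, 0)"] by simp
  interpret linear "ddir \<phi> (x, v, t)" by (rule linear_ddir[OF assms])
  have "(v, - gradPsi v, 1) = (0, 0, 1) + (v, 0, 0) - (0, gradPsi v, 0 :: real)" by simp
  then have "ddir \<phi> (x, v, t) (v, - gradPsi v, 1) = ddir \<phi> (x, v, t) (0, 0, 1) + ddir \<phi> (x, v, t) (v, 0, 0) - ddir \<phi> (x, v, t) (0, gradPsi v, 0)"
    by (simp only: add diff)
  then show ?thesis by (simp add: weak_op_def 1 2 3)
qed

lemma ddir_bounded:
  assumes "csmooth g"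
  obtains C where "0 \<le> C" "\<And>p q. \<bar>ddir g p q\<bar> \<le> C * norm q"
proof -
  obtain C where C: "0 \<le> C" "\<And>p q. \<bar>g p - g q\<bar> \<le> C * norm (p - q)"
    using csmooth_lipschitz[OF assms] by blast
  have "\<bar>ddir g p q\<bar> \<le> C * norm q" for p q
  proof -
    have "((\<lambda>h. g (p + h *\<^sub>R q)) has_real_derivative ddir g (p + 0 *\<^sub>R q) q) (at 0)"
      using assms by (intro smooth_fun_DERIV_line) (simp add: csmooth_def)
    then have "((\<lambda>h. (g (p + h *\<^sub>R q) - g p) / h) \<longlongrightarrow> ddir g p q) (at 0)"
      by (simp add: DERIV_def)
    then have "((\<lambda>h. \<bar>(g (p + h *\<^sub>R q) - g p) / h\<bar>) \<longlongrightarrow> \<bar>ddir g p q\<bar>) (at 0)"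
      by (rule tendsto_rabs)
    moreover have "\<forall>\<^sub>F h in at 0. \<bar>(g (p + h *\<^sub>R q) - g p) / h\<bar> \<le> C * norm q"
      unfolding eventually_at_filter
    proof (intro always_eventually allI impI)
      fix h :: real assume "h \<noteq> 0"
      then show "\<bar>(g (p + h *\<^sub>R q) - g p) / h\<bar> \<le> C * norm q"
        using C(2)[of "p + h *\<^sub>R q" p] by (simp add: abs_divide field_simps)
    qed
    ultimately show ?thesis by (rule tendsto_upperbound) simp
  qed
  with C show thesis by (intro that)
qed

section \<open>Consistency and the limit equation\<close>

text \<open>Time dependence and size of the jump term at a fixed rate. The factor 2 counts the two
  values of \<open>\<phi>\<close> in the difference.\<close>

lemma jump_average_lipschitz_time:
  fixes \<phi> :: "'a::euclidean_space \<times> 'a \<times> real \<Rightarrow> real"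
  assumes \<kappa>: "prob_space \<kappa>" "sets \<kappa> = sets borel" and cont: "continuous_on UNIV \<phi>"
    and M: "\<And>p. \<bar>\<phi> p\<bar> \<le> M" and C: "\<And>p q. \<bar>\<phi> p - \<phi> q\<bar> \<le> C * norm (p - q)" and r: "0 \<le> r"
  shows "integrable \<kappa> (\<lambda>y. \<phi> (x, v + y, t))"
    and "\<bar>r * (\<integral>y. \<phi> (x, v + y, t) - \<phi> (x, v, t) \<partial>\<kappa>) - r * (\<integral>y. \<phi> (x, v + y, t') - \<phi> (x, v, t') \<partial>\<kappa>)\<bar> \<le> 2 * r * C * \<bar>t - t'\<bar>"
    and "\<bar>r * (\<integral>y. \<phi> (x, v + y, t) - \<phi> (x, v, t) \<partial>\<kappa>)\<bar> \<le> 2 * r * M"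
proof -
  interpret prob_space \<kappa> by (rule \<kappa>)
  note [measurable_cong] = \<kappa>(2)
  have [measurable]: "(\<lambda>y. \<phi> (x, v + y, t)) \<in> borel_measurable borel" for x v t
    by (intro borel_measurable_continuous_onI continuous_on_compose2[OF cont] continuous_intros) auto
  have i: "integrable \<kappa> (\<lambda>y. \<phi> (x, v + y, t))" for x v t
    by (rule integrable_const_bound[of _ M]) (auto simp: M)
  then show "integrable \<kappa> (\<lambda>y. \<phi> (x, v + y, t))" .
  have avg: "\<bar>\<integral>y. g y \<partial>\<kappa>\<bar> \<le> c" if "integrable \<kappa> g" "\<And>y. \<bar>g y\<bar> \<le> c" for g :: "'a \<Rightarrow> real" and c
  proof -
    have "\<bar>\<integral>y. g y \<partial>\<kappa>\<bar> \<le> (\<integral>y. \<bar>g y\<bar> \<partial>\<kappa>)" by (rule integral_abs_bound)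
    also have "\<dots> \<le> (\<integral>y. c \<partial>\<kappa>)" using that by (intro integral_mono) auto
    finally show ?thesis by (simp add: prob_space)
  qed
  have "(\<integral>y. \<phi> (x, v + y, t) - \<phi> (x, v, t) \<partial>\<kappa>) - (\<integral>y. \<phi> (x, v + y, t') - \<phi> (x, v, t') \<partial>\<kappa>)
      = (\<integral>y. (\<phi> (x, v + y, t) - \<phi> (x, v + y, t')) - (\<phi> (x, v, t) - \<phi> (x, v, t')) \<partial>\<kappa>)"
    using i by (simp add: prob_space)
  moreover have "\<bar>\<integral>y. (\<phi> (x, v + y, t) - \<phi> (x, v + y, t')) - (\<phi> (x, v, t) - \<phi> (x, v, t')) \<partial>\<kappa>\<bar> \<le> 2 * (C * \<bar>t - t'\<bar>)"
  proof (rule avg)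
    show "integrable \<kappa> (\<lambda>y. (\<phi> (x, v + y, t) - \<phi> (x, v + y, t')) - (\<phi> (x, v, t) - \<phi> (x, v, t')))"
      using i by auto
    fix y
    show "\<bar>(\<phi> (x, v + y, t) - \<phi> (x, v + y, t')) - (\<phi> (x, v, t) - \<phi> (x, v, t'))\<bar> \<le> 2 * (C * \<bar>t - t'\<bar>)"
      using C[of "(x, v + y, t)" "(x, v + y, t')"] C[of "(x, v, t)" "(x, v, t')"] by (simp add: norm_Pair)
  qed
  ultimately have "r * \<bar>(\<integral>y. \<phi> (x, v + y, t) - \<phi> (x, v, t) \<partial>\<kappa>) - (\<integral>y. \<phi> (x, v + y, t') - \<phi> (x, v, t') \<partial>\<kappa>)\<bar> \<le> r * (2 * (C * \<bar>t - t'\<bar>))"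
    using r by (intro mult_left_mono) auto
  then show "\<bar>r * (\<integral>y. \<phi> (x, v + y, t) - \<phi> (x, v, t) \<partial>\<kappa>) - r * (\<integral>y. \<phi> (x, v + y, t') - \<phi> (x, v, t') \<partial>\<kappa>)\<bar> \<le> 2 * r * C * \<bar>t - t'\<bar>"
    using r by (simp add: right_diff_distrib[symmetric] abs_mult mult_ac)
  have "\<bar>\<integral>y. \<phi> (x, v + y, t) - \<phi> (x, v, t) \<partial>\<kappa>\<bar> \<le> 2 * M"
  proof (rule avg)
    fix y
    show "\<bar>\<phi> (x, v + y, t) - \<phi> (x, v, t)\<bar> \<le> 2 * M"
      using M[of "(x, v + y, t)"] M[of "(x, v, t)"] by simp
  qed (use i in auto)
  then have "r * \<bar>\<integral>y. \<phi> (x, v + y, t) - \<phi> (x, v, t) \<partial>\<kappa>\<bar> \<le> r * (2 * M)"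
    using r by (rule mult_left_mono)
  then show "\<bar>r * (\<integral>y. \<phi> (x, v + y, t) - \<phi> (x, v, t) \<partial>\<kappa>)\<bar> \<le> 2 * r * M"
    using r by (simp add: abs_mult mult_ac)
qed

text \<open>Two difficulties. The scheme takes the jump term at the end of a step and the equation
  at any time within it, while the available Lipschitz constants in time grow with the rates
  \<open>r n\<close>; the comparison therefore goes through one fixed index \<open>m\<close>. And
  the drift is unbounded, so Taylor errors are controlled only locally; far out, a point cannot
  reach the support of \<open>\<phi>\<close> in one step.\<close>

lemma scheme_consistent:
  fixes \<phi> :: "'a::euclidean_space \<times> 'a \<times> real \<Rightarrow> real" and \<kappa> :: "nat \<Rightarrow> 'a measure"
  assumes \<phi>: "csmooth \<phi>"
    and \<kappa>: "\<And>n. prob_space (\<kappa> n)" "\<And>n. sets (\<kappa> n) = sets borel" and r: "\<And>n. 0 \<le> r n"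
    and appr: "\<And>e. 0 < e \<Longrightarrow> \<forall>\<^sub>F n in sequentially. \<forall>x v t.
       \<bar>r n * (\<integral>y. \<phi> (x, v + y, t) - \<phi> (x, v, t) \<partial>\<kappa> n) + frac_lap s (\<lambda>w. \<phi> (x, w, t)) v\<bar> \<le> e"
    and B: "0 \<le> B" "\<And>z. norm (b z) \<le> B * (1 + norm z)"
    and h: "\<And>n. 0 < h n" "h \<longlonglongrightarrow> 0" and e: "0 < e"
  shows "\<forall>\<^sub>F n in sequentially. \<forall>t0 t x v. t0 \<le> t \<longrightarrow> t \<le> t0 + h n \<longrightarrow>
     \<bar>scheme_incr b (\<kappa> n) (r n) (h n) (\<lambda>p. \<phi> (fst (fst p), snd (fst p), snd p)) t0 (x, v)
       - h n * (ddir \<phi> (x, v, t) (fst (b (x, v)), snd (b (x, v)), 1) - frac_lap s (\<lambda>w. \<phi> (x, w, t)) v)\<bar> \<le> h n * e"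
proof -
  have sm: "smooth_fun \<phi>" using \<phi> by (simp add: csmooth_def)
  note cont = smooth_fun_continuous[OF sm]
  obtain M where M: "\<And>p. \<bar>\<phi> p\<bar> \<le> M" using csmooth_bounded[OF \<phi>] by blast
  obtain C1 where C1: "0 \<le> C1" "\<And>p p' q. \<bar>ddir \<phi> p q - ddir \<phi> p' q\<bar> \<le> C1 * norm q * norm (p - p')"
    using csmooth_ddir_lipschitz[OF \<phi>] by blast
  obtain C2 where C2: "0 \<le> C2" "\<And>p q. \<bar>\<phi> p - \<phi> q\<bar> \<le> C2 * norm (p - q)"
    using csmooth_lipschitz[OF \<phi>] by blast
  obtain R where R: "0 < R" "\<And>p. R < norm p \<Longrightarrow> \<phi> p = 0" "\<And>p q. R < norm p \<Longrightarrow> ddir \<phi> p q = 0"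
    using csmooth_support[OF \<phi>] by blast
  let ?A = "\<lambda>n x v t. r n * (\<integral>y. \<phi> (x, v + y, t) - \<phi> (x, v, t) \<partial>\<kappa> n)"
  let ?L = "\<lambda>x v t. frac_lap s (\<lambda>w. \<phi> (x, w, t)) v"
  have e4: "0 < e / 4" using e by simp
  \<comment> \<open>Frozen index: its jump term is within \<open>e / 4\<close> of the fractional
    Laplacian up to sign, at all points and times, and is Lipschitz in time with a constant
    independent of \<open>n\<close>.\<close>
  obtain m where m: "\<And>x v t. \<bar>?A m x v t + ?L x v t\<bar> \<le> e / 4"
    using eventually_happens'[OF sequentially_bot appr[OF e4]] by blast
  \<comment> \<open>Bound of the drift on the ball of radius \<open>2 * R + 1\<close>, where
    \<open>R\<close> encloses the support of \<open>\<phi>\<close>.\<close>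
  define \<beta> where "\<beta> = B * (1 + (2 * R + 1))"
  have \<beta>: "0 \<le> \<beta>" using B R by (simp add: \<beta>_def)
  define Q where "Q = C1 + C1 * \<beta> * (2 * \<beta> + 1) + 2 * r m * C2"
  have "(\<lambda>n. Q * h n) \<longlonglongrightarrow> Q * 0" "(\<lambda>n. (8 * B) * h n) \<longlonglongrightarrow> (8 * B) * 0"
    by (intro tendsto_intros h)+
  then have "\<forall>\<^sub>F n in sequentially. Q * h n < e / 4" "\<forall>\<^sub>F n in sequentially. (8 * B) * h n < 1"
    using e by (auto intro!: order_tendstoD(2)[of _ 0])
  with appr[OF e4] show ?thesis
  proof eventually_elim
    case (elim n)
    define k where "k = h n"
    have k: "0 < k" "Q * k < e / 4" "8 * B * k < 1" using h(1) elim by (auto simp: k_def)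
    show ?case
    proof (intro allI impI)
      fix t0 t :: real and x v :: 'a
      assume t: "t0 \<le> t" "t \<le> t0 + h n"
      define z where "z = (x, v)"
      define w where "w = b z"
      have T1: "\<bar>(\<phi> (x, v, t0 + k) - \<phi> (x, v, t0)) - k * ddir \<phi> (x, v, t) (0, 0, 1)\<bar> \<le> k * (C1 * k)"
      proof -
        obtain \<theta> where \<theta>: "0 < \<theta>" "\<theta> < 1"
          "\<phi> ((x, v, t0) + (0, 0, k)) - \<phi> (x, v, t0) = ddir \<phi> ((x, v, t0) + \<theta> *\<^sub>R (0, 0, k)) (0, 0, k)"
          using smooth_fun_mvt[OF sm] by blast
        have "ddir \<phi> p (0, 0, k) = k * ddir \<phi> p (0, 0, 1)" for p
          using linear_cmul[OF linear_ddir[OF sm], of p k "(0, 0, 1)"] by simp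
        then have eq: "(\<phi> (x, v, t0 + k) - \<phi> (x, v, t0)) - k * ddir \<phi> (x, v, t) (0, 0, 1)
            = k * (ddir \<phi> (x, v, t0 + \<theta> * k) (0, 0, 1) - ddir \<phi> (x, v, t) (0, 0, 1))"
          using \<theta>(3) by (simp add: right_diff_distrib)
        have "\<theta> * k \<le> k" "0 \<le> \<theta> * k" using \<theta> k by auto
        then have "\<bar>t0 + \<theta> * k - t\<bar> \<le> k" using t by (auto simp: k_def abs_le_iff)
        then have "C1 * norm (0 :: 'a, 0 :: 'a, 1 :: real) * norm ((x, v, t0 + \<theta> * k) - (x, v, t)) \<le> C1 * k"
          using C1 by (simp add: norm_Pair mult_left_mono)
        with C1(2) have "\<bar>ddir \<phi> (x, v, t0 + \<theta> * k) (0, 0, 1) - ddir \<phi> (x, v, t) (0, 0, 1)\<bar> \<le> C1 * k"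
          by (rule order.trans)
        then show ?thesis unfolding eq using k by (simp add: abs_mult)
      qed
      let ?q = "(fst w, snd w, 0 :: real)"
      \<comment> \<open>Displacement for time \<open>2 * k\<close> with weight 1/2 gives
        \<open>k\<close> times the derivative. In the error, \<open>2 * \<beta>\<close> stems from
        the displaced point and 1 from the time shift.\<close>
      have T2: "\<bar>1/2 * (\<phi> (x + (2 * k) *\<^sub>R fst w, v + (2 * k) *\<^sub>R snd w, t0 + k) - \<phi> (x, v, t0 + k)) - k * ddir \<phi> (x, v, t) ?q\<bar>
          \<le> k * (C1 * \<beta> * (2 * \<beta> + 1) * k)"
      proof (cases "norm z \<le> 2 * R + 1")
        case True
        have w: "norm w \<le> \<beta>"
          using B(2)[of z] mult_left_mono[of "1 + norm z" "1 + (2 * R + 1)" B] True B(1) by (simp add: w_def \<beta>_def)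
        have nq: "norm ?q = norm w" by (cases w) (simp add: norm_Pair)
        obtain \<theta> where \<theta>: "0 < \<theta>" "\<theta> < 1"
          "\<phi> ((x, v, t0 + k) + (2 * k) *\<^sub>R ?q) - \<phi> (x, v, t0 + k) = ddir \<phi> ((x, v, t0 + k) + \<theta> *\<^sub>R (2 * k) *\<^sub>R ?q) ((2 * k) *\<^sub>R ?q)"
          using smooth_fun_mvt[OF sm] by blast
        let ?p = "(x, v, t0 + k) + \<theta> *\<^sub>R (2 * k) *\<^sub>R ?q"
        have eq: "1/2 * (\<phi> (x + (2 * k) *\<^sub>R fst w, v + (2 * k) *\<^sub>R snd w, t0 + k) - \<phi> (x, v, t0 + k)) - k * ddir \<phi> (x, v, t) ?q
            = k * (ddir \<phi> ?p ?q - ddir \<phi> (x, v, t) ?q)"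
          using \<theta>(3) linear_cmul[OF linear_ddir[OF sm], of ?p "2 * k" ?q] by (simp add: right_diff_distrib)
        have "?p - (x, v, t) = (\<theta> * (2 * k)) *\<^sub>R ?q + (0, 0, t0 + k - t)" by simp
        then have "norm (?p - (x, v, t)) \<le> norm ((\<theta> * (2 * k)) *\<^sub>R ?q) + norm (0 :: 'a, 0 :: 'a, t0 + k - t)"
          by (metis norm_triangle_ineq)
        also have "\<dots> \<le> 2 * k * \<beta> + k"
        proof (rule add_mono)
          have "norm ((\<theta> * (2 * k)) *\<^sub>R ?q) = \<bar>\<theta> * (2 * k)\<bar> * norm w" by (simp only: norm_scaleR nq)
          also have "\<dots> = \<theta> * (2 * k) * norm w" using \<theta> k by simp
          also have "\<dots> \<le> 1 * (2 * k) * \<beta>" using \<theta> k w \<beta> by (intro mult_mono) auto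
          finally show "norm ((\<theta> * (2 * k)) *\<^sub>R ?q) \<le> 2 * k * \<beta>" by simp
          show "norm (0 :: 'a, 0 :: 'a, t0 + k - t) \<le> k" using t by (simp add: norm_Pair k_def)
        qed
        finally have np: "norm (?p - (x, v, t)) \<le> 2 * k * \<beta> + k" .
        have "\<bar>ddir \<phi> ?p ?q - ddir \<phi> (x, v, t) ?q\<bar> \<le> C1 * norm ?q * norm (?p - (x, v, t))" by (rule C1)
        also have "\<dots> \<le> C1 * \<beta> * (2 * k * \<beta> + k)"
          using np w nq C1 \<beta> by (intro mult_mono) auto
        also have "\<dots> = C1 * \<beta> * (2 * \<beta> + 1) * k" by (simp add: algebra_simps)
        finally show ?thesis unfolding eq using k by (simp add: abs_mult)
      next
        case False
        then have z: "2 * R + 1 < norm z" by simp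
        have nz: "norm z \<le> norm (x, v, \<tau>)" for \<tau> :: real
          by (simp add: z_def norm_Pair)
        have nz': "norm q \<le> norm (fst q, snd q, \<tau>)" for \<tau> :: real and q :: "'a \<times> 'a"
          by (cases q) (simp add: norm_Pair)
        have "norm ((2 * k) *\<^sub>R w) \<le> 2 * k * (B * (1 + norm z))"
          using k B(2)[of z] by (simp add: w_def)
        also have "\<dots> = (8 * B * k) * ((1 + norm z) / 4)" by simp
        \<comment> \<open>The displacement is at most a quarter of \<open>1 + norm z\<close>;
          starting from a norm above \<open>2 * R + 1\<close>, this leaves a norm above
          \<open>R\<close>.\<close>
        also have "\<dots> \<le> 1 * ((1 + norm z) / 4)"
          using k by (intro mult_right_mono) auto
        finally have "norm z - (1 + norm z) / 4 \<le> norm z - norm ((2 * k) *\<^sub>R w)" by simp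
        also have "\<dots> \<le> norm (z + (2 * k) *\<^sub>R w)"
          using norm_diff_ineq[of z "(2 * k) *\<^sub>R w"] by simp
        finally have "R < norm (z + (2 * k) *\<^sub>R w)" using z R(1) by (simp add: field_simps)
        also have "\<dots> \<le> norm (x + (2 * k) *\<^sub>R fst w, v + (2 * k) *\<^sub>R snd w, t0 + k)"
          using nz'[of "z + (2 * k) *\<^sub>R w" "t0 + k"] by (simp add: z_def)
        finally have "\<phi> (x + (2 * k) *\<^sub>R fst w, v + (2 * k) *\<^sub>R snd w, t0 + k) = 0" by (rule R)
        moreover have "R < norm (x, v, \<tau>)" for \<tau> :: real using nz[of \<tau>] z R(1) by simp
        ultimately show ?thesis using R(2,3) C1 \<beta> k by simp
      qed
      have T3: "\<bar>?A n x v (t0 + k) + ?L x v t\<bar> \<le> 3 * (e / 4) + 2 * r m * C2 * k"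
      proof -
        have "\<bar>?A m x v (t0 + k) - ?A m x v t\<bar> \<le> 2 * r m * C2 * \<bar>t0 + k - t\<bar>"
          by (rule jump_average_lipschitz_time(2)[OF \<kappa> cont M C2(2) r])
        also have "\<dots> \<le> 2 * r m * C2 * k"
          using r C2 t by (intro mult_left_mono) (auto simp: k_def)
        finally show ?thesis
          using elim(1)[rule_format, of x v "t0 + k"] m[of x v t] m[of x v "t0 + k"] unfolding k_def by linarith
      qed
      interpret \<kappa>: prob_space "\<kappa> n" by (rule \<kappa>)
      have i: "integrable (\<kappa> n) (\<lambda>y. \<phi> (x, v + y, t0 + k))"
        by (rule jump_average_lipschitz_time(1)[OF \<kappa> cont M C2(2) r[of n]])
      have incr: "scheme_incr b (\<kappa> n) (r n) (h n) (\<lambda>p. \<phi> (fst (fst p), snd (fst p), snd p)) t0 (x, v)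
        = (\<phi> (x, v, t0 + k) - \<phi> (x, v, t0))
          + 1/2 * (\<phi> (x + (2 * k) *\<^sub>R fst w, v + (2 * k) *\<^sub>R snd w, t0 + k) - \<phi> (x, v, t0 + k)) + k * ?A n x v (t0 + k)"
        unfolding scheme_incr_def k_def[symmetric] using i
        by (simp add: w_def z_def \<kappa>.prob_space)
      have dd: "ddir \<phi> (x, v, t) (fst w, snd w, 1) = ddir \<phi> (x, v, t) (0, 0, 1) + ddir \<phi> (x, v, t) ?q"
        using linear_add[OF linear_ddir[OF sm], of "(x, v, t)" "(0, 0, 1)" ?q] by simp
      have T3': "\<bar>k * ?A n x v (t0 + k) + k * ?L x v t\<bar> \<le> k * (3 * (e / 4) + 2 * r m * C2 * k)"
        using mult_left_mono[OF T3, of k] k by (simp add: abs_mult distrib_left[symmetric])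
      have "\<bar>scheme_incr b (\<kappa> n) (r n) (h n) (\<lambda>p. \<phi> (fst (fst p), snd (fst p), snd p)) t0 (x, v)
         - k * (ddir \<phi> (x, v, t) (fst w, snd w, 1) - ?L x v t)\<bar>
         \<le> k * (C1 * k) + k * (C1 * \<beta> * (2 * \<beta> + 1) * k) + k * (3 * (e / 4) + 2 * r m * C2 * k)"
        using T1 T2 T3' unfolding incr dd distrib_left right_diff_distrib by linarith
      also have "\<dots> = k * (Q * k + 3 * (e / 4))" by (simp add: Q_def algebra_simps)
      also have "\<dots> \<le> k * e" using k by (intro mult_left_mono) auto
      finally show "\<bar>scheme_incr b (\<kappa> n) (r n) (h n) (\<lambda>p. \<phi> (fst (fst p), snd (fst p), snd p)) t0 (x, v)
         - h n * (ddir \<phi> (x, v, t) (fst (b (x, v)), snd (b (x, v)), 1) - ?L x v t)\<bar> \<le> h n * e"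
        by (simp add: k_def w_def z_def)
    qed
  qed
qed

text \<open>Up to sign the fractional Laplacian is a uniform limit of jump terms, which are
  measurable in the parameters as integrals of jointly measurable functions and are bounded for each
  \<open>n\<close>. Both properties thus follow for all \<open>s\<close> at once, without returning
  to the singular integral.\<close>

lemma frac_lap_measurable_bounded:
  fixes \<phi> :: "'a::euclidean_space \<times> 'a \<times> real \<Rightarrow> real" and \<kappa> :: "nat \<Rightarrow> 'a measure"
  assumes \<phi>: "csmooth \<phi>"
    and \<kappa>: "\<And>n. prob_space (\<kappa> n)" "\<And>n. sets (\<kappa> n) = sets borel" and r: "\<And>n. 0 \<le> r n"
    and appr: "\<And>e. 0 < e \<Longrightarrow> \<forall>\<^sub>F n in sequentially. \<forall>x v t.
       \<bar>r n * (\<integral>y. \<phi> (x, v + y, t) - \<phi> (x, v, t) \<partial>\<kappa> n) + frac_lap s (\<lambda>w. \<phi> (x, w, t)) v\<bar> \<le> e"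
  shows "(\<lambda>(x, v, t). frac_lap s (\<lambda>w. \<phi> (x, w, t)) v) \<in> borel_measurable borel"
    and "\<exists>C. \<forall>x v t. \<bar>frac_lap s (\<lambda>w. \<phi> (x, w, t)) v\<bar> \<le> C"
proof -
  have sm: "smooth_fun \<phi>" using \<phi> by (simp add: csmooth_def)
  note cont = smooth_fun_continuous[OF sm]
  obtain M where M: "\<And>p. \<bar>\<phi> p\<bar> \<le> M" using csmooth_bounded[OF \<phi>] by blast
  obtain C2 where C2: "0 \<le> C2" "\<And>p q. \<bar>\<phi> p - \<phi> q\<bar> \<le> C2 * norm (p - q)"
    using csmooth_lipschitz[OF \<phi>] by blast
  let ?A = "\<lambda>n x v t. r n * (\<integral>y. \<phi> (x, v + y, t) - \<phi> (x, v, t) \<partial>\<kappa> n)"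
  have "(\<lambda>p. - ?A n (fst p) (fst (snd p)) (snd (snd p))) \<in> borel_measurable borel" for n
  proof -
    interpret \<kappa>: prob_space "\<kappa> n" by (rule \<kappa>)
    have "(\<lambda>(p, y). \<phi> (fst p, fst (snd p) + y, snd (snd p)) - \<phi> (fst p, fst (snd p), snd (snd p)))
        \<in> borel_measurable (borel :: (('a \<times> 'a \<times> real) \<times> 'a) measure)"
      unfolding case_prod_beta'
      by (intro borel_measurable_continuous_onI continuous_on_diff continuous_on_compose2[OF cont] continuous_intros) auto
    then have "(\<lambda>(p, y). \<phi> (fst p, fst (snd p) + y, snd (snd p)) - \<phi> (fst p, fst (snd p), snd (snd p)))
        \<in> borel_measurable ((borel :: ('a \<times> 'a \<times> real) measure) \<Otimes>\<^sub>M \<kappa> n)"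
      unfolding borel_prod[symmetric, where 'a = "'a \<times> 'a \<times> real" and 'b = 'a]
      by (subst measurable_cong_sets[OF sets_pair_measure_cong[OF refl \<kappa>(2)] refl])
    then have "(\<lambda>p. \<integral>y. \<phi> (fst p, fst (snd p) + y, snd (snd p)) - \<phi> (fst p, fst (snd p), snd (snd p)) \<partial>\<kappa> n) \<in> borel_measurable borel"
      by (rule \<kappa>.borel_measurable_lebesgue_integral)
    then show ?thesis by simp
  qed
  moreover have "(\<lambda>n. - ?A n (fst p) (fst (snd p)) (snd (snd p))) \<longlonglongrightarrow> (case p of (x, v, t) \<Rightarrow> frac_lap s (\<lambda>w. \<phi> (x, w, t)) v)" for p
  proof (cases p)
    case (fields x v t)
    have "(\<lambda>n. - ?A n x v t) \<longlonglongrightarrow> frac_lap s (\<lambda>w. \<phi> (x, w, t)) v"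
    proof (rule tendstoI)
      fix e :: real assume "0 < e"
      then have "0 < e / 2" by simp
      from appr[OF this] show "\<forall>\<^sub>F n in sequentially. dist (- ?A n x v t) (frac_lap s (\<lambda>w. \<phi> (x, w, t)) v) < e"
      proof eventually_elim
        case (elim n)
        have "\<bar>?A n x v t + frac_lap s (\<lambda>w. \<phi> (x, w, t)) v\<bar> \<le> e / 2" using elim by blast
        then show ?case using \<open>0 < e\<close> unfolding dist_real_def by linarith
      qed
    qed
    then show ?thesis by (simp add: fields)
  qed
  ultimately show "(\<lambda>(x, v, t). frac_lap s (\<lambda>w. \<phi> (x, w, t)) v) \<in> borel_measurable borel"
    by (rule borel_measurable_LIMSEQ_real[rotated])
  obtain m where m: "\<And>x v t. \<bar>?A m x v t + frac_lap s (\<lambda>w. \<phi> (x, w, t)) v\<bar> \<le> 1"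
    using eventually_happens'[OF sequentially_bot appr[of 1]] by auto
  have "\<bar>frac_lap s (\<lambda>w. \<phi> (x, w, t)) v\<bar> \<le> 1 + 2 * r m * M" for x v t
  proof -
    have "\<bar>?A m x v t\<bar> \<le> 2 * r m * M"
      by (rule jump_average_lipschitz_time(3)[OF \<kappa> cont M C2(2) r])
    then show ?thesis using m[of x v t] by linarith
  qed
  then show "\<exists>C. \<forall>x v t. \<bar>frac_lap s (\<lambda>w. \<phi> (x, w, t)) v\<bar> \<le> C" by blast
qed

lemma jump_data:
  fixes s :: real
  assumes s: "0 < s" "s \<le> 1"
  obtains \<kappa> :: "nat \<Rightarrow> 'a::euclidean_space measure" and r :: "nat \<Rightarrow> real" and C :: real where
    "\<And>n. prob_space (\<kappa> n)" "\<And>n. sets (\<kappa> n) = sets borel" "\<And>n. distr (\<kappa> n) borel uminus = \<kappa> n"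
    "\<And>n. 0 \<le> r n" "0 \<le> C" "\<And>n. ennreal (r n) * (\<integral>\<^sup>+y. ennreal (logw y) \<partial>\<kappa> n) \<le> ennreal C"
    "\<And>\<phi> e. csmooth \<phi> \<Longrightarrow> 0 < e \<Longrightarrow> \<forall>\<^sub>F n in sequentially. \<forall>(x :: 'a) v (t :: real).
       \<bar>r n * (\<integral>y. \<phi> (x, v + y, t) - \<phi> (x, v, t) \<partial>\<kappa> n) + frac_lap s (\<lambda>w. \<phi> (x, w, t)) v\<bar> \<le> e"
proof (cases "s = 1")
  case True
  show thesis
  proof (rule jump_data_laplacian[where 'a = 'a], goal_cases)
    case (1 \<kappa> r C)
    show ?case by (rule that[OF 1(1-6)]) (use True 1(7) in simp_all)
  qed
next
  case False
  with s have "s < 1" by simp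
  show thesis
  proof (rule jump_data_fractional[OF s(1) \<open>s < 1\<close>, where 'a = 'a], goal_cases)
    case (1 \<kappa> r C)
    show ?case by (rule that[OF 1])
  qed
qed

text \<open>The chain lives on phase space with time appended, whereas the solution takes
  \<open>(x, v, t)\<close>; this map changes the nesting.\<close>

definition reassoc :: "('a \<times> 'a) \<times> real \<Rightarrow> 'a \<times> 'a \<times> real" where
  "reassoc p = (fst (fst p), snd (fst p), snd p)"

lemma borel_measurable_reassoc [measurable]:
  "reassoc \<in> borel_measurable (borel :: (('a::euclidean_space \<times> 'a) \<times> real) measure)"
  unfolding reassoc_def[abs_def] by (intro borel_measurable_continuous_onI continuous_intros)

text \<open>The measure of a set is an iterated integral of its indicator, and both nestings lead to
  the same triple integral.\<close>

lemma distr_reassoc_lborel: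
  "distr lborel borel reassoc = (lborel :: ('a::euclidean_space \<times> 'a \<times> real) measure)"
proof (rule measure_eqI)
  fix A :: "('a \<times> 'a \<times> real) set"
  assume "A \<in> sets (distr lborel borel reassoc)"
  then have A: "A \<in> sets borel" by simp
  have A2: "A \<in> sets ((borel :: 'a measure) \<Otimes>\<^sub>M (borel :: ('a \<times> real) measure))"
    by (subst borel_prod) (rule A)
  have A3 [measurable]: "A \<in> sets ((borel :: 'a measure) \<Otimes>\<^sub>M ((borel :: 'a measure) \<Otimes>\<^sub>M (borel :: real measure)))"
    by (subst borel_prod[where 'a = 'a and 'b = real]) (rule A2)
  have rm: "reassoc -` A \<in> sets borel"
    using measurable_sets[OF borel_measurable_reassoc A] by simp
  have rm2 [measurable]: "reassoc -` A \<in> sets ((borel :: ('a \<times> 'a) measure) \<Otimes>\<^sub>M (borel :: real measure))"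
    by (subst borel_prod) (rule rm)
  have "emeasure (distr lborel borel reassoc) A = emeasure lborel (reassoc -` A)"
    using A by (subst emeasure_distr) auto
  also have "\<dots> = (\<integral>\<^sup>+p. indicator (reassoc -` A) p \<partial>(lborel \<Otimes>\<^sub>M lborel))"
    using rm by (simp add: lborel_prod)
  also have "\<dots> = (\<integral>\<^sup>+z. (\<integral>\<^sup>+t. indicator (reassoc -` A) (z, t) \<partial>lborel) \<partial>lborel)"
    by (rule lborel.nn_integral_fst[symmetric]) simp
  also have "\<dots> = (\<integral>\<^sup>+z. (\<integral>\<^sup>+t. indicator A (fst z, snd z, t) \<partial>lborel) \<partial>lborel)"
    by (intro nn_integral_cong) (auto simp: indicator_def reassoc_def)
  also have "\<dots> = (\<integral>\<^sup>+z. (\<integral>\<^sup>+t. indicator A (fst z, snd z, t) \<partial>lborel) \<partial>(lborel \<Otimes>\<^sub>M lborel))"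
    by (simp add: lborel_prod)
  also have "\<dots> = (\<integral>\<^sup>+x. (\<integral>\<^sup>+v. (\<integral>\<^sup>+t. indicator A (x, v, t) \<partial>lborel) \<partial>lborel) \<partial>lborel)"
    by (subst lborel.nn_integral_fst[symmetric]) simp_all
  also have "\<dots> = (\<integral>\<^sup>+x. (\<integral>\<^sup>+q. indicator A (x, q) \<partial>(lborel \<Otimes>\<^sub>M lborel)) \<partial>lborel)"
    by (intro nn_integral_cong lborel.nn_integral_fst) measurable
  also have "\<dots> = (\<integral>\<^sup>+x. (\<integral>\<^sup>+q. indicator A (x, q) \<partial>lborel) \<partial>lborel)"
    by (simp add: lborel_prod)
  also have "\<dots> = (\<integral>\<^sup>+p. indicator A p \<partial>(lborel \<Otimes>\<^sub>M lborel))"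
    using A2 by (intro lborel.nn_integral_fst) simp
  also have "\<dots> = emeasure lborel A"
    using A by (simp add: lborel_prod)
  finally show "emeasure (distr lborel borel reassoc) A = emeasure lborel A" .
qed simp

lemma integral_reassoc:
  fixes f :: "'a::euclidean_space \<times> 'a \<times> real \<Rightarrow> real"
  assumes "f \<in> borel_measurable borel"
  shows "integrable lborel f \<longleftrightarrow> integrable lborel (\<lambda>p. f (reassoc p))"
    and "integral\<^sup>L lborel f = (\<integral>p. f (reassoc p) \<partial>lborel)"
proof -
  have m: "reassoc \<in> borel_measurable (lborel :: (('a \<times> 'a) \<times> real) measure)" by simp
  show "integrable lborel f \<longleftrightarrow> integrable lborel (\<lambda>p. f (reassoc p))"
    using integrable_distr_eq[OF m assms] by (simp add: distr_reassoc_lborel)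
  show "integral\<^sup>L lborel f = (\<integral>p. f (reassoc p) \<partial>lborel)"
    using integral_distr[OF m assms] by (simp add: distr_reassoc_lborel)
qed

text \<open>Both functions of \<open>t\<close> are densities of the time marginal, and densities
  with respect to Lebesgue measure are unique almost everywhere. With extended non-negative
  integrals no integrability of the single slices has to be known beforehand.\<close>

lemma time_slices_AE:
  fixes D :: "'e::euclidean_space \<times> real \<Rightarrow> real"
  assumes D: "D \<in> borel_measurable borel" "\<And>p. 0 \<le> D p" "integrable lborel D" and T: "0 < T"
    and marg: "\<And>J. J \<in> sets borel \<Longrightarrow> (\<integral>p. D p * indicator (UNIV \<times> J) p \<partial>lborel) = measure lborel (J \<inter> {0<..<T}) / T"
  shows "AE t in lborel. (\<integral>\<^sup>+z. ennreal (D (z, t)) \<partial>lborel) = ennreal (indicator {0<..<T} t / T)"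
proof -
  have [measurable]: "D \<in> borel_measurable (borel \<Otimes>\<^sub>M borel)" using D(1) by (simp add: borel_prod)
  let ?G = "\<lambda>t. \<integral>\<^sup>+z. ennreal (D (z, t)) \<partial>lborel"
  have "density lborel ?G = density lborel (\<lambda>t. ennreal (indicator {0<..<T} t / T))"
  proof (rule measure_eqI)
    fix J :: "real set" assume "J \<in> sets (density lborel ?G)"
    then have [measurable]: "J \<in> sets borel" by simp
    have UJ: "UNIV \<times> J \<in> sets (borel :: ('e \<times> real) measure)" by (intro borel_Times) auto
    have "emeasure (density lborel ?G) J = (\<integral>\<^sup>+t. ?G t * indicator J t \<partial>lborel)"
      by (rule emeasure_density) measurable
    also have "\<dots> = (\<integral>\<^sup>+t. (\<integral>\<^sup>+z. ennreal (D (z, t) * indicator (UNIV \<times> J) (z, t)) \<partial>lborel) \<partial>lborel)"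
      by (intro nn_integral_cong) (auto simp: indicator_def)
    also have "\<dots> = (\<integral>\<^sup>+p. ennreal (D p * indicator (UNIV \<times> J) p) \<partial>(lborel \<Otimes>\<^sub>M lborel))"
      by (rule lborel_pair.nn_integral_snd) measurable
    also have "\<dots> = (\<integral>\<^sup>+p. ennreal (D p * indicator (UNIV \<times> J) p) \<partial>lborel)"
      by (simp add: lborel_prod)
    also have "\<dots> = ennreal (\<integral>p. D p * indicator (UNIV \<times> J) p \<partial>lborel)"
    proof (rule nn_integral_eq_integral)
      show "integrable lborel (\<lambda>p. D p * indicator (UNIV \<times> J) p)"
        using integrable_mult_indicator[of "UNIV \<times> J" lborel, OF _ D(3)] UJ by (simp add: mult.commute)
    qed (simp add: D)
    also have "\<dots> = ennreal (measure lborel (J \<inter> {0<..<T}) / T)" by (simp add: marg)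
    also have "\<dots> = ennreal (1 / T) * emeasure lborel (J \<inter> {0<..<T})"
    proof -
      have "emeasure lborel (J \<inter> {0<..<T}) \<le> emeasure lborel {0<..<T}" by (intro emeasure_mono) auto
      also have "\<dots> < \<infinity>" using T by simp
      finally have "emeasure lborel (J \<inter> {0<..<T}) = ennreal (measure lborel (J \<inter> {0<..<T}))"
        by (intro emeasure_eq_ennreal_measure) auto
      then show ?thesis using T by (simp add: ennreal_mult[symmetric])
    qed
    also have "\<dots> = (\<integral>\<^sup>+t. ennreal (1 / T) * indicator (J \<inter> {0<..<T}) t \<partial>lborel)"
      by (simp add: nn_integral_cmult_indicator)
    also have "\<dots> = (\<integral>\<^sup>+t. ennreal (indicator {0<..<T} t / T) * indicator J t \<partial>lborel)"
      by (intro nn_integral_cong) (auto simp: indicator_def)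
    also have "\<dots> = emeasure (density lborel (\<lambda>t. ennreal (indicator {0<..<T} t / T))) J"
      by (rule emeasure_density[symmetric]) measurable
    finally show "emeasure (density lborel ?G) J = emeasure (density lborel (\<lambda>t. ennreal (indicator {0<..<T} t / T))) J" .
  qed simp
  then show ?thesis
    by (intro sigma_finite_measure.density_unique[OF sigma_finite_lborel]) measurable
qed

text \<open>The cylinder over a null set of times is null, since infinity times 0 is 0 for
  measures.\<close>

lemma AE_lborel_snd:
  assumes "AE t in lborel. P t"
  shows "AE p in (lborel :: ('e::euclidean_space \<times> real) measure). P (snd p)"
proof -
  obtain N where N: "N \<in> null_sets lborel" "{t. \<not> P t} \<subseteq> N"
    using assms by (auto simp: eventually_ae_filter)
  have "UNIV \<times> N \<in> sets (borel :: ('e \<times> real) measure)"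
    using N by (intro borel_Times) auto
  moreover have "emeasure (lborel \<Otimes>\<^sub>M lborel) (UNIV \<times> N :: ('e \<times> real) set) = emeasure lborel (UNIV :: 'e set) * emeasure lborel N"
    using N by (intro lborel.emeasure_pair_measure_Times) auto
  ultimately have "UNIV \<times> N \<in> null_sets (lborel :: ('e \<times> real) measure)"
    using N by (simp add: null_sets_def lborel_prod)
  then show ?thesis
    by (rule AE_I') (use N in auto)
qed

section \<open>Test functions at the final time, a Borel version of the initial density, and the
  existence theorem\<close>

lemma test_fun_csmooth: "test_fun T \<phi> \<Longrightarrow> csmooth \<phi>"
  by (simp add: test_fun_def csmooth_def)

lemma test_fun_final_time:
  assumes "test_fun T \<phi>"
  shows "\<phi> (x, v, T) = 0"
proof (rule ccontr)
  assume "\<phi> (x, v, T) \<noteq> 0"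
  then have "(x, v, T) \<in> closure {p. \<phi> p \<noteq> 0}" using closure_subset[of "{p. \<phi> p \<noteq> 0}"] by auto
  with assms show False by (auto simp: test_fun_def)
qed

text \<open>The initial density is only Lebesgue measurable, while the chain lives on Borel sets.
  Taking the positive part of a Borel version changes nothing almost everywhere. The logarithmic
  moment is finite by the second moment and \<open>ln (1 + x) \<le> x\<close>.\<close>

lemma borel_density_of_P2a:
  fixes f0 :: "'a::euclidean_space \<times> 'a \<Rightarrow> real"
  assumes f0: "\<And>z. 0 \<le> f0 z" "P2a_density f0"
  obtains g0 where "g0 \<in> borel_measurable borel" "\<And>z. 0 \<le> g0 z" "AE z in lebesgue. f0 z = g0 z"
    "(\<integral>\<^sup>+z. ennreal (g0 z) \<partial>lborel) = 1" "(\<integral>\<^sup>+z. ennreal (logw z) * ennreal (g0 z) \<partial>lborel) < \<infinity>"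
proof -
  have P: "f0 \<in> borel_measurable lebesgue" "integrable lebesgue f0" "(\<integral>z. f0 z \<partial>lebesgue) = 1"
    "integrable lebesgue (\<lambda>z. (norm z)\<^sup>2 * f0 z)"
    using f0(2) by (auto simp: P2a_density_def)
  obtain g where g: "g \<in> borel_measurable lborel" "AE z in lborel. f0 z = g z"
    using completion_ex_borel_measurable_real[OF P(1)] by blast
  define g0 where "g0 z = max 0 (g z)" for z
  have [measurable]: "g0 \<in> borel_measurable borel" using g(1) by (simp add: g0_def[abs_def])
  have g0: "0 \<le> g0 z" for z by (simp add: g0_def)
  have AE: "AE z in lebesgue. f0 z = g0 z"
    using AE_completion[OF g(2)] by eventually_elim (use f0(1) in \<open>simp add: g0_def max_def; metis\<close>)
  have AE': "AE z in lebesgue. g0 z = f0 z" "AE z in lebesgue. (norm z)\<^sup>2 * g0 z = (norm z)\<^sup>2 * f0 z"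
    using AE by (eventually_elim, simp)+
  have m: "g0 \<in> borel_measurable lebesgue" "(\<lambda>z. (norm z)\<^sup>2 * g0 z) \<in> borel_measurable lebesgue"
    by (intro measurable_completion; measurable)+
  have "integrable lebesgue g0"
    using integrable_cong_AE[OF m(1) P(1) AE'(1)] P(2) by simp
  then have i: "integrable lborel g0" by (simp add: integrable_completion)
  have "(\<integral>z. g0 z \<partial>lborel) = (\<integral>z. g0 z \<partial>lebesgue)" by (simp add: integral_completion)
  also have "\<dots> = (\<integral>z. f0 z \<partial>lebesgue)"
    by (rule integral_cong_AE[OF m(1) P(1) AE'(1)])
  finally have 1: "(\<integral>z. g0 z \<partial>lborel) = 1" using P(3) by simp
  have "integrable lebesgue (\<lambda>z. (norm z)\<^sup>2 * g0 z)"
    using integrable_cong_AE[OF m(2) borel_measurable_integrable[OF P(4)] AE'(2)] P(4) by simp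
  then have i2: "integrable lborel (\<lambda>z. (norm z)\<^sup>2 * g0 z)" by (simp add: integrable_completion)
  show thesis
  proof (rule that[OF _ g0 AE])
    show "g0 \<in> borel_measurable borel" by measurable
    show "(\<integral>\<^sup>+z. ennreal (g0 z) \<partial>lborel) = 1"
      using nn_integral_eq_integral[OF i] g0 1 by simp
    have "(\<integral>\<^sup>+z. ennreal (logw z) * ennreal (g0 z) \<partial>lborel) \<le> (\<integral>\<^sup>+z. ennreal ((norm z)\<^sup>2 * g0 z) \<partial>lborel)"
    proof (rule nn_integral_mono)
      fix z :: "'a \<times> 'a"
      have "logw z \<le> (norm z)\<^sup>2" unfolding logw_def by (rule ln_add_one_self_le_self) simp
      then have "logw z * g0 z \<le> (norm z)\<^sup>2 * g0 z" using g0 by (rule mult_right_mono)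
      then show "ennreal (logw z) * ennreal (g0 z) \<le> ennreal ((norm z)\<^sup>2 * g0 z)"
        by (simp add: ennreal_mult[symmetric] logw_nonneg g0 ennreal_leI)
    qed
    also have "\<dots> = ennreal (\<integral>z. (norm z)\<^sup>2 * g0 z \<partial>lborel)"
      using i2 g0 by (intro nn_integral_eq_integral) auto
    also have "\<dots> < \<infinity>" by simp
    finally show "(\<integral>\<^sup>+z. ennreal (logw z) * ennreal (g0 z) \<partial>lborel) < \<infinity>" .
  qed
qed

theorem theorem1p3:
  fixes s T :: real
    and Psi :: "'a::euclidean_space \<Rightarrow> real"
    and gradPsi :: "'a \<Rightarrow> 'a"
    and f0 :: "'a \<times> 'a \<Rightarrow> real"
  assumes s: "0 < s" "s \<le> 1"
    and T: "T > 0"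
    and Psi_nonneg: "\<forall>v. Psi v \<ge> 0"
    and Psi_reg: "C11_C21 Psi gradPsi"
    and f0_nonneg: "\<forall>z. f0 z \<ge> 0"
    and f0_P2a: "P2a_density f0"
    and f0_Lp: "Lp_some f0"
    and f0_Psi: "integrable lebesgue (\<lambda>(x, v). f0 (x, v) * Psi v)"
  shows "\<exists>f :: 'a \<times> 'a \<times> real \<Rightarrow> real.
           f \<in> borel_measurable lebesgue
         \<and> (\<forall>t\<in>{0<..<T}. integrable lebesgue (\<lambda>(x, v). f (x, v, t))
                \<and> (\<integral>(x, v). f (x, v, t) \<partial>lebesgue) = (\<integral>z. f0 z \<partial>lebesgue)
                \<and> (\<integral>z. f0 z \<partial>lebesgue) = 1)
         \<and> (AE p in lebesgue. p \<in> UNIV \<times> UNIV \<times> {0<..<T} \<longrightarrow> f p \<ge> 0)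
         \<and> (\<forall>\<phi>. test_fun T \<phi> \<longrightarrow>
                set_integrable lebesgue (UNIV \<times> UNIV \<times> {0<..<T})
                   (\<lambda>p. f p * weak_op s gradPsi \<phi> p)
              \<and> (\<integral>p \<in> UNIV \<times> UNIV \<times> {0<..<T}. f p * weak_op s gradPsi \<phi> p \<partial>lebesgue)
                + (\<integral>(x, v). f0 (x, v) * \<phi> (x, v, 0) \<partial>lebesgue) = 0)"
proof -
  obtain L0 where L0: "L0-lipschitz_on UNIV gradPsi"
    using Psi_reg by (auto simp: C11_C21_def)
  define b :: "'a \<times> 'a \<Rightarrow> 'a \<times> 'a" where "b z = (snd z, - gradPsi (snd z))" for z
  \<comment> \<open>The position component \<open>v\<close> of the drift contributes 1, the
    component \<open>- gradPsi v\<close> contributes \<open>L0\<close>.\<close>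
  define L where "L = 1 + L0"
  define B where "B = norm (b 0) + L"
  have L00: "0 \<le> L0" using L0 by (rule lipschitz_on_nonneg)
  have L: "0 \<le> L" using L00 by (simp add: L_def)
  have Lip: "norm (b z - b w) \<le> L * norm (z - w)" for z w
  proof -
    have "norm (b z - b w) \<le> norm (snd z - snd w) + norm (- gradPsi (snd z) - - gradPsi (snd w))"
      unfolding b_def by (simp only: diff_Pair norm_Pair_le)
    also have "norm (- gradPsi (snd z) - - gradPsi (snd w)) \<le> L0 * norm (snd z - snd w)"
      using lipschitz_onD[OF L0, of "snd z" "snd w"] by (simp add: dist_norm norm_minus_commute)
    also have "norm (snd z - snd w) + L0 * norm (snd z - snd w) = L * norm (snd z - snd w)"
      by (simp add: L_def algebra_simps)
    also have "\<dots> \<le> L * norm (z - w)"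
      using L norm_snd_le[of "snd z - snd w" "fst z - fst w"] by (intro mult_left_mono) (auto simp: minus_prod_def)
    finally show ?thesis by simp
  qed
  have B: "0 \<le> B" using L by (simp add: B_def)
  have growth: "norm (b z) \<le> B * (1 + norm z)" for z
  proof -
    have "norm (b z) \<le> norm (b 0) + norm (b z - b 0)" by (metis norm_triangle_sub)
    also have "\<dots> \<le> norm (b 0) + L * norm z" using Lip[of z 0] by simp
    also have "\<dots> \<le> B * (1 + norm z)" using L by (simp add: B_def algebra_simps)
    finally show ?thesis .
  qed
  obtain g0 where g0: "g0 \<in> borel_measurable borel" "\<And>z. 0 \<le> g0 z"
    and f0g0: "AE z in lebesgue. f0 z = g0 z"
    and g0_int: "(\<integral>\<^sup>+z. ennreal (g0 z) \<partial>lborel) = 1" "(\<integral>\<^sup>+z. ennreal (logw z) * ennreal (g0 z) \<partial>lborel) < \<infinity>"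
    using borel_density_of_P2a[of f0] f0_nonneg f0_P2a by blast
  have f01: "(\<integral>z. f0 z \<partial>lebesgue) = 1" and f0m: "f0 \<in> borel_measurable lebesgue"
    using f0_P2a by (auto simp: P2a_density_def)
  obtain \<kappa> :: "nat \<Rightarrow> 'a measure" and r C where
    \<kappa>: "\<And>n. prob_space (\<kappa> n)" "\<And>n. sets (\<kappa> n) = sets borel" "\<And>n. distr (\<kappa> n) borel uminus = \<kappa> n"
    and r: "\<And>n. 0 \<le> r n" and C: "0 \<le> C" "\<And>n. ennreal (r n) * (\<integral>\<^sup>+y. ennreal (logw y) \<partial>\<kappa> n) \<le> ennreal C"
    and appr: "\<And>\<phi> e. csmooth \<phi> \<Longrightarrow> 0 < e \<Longrightarrow> \<forall>\<^sub>F n in sequentially. \<forall>(x :: 'a) v (t :: real).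
       \<bar>r n * (\<integral>y. \<phi> (x, v + y, t) - \<phi> (x, v, t) \<partial>\<kappa> n) + frac_lap s (\<lambda>w. \<phi> (x, w, t)) v\<bar> \<le> e"
  proof (rule jump_data[OF s, where 'a = 'a], goal_cases)
    case (1 \<kappa> r C)
    show ?case by (rule 1(1)[OF 1(2-)])
  qed
  \<comment> \<open>For the step \<open>T / N n\<close> the summands enforce, in turn, step at most
    1, step times \<open>r n\<close> at most 1/2, the bound with \<open>L\<close>, and convergence
    to 0.\<close>
  define N where "N n = Suc (nat \<lceil>T + 2 * T * r n + 4 * T * L + real n\<rceil>)" for n
  have N: "T + 2 * T * r n + 4 * T * L + real n \<le> real (N n)" for n
    unfolding N_def by linarith
  have N0: "0 < N n" for n by (simp add: N_def)
  have TN: "T \<le> real (N n)" "2 * T * r n \<le> real (N n)" "4 * T * L \<le> real (N n)" "real n \<le> real (N n)" for n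
    using N[of n] T r[of n] L mult_nonneg_nonneg[of T "r n"] mult_nonneg_nonneg[of T L] by linarith+
  have scheme: "drift_jump_scheme b (\<kappa> n) L B C (r n) (T / real (N n))" for n
  proof -
    have "0 < T / real (N n)" using T N0[of n] by simp
    moreover have "T / real (N n) \<le> 1" "T / real (N n) * r n \<le> 1 / 2" "4 * (T / real (N n) * L) \<le> 1"
      using TN[of n] N0[of n] by (simp_all add: field_simps)
    ultimately show ?thesis
      by (intro drift_jump_scheme.intro) (assumption | rule L Lip B growth \<kappa> C r)+
  qed
  have hlim: "(\<lambda>n. T / real (N n)) \<longlonglongrightarrow> 0"
  proof (rule tendsto_sandwich[of "\<lambda>_. 0" _ _ "\<lambda>n. T / real n"])
    show "\<forall>\<^sub>F n in sequentially. T / real (N n) \<le> T / real n"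
      using eventually_gt_at_top[of 0]
      by eventually_elim (use T TN(4) in \<open>intro divide_left_mono mult_pos_pos, auto simp: N0\<close>)
    show "(\<lambda>n. T / real n) \<longlonglongrightarrow> 0" by (rule lim_const_over_n)
  qed (use T in auto)
  obtain D :: "('a \<times> 'a) \<times> real \<Rightarrow> real" where D: "D \<in> borel_measurable borel" "\<And>p. 0 \<le> D p" "integrable lborel D"
    and marg: "\<And>J. J \<in> sets borel \<Longrightarrow> (\<integral>p. D p * indicator (UNIV \<times> J) p \<partial>lborel) = measure lborel (J \<inter> {0<..<T}) / T"
    and weak: "\<And>F \<phi> C C'. F \<in> borel_measurable borel \<Longrightarrow> (\<And>p. \<bar>F p\<bar> \<le> C) \<Longrightarrow> \<phi> \<in> borel_measurable borel \<Longrightarrow>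
       (\<And>p. \<bar>\<phi> p\<bar> \<le> C') \<Longrightarrow> (\<And>z. \<phi> (z, T) = 0) \<Longrightarrow>
       (\<And>d. 0 < d \<Longrightarrow> \<forall>\<^sub>F n in sequentially. \<forall>k z t. k < N n \<longrightarrow> real k * (T / N n) \<le> t \<longrightarrow> t \<le> real k * (T / N n) + T / N n \<longrightarrow>
          \<bar>scheme_incr b (\<kappa> n) (r n) (T / N n) \<phi> (real k * (T / N n)) z - (T / N n) * F (z, t)\<bar> \<le> (T / N n) * d) \<Longrightarrow>
       (\<integral>p. D p * F p \<partial>lborel) + (\<integral>z. g0 z * \<phi> (z, 0) \<partial>lborel) / T = 0"
  proof (rule kinetic_scheme_limit[where T = T and b = b and \<kappa> = \<kappa> and L = L and B = B and C = C and r = r and N = N and ?g0.0 = g0,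
      OF T scheme N0 g0 g0_int], goal_cases)
    case (1 D)
    show ?case by (rule 1(1)[OF 1(2-)])
  qed
  have Dpair [measurable]: "D \<in> borel_measurable ((borel :: ('a \<times> 'a) measure) \<Otimes>\<^sub>M (borel :: real measure))"
    using D(1) by (simp only: borel_prod)
  have slices: "AE t in lborel. (\<integral>\<^sup>+z. ennreal (D (z, t)) \<partial>lborel) = ennreal (indicator {0<..<T} t / T)"
    by (rule time_slices_AE[OF D T]) (rule marg)
  let ?G = "\<lambda>t. \<integral>\<^sup>+z. ennreal (D (z, t)) \<partial>lborel"
  \<comment> \<open>\<open>D\<close> has mass \<open>1 / T\<close> on almost every slice in (0, T),
    hence the factor \<open>T\<close>. The test selects the slices of exactly this mass; on all
    others \<open>g0\<close> supplies mass one, so the mass condition holds at every time and not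
    merely almost everywhere.\<close>
  define f where "f p = (case p of (x, v, t) \<Rightarrow> if ?G t = ennreal (1 / T) then T * D ((x, v), t) else g0 (x, v))" for p
  have ret: "(\<lambda>(x, v, t). ((x, v), t)) \<in> borel_measurable (borel :: ('a \<times> 'a \<times> real) measure)"
    unfolding case_prod_beta' by (intro borel_measurable_continuous_onI continuous_intros)
  define k where "k p = (if ?G (snd p) = ennreal (1 / T) then T * D p else g0 (fst p))" for p :: "('a \<times> 'a) \<times> real"
  note [measurable] = g0(1)
  have kp: "k \<in> borel_measurable ((borel :: ('a \<times> 'a) measure) \<Otimes>\<^sub>M (borel :: real measure))"
    unfolding k_def[abs_def] by measurable
  then have k: "k \<in> borel_measurable borel" by (simp only: borel_prod)
  have f_k: "f (reassoc p) = k p" for p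
    by (simp add: f_def k_def reassoc_def)
  have "f = k \<circ> (\<lambda>(x, v, t). ((x, v), t))" by (auto simp: f_def k_def fun_eq_iff)
  then have f: "f \<in> borel_measurable borel" using measurable_comp[OF ret k] by simp
  have f0': "0 \<le> f p" for p using T D(2) g0(2) by (auto simp: f_def split: prod.splits)
  \<comment> \<open>The time marginal has no mass outside (0, T), so \<open>D\<close> vanishes there
    almost everywhere; inside, the exceptional slices form a null set. Restricted to (0, T),
    \<open>k\<close> and \<open>T * D\<close> therefore have the same integrals.\<close>
  have kD: "AE p in lborel. indicator {0<..<T} (snd p) * k p = T * D p"
  proof -
    have "(\<integral>p. D p * indicator (UNIV \<times> (- {0<..<T})) p \<partial>lborel) = 0"
      by (subst marg) auto
    moreover have "UNIV \<times> (- {0<..<T}) \<in> sets (borel :: (('a \<times> 'a) \<times> real) measure)" by (intro borel_Times) auto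
    then have "integrable lborel (\<lambda>p. D p * indicator (UNIV \<times> (- {0<..<T})) p)"
      using integrable_mult_indicator[of "UNIV \<times> (- {0<..<T})" lborel, OF _ D(3)] by (simp add: mult.commute)
    ultimately have "AE p in lborel. D p * indicator (UNIV \<times> (- {0<..<T})) p = 0"
      using D(2) by (subst (asm) integral_nonneg_eq_0_iff_AE) auto
    with AE_lborel_snd[OF slices] show ?thesis
    proof eventually_elim
      case (elim p)
      show ?case
      proof (cases "snd p \<in> {0<..<T}")
        case True
        then have "?G (snd p) = ennreal (1 / T)" using elim(1) by simp
        then show ?thesis using True by (simp add: k_def)
      next
        case False
        then have "p \<in> UNIV \<times> (- {0<..<T})" by (cases p) auto
        then have "D p = 0" using elim(2) by simp
        then show ?thesis using False by simp
      qed
    qed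
  qed
  show ?thesis
  proof (intro exI[of _ f] conjI ballI allI impI)
    show "f \<in> borel_measurable lebesgue" using f by (intro measurable_completion) simp
    show "AE p in lebesgue. p \<in> UNIV \<times> UNIV \<times> {0<..<T} \<longrightarrow> 0 \<le> f p" using f0' by simp
    show "(\<integral>z. f0 z \<partial>lebesgue) = 1" by (rule f01)
  next
    fix t :: real assume "t \<in> {0<..<T}"
    have sl: "(\<lambda>(x, v). f (x, v, t)) = (\<lambda>z. k (z, t))" by (auto simp: f_def k_def fun_eq_iff)
    have km [measurable]: "(\<lambda>z. k (z, t)) \<in> borel_measurable borel" using kp by measurable
    have "(\<integral>\<^sup>+z. ennreal (k (z, t)) \<partial>lborel) = 1"
    proof (cases "?G t = ennreal (1 / T)")
      case True
      then have "(\<integral>\<^sup>+z. ennreal (k (z, t)) \<partial>lborel) = (\<integral>\<^sup>+z. ennreal T * ennreal (D (z, t)) \<partial>lborel)"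
        using T D(2) by (intro nn_integral_cong) (simp add: k_def ennreal_mult)
      also have "\<dots> = ennreal T * ?G t" by (rule nn_integral_cmult) measurable
      also have "\<dots> = ennreal (T * (1 / T))" unfolding True using T by (subst ennreal_mult) auto
      finally show ?thesis using T by simp
    qed (simp add: k_def g0_int)
    moreover have "0 \<le> k (z, t)" for z using f0'[of "reassoc (z, t)"] by (simp add: f_k)
    ultimately have "integrable lborel (\<lambda>z. k (z, t))" "(\<integral>z. k (z, t) \<partial>lborel) = 1"
      by (auto intro!: integrableI_nonneg simp: integral_eq_nn_integral)
    then show "integrable lebesgue (\<lambda>(x, v). f (x, v, t))" "(\<integral>(x, v). f (x, v, t) \<partial>lebesgue) = (\<integral>z. f0 z \<partial>lebesgue)"
      unfolding sl f01 by (simp_all add: integrable_completion integral_completion)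
  next
    fix \<phi> :: "'a \<times> 'a \<times> real \<Rightarrow> real" assume \<phi>: "test_fun T \<phi>"
    note cs = test_fun_csmooth[OF \<phi>]
    then have sm: "smooth_fun \<phi>" by (simp add: csmooth_def)
    have \<phi>m: "\<phi> \<in> borel_measurable borel" by (intro borel_measurable_continuous_onI smooth_fun_continuous sm)
    obtain M where M: "\<And>p. \<bar>\<phi> p\<bar> \<le> M" using csmooth_bounded[OF cs] by blast
    let ?W = "weak_op s gradPsi \<phi>"
    define F where "F p = ?W (reassoc p)" for p
    note fl = frac_lap_measurable_bounded[OF cs \<kappa>(1,2) r appr[OF cs]]
    obtain C1 where C1: "0 \<le> C1" "\<And>p q. \<bar>ddir \<phi> p q\<bar> \<le> C1 * norm q" using ddir_bounded[OF cs] by blast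
    obtain C2 where C2: "\<And>x v t. \<bar>frac_lap s (\<lambda>w. \<phi> (x, w, t)) v\<bar> \<le> C2" using fl(2) by blast
    obtain R where R: "0 < R" "\<And>p q. R < norm p \<Longrightarrow> ddir \<phi> p q = 0" using csmooth_support[OF cs] by metis
    have contG: "continuous_on UNIV gradPsi" using L0 by (rule lipschitz_on_continuous_on)
    have "continuous_on UNIV (partial c \<phi>)" if "c \<in> Basis" for c
      by (rule smooth_fun_continuous[OF smooth_fun_partial[OF sm that]])
    then have "continuous_on UNIV (\<lambda>p. ddir \<phi> p (fst (snd p), - gradPsi (fst (snd p)), 1))"
      unfolding ddir_def
      by (intro continuous_intros continuous_on_compose2[OF contG]) auto
    then have "(\<lambda>p. ddir \<phi> p (fst (snd p), - gradPsi (fst (snd p)), 1)) \<in> borel_measurable borel"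
      by (rule borel_measurable_continuous_onI)
    then have "(\<lambda>p. ddir \<phi> p (fst (snd p), - gradPsi (fst (snd p)), 1) - (case p of (x, v, t) \<Rightarrow> frac_lap s (\<lambda>w. \<phi> (x, w, t)) v)) \<in> borel_measurable borel"
      using fl(1) by (rule borel_measurable_diff)
    also have "(\<lambda>p. ddir \<phi> p (fst (snd p), - gradPsi (fst (snd p)), 1) - (case p of (x, v, t) \<Rightarrow> frac_lap s (\<lambda>w. \<phi> (x, w, t)) v)) = ?W"
      by (auto simp: fun_eq_iff weak_op_eq[OF sm])
    finally have Wm: "?W \<in> borel_measurable borel" .
    then have Fm: "F \<in> borel_measurable borel"
      unfolding F_def[abs_def] using borel_measurable_reassoc by (rule measurable_compose[rotated])
    \<comment> \<open>The derivative term vanishes outside the ball of radius \<open>R\<close>,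
      within which the linearly growing drift is bounded; the nonlocal term need not have compact
      support but is bounded by \<open>C2\<close>.\<close>
    have WC: "\<bar>?W p\<bar> \<le> C1 * (B * (1 + R) + 1) + C2" for p
    proof (cases p)
      case (fields x v t)
      have "\<bar>ddir \<phi> p (v, - gradPsi v, 1)\<bar> \<le> C1 * (B * (1 + R) + 1)"
      proof (cases "R < norm p")
        case True
        then show ?thesis using R C1 B by simp
      next
        case False
        have "norm (x, v) \<le> norm p" by (simp add: fields norm_Pair)
        then have "norm (b (x, v)) \<le> B * (1 + R)"
          using growth[of "(x, v)"] False B mult_left_mono[of "1 + norm (x, v)" "1 + R" B] by linarith
        moreover have "norm (v, - gradPsi v, 1 :: real) \<le> norm (b (x, v)) + 1"
        proof -
          have "(v, - gradPsi v, 1 :: real) = (v, - gradPsi v, 0) + (0, 0, 1)" by simp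
          then have "norm (v, - gradPsi v, 1 :: real) \<le> norm (v, - gradPsi v, 0 :: real) + norm (0 :: 'a, 0 :: 'a, 1 :: real)"
            by (metis norm_triangle_ineq)
          then show ?thesis by (simp add: b_def norm_Pair)
        qed
        ultimately have "C1 * norm (v, - gradPsi v, 1 :: real) \<le> C1 * (B * (1 + R) + 1)"
          using C1(1) by (intro mult_left_mono) auto
        with C1(2) show ?thesis by (rule order.trans)
      qed
      then show ?thesis using C2[of x t v] unfolding fields weak_op_eq[OF sm] by linarith
    qed
    define \<psi> where "\<psi> p = \<phi> (fst (fst p), snd (fst p), snd p)" for p :: "('a \<times> 'a) \<times> real"
    have \<psi>_eq: "\<psi> = (\<lambda>p. \<phi> (reassoc p))" by (simp add: \<psi>_def reassoc_def fun_eq_iff)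
    have main: "(\<integral>p. D p * F p \<partial>lborel) + (\<integral>z. g0 z * \<psi> (z, 0) \<partial>lborel) / T = 0"
    proof (rule weak[OF Fm])
      show "\<bar>F p\<bar> \<le> C1 * (B * (1 + R) + 1) + C2" for p unfolding F_def by (rule WC)
      show "\<psi> \<in> borel_measurable borel"
        unfolding \<psi>_eq using borel_measurable_reassoc \<phi>m by (rule measurable_compose)
      show "\<bar>\<psi> p\<bar> \<le> M" for p by (simp add: \<psi>_def M)
      show "\<psi> (z, T) = 0" for z by (simp add: \<psi>_def test_fun_final_time[OF \<phi>])
      fix d :: real assume d: "0 < d"
      have "\<forall>\<^sub>F n in sequentially. \<forall>t0 t x v. t0 \<le> t \<longrightarrow> t \<le> t0 + T / real (N n) \<longrightarrow>
         \<bar>scheme_incr b (\<kappa> n) (r n) (T / real (N n)) \<psi> t0 (x, v)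
          - T / real (N n) * (ddir \<phi> (x, v, t) (fst (b (x, v)), snd (b (x, v)), 1) - frac_lap s (\<lambda>w. \<phi> (x, w, t)) v)\<bar> \<le> T / real (N n) * d"
        unfolding \<psi>_def[abs_def]
        using T N0 by (intro scheme_consistent[OF cs \<kappa>(1,2) r appr[OF cs] B growth _ hlim d]) auto
      then show "\<forall>\<^sub>F n in sequentially. \<forall>k z t. k < N n \<longrightarrow> real k * (T / N n) \<le> t \<longrightarrow> t \<le> real k * (T / N n) + T / N n \<longrightarrow>
          \<bar>scheme_incr b (\<kappa> n) (r n) (T / N n) \<psi> (real k * (T / N n)) z - (T / N n) * F (z, t)\<bar> \<le> (T / N n) * d"
      proof eventually_elim
        case (elim n)
        show ?case
        proof (intro allI impI)
          fix i :: nat and z :: "'a \<times> 'a" and t :: real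
          assume t: "real i * (T / N n) \<le> t" "t \<le> real i * (T / N n) + T / N n"
          obtain x v where z: "z = (x, v)" by (cases z)
          have "F (z, t) = ddir \<phi> (x, v, t) (fst (b (x, v)), snd (b (x, v)), 1) - frac_lap s (\<lambda>w. \<phi> (x, w, t)) v"
            by (simp add: F_def reassoc_def z weak_op_eq[OF sm] b_def)
          then show "\<bar>scheme_incr b (\<kappa> n) (r n) (T / N n) \<psi> (real i * (T / N n)) z - (T / N n) * F (z, t)\<bar> \<le> (T / N n) * d"
            using elim[rule_format, OF t] unfolding z by (simp only:)
        qed
      qed
    qed
    let ?S = "UNIV \<times> UNIV \<times> {0<..<T} :: ('a \<times> 'a \<times> real) set"
    let ?h = "\<lambda>p. indicator ?S p *\<^sub>R (f p * ?W p)"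
    have S: "?S \<in> sets borel" by (intro borel_Times) auto
    have hm: "?h \<in> borel_measurable borel" using S f Wm by measurable
    have ind: "indicator ?S (reassoc p) = indicator {0<..<T} (snd p)" for p :: "('a \<times> 'a) \<times> real"
      by (auto simp: reassoc_def indicator_def)
    \<comment> \<open>This is where redefining the exceptional slices is seen to be harmless for the
      weak equation.\<close>
    have AEh: "AE p in lborel. ?h (reassoc p) = T * (D p * F p)"
      using kD by eventually_elim (simp add: ind f_k F_def mult.assoc[symmetric])
    have hrm: "(\<lambda>p. ?h (reassoc p)) \<in> borel_measurable borel"
      using borel_measurable_reassoc hm by (rule measurable_compose)
    have DF: "integrable lborel (\<lambda>p. D p * F p)"
    proof (rule Bochner_Integration.integrable_bound[OF integrable_mult_left[OF D(3), of "C1 * (B * (1 + R) + 1) + C2"]])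
      show "(\<lambda>p. D p * F p) \<in> borel_measurable lborel" using D(1) Fm by simp
      show "AE p in lborel. norm (D p * F p) \<le> norm (D p * (C1 * (B * (1 + R) + 1) + C2))"
      proof (rule AE_I2)
        fix p
        have "\<bar>F p\<bar> \<le> \<bar>C1 * (B * (1 + R) + 1) + C2\<bar>" using WC[of "reassoc p"] unfolding F_def by linarith
        then show "norm (D p * F p) \<le> norm (D p * (C1 * (B * (1 + R) + 1) + C2))"
          using D(2)[of p] by (simp add: abs_mult mult_left_mono)
      qed
    qed
    have ih: "integrable lborel (\<lambda>p. ?h (reassoc p))"
      using AEh DF hrm D(1) Fm by (subst integrable_cong_AE[where g = "\<lambda>p. T * (D p * F p)"]) auto
    have Ih: "(\<integral>p. ?h (reassoc p) \<partial>lborel) = T * (\<integral>p. D p * F p \<partial>lborel)"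
      using AEh hrm D(1) Fm by (subst integral_cong_AE[where g = "\<lambda>p. T * (D p * F p)"]) auto
    have "integrable lborel ?h" using ih integral_reassoc(1)[OF hm] by simp
    then show "set_integrable lebesgue ?S (\<lambda>p. f p * ?W p)"
      unfolding set_integrable_def using hm by (simp add: integrable_completion)
    have "(\<integral>p\<in>?S. f p * ?W p \<partial>lebesgue) = (\<integral>p. ?h p \<partial>lborel)"
      unfolding set_lebesgue_integral_def using hm by (simp add: integral_completion)
    also have "\<dots> = T * (\<integral>p. D p * F p \<partial>lborel)"
      using integral_reassoc(2)[OF hm] Ih by simp
    finally have 1: "(\<integral>p\<in>?S. f p * ?W p \<partial>lebesgue) = T * (\<integral>p. D p * F p \<partial>lborel)" .
    have \<phi>0: "(\<lambda>z. \<psi> (z, 0)) \<in> borel_measurable borel"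
    proof -
      have "continuous_on UNIV (\<lambda>z. \<psi> (z, 0))"
        unfolding \<psi>_def
        by (intro continuous_on_compose2[OF smooth_fun_continuous[OF sm]] continuous_intros) auto
      then show ?thesis by (rule borel_measurable_continuous_onI)
    qed
    have "(\<integral>(x, v). f0 (x, v) * \<phi> (x, v, 0) \<partial>lebesgue) = (\<integral>z. f0 z * \<psi> (z, 0) \<partial>lebesgue)"
      by (intro Bochner_Integration.integral_cong) (auto simp: \<psi>_def)
    also have "\<dots> = (\<integral>z. g0 z * \<psi> (z, 0) \<partial>lebesgue)"
    proof (rule integral_cong_AE)
      have "(\<lambda>z. \<psi> (z, 0)) \<in> borel_measurable lebesgue" "g0 \<in> borel_measurable lebesgue"
        using \<phi>0 g0(1) by (auto intro!: measurable_completion)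
      then show "(\<lambda>z. f0 z * \<psi> (z, 0)) \<in> borel_measurable lebesgue" "(\<lambda>z. g0 z * \<psi> (z, 0)) \<in> borel_measurable lebesgue"
        using f0m by (auto intro: borel_measurable_times)
      show "AE z in lebesgue. f0 z * \<psi> (z, 0) = g0 z * \<psi> (z, 0)"
        using f0g0 by eventually_elim simp
    qed
    also have "\<dots> = (\<integral>z. g0 z * \<psi> (z, 0) \<partial>lborel)"
      using g0(1) \<phi>0 by (intro integral_completion) auto
    finally have 2: "(\<integral>(x, v). f0 (x, v) * \<phi> (x, v, 0) \<partial>lebesgue) = (\<integral>z. g0 z * \<psi> (z, 0) \<partial>lborel)" .
    \<comment> \<open>\<open>main\<close> carries the initial term divided by \<open>T\<close>;
      multiplying by \<open>T\<close> matches the rescaling in \<open>f\<close>.\<close>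
    show "(\<integral>p\<in>?S. f p * ?W p \<partial>lebesgue) + (\<integral>(x, v). f0 (x, v) * \<phi> (x, v, 0) \<partial>lebesgue) = 0"
      unfolding 1 2 using main T by (simp add: field_simps)
  qed
qed

end
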